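(* Let $G$ be a Lie group and let $K$ be a semisimple Lie subgroup of $G$, of codimension two, with Lie algebra $\mathfrak{k}$, generating a left-invariant foliation $\mathcal{F}$ on $G$. Let $g$ be a left-invariant semi-Riemannian metric on $G$ such that the restriction $h$ of $g$ to $K$ is the metric induced by the negative Killing form of $K$, i.e. $g(V,W) = -\operatorname{trace}(\operatorname{ad}_V\circ \operatorname{ad}_W)$ for all $V,W\in\mathfrak{k}$, where $\operatorname{ad}_V,\operatorname{ad}_W$ act on $\mathfrak{k}$. If the foliation $\mathcal{F}$ on $(G,g)$ is conformal, then it is totally geodesic.
   Context: A Lie group is semisimple if its Lie algebra is semisimple. Let $\mathfrak{g}$ be the Lie algebra of $G$. The foliation $\mathcal{F}$ generated by $K$ is the foliation tangent to the left-invariant integrable distribution $\mathcal{V}$ on $G$ obtained by left-translating $\mathfrak{k}\subset\mathfrak{g}$. Let $\mathcal{H}$ be the orthogonal complementary distribution of $\mathcal{V}$ with respect to $g$ (it has rank two); the symbols $\mathcal{V},\mathcal{H}$ also denote the orthogonal projections of $TG$ onto these subbundles. Let $\nabla$ be the Levi-Civita connection of $g$. The second fundamental forms are $$B^{\mathcal{V}}(V,W)=\tfrac12\,\mathcal{H}(\nabla_V W+\nabla_W V)\ \ (V,W\in\mathcal{V}),\qquad B^{\mathcal{H}}(X,Y)=\tfrac12\,\mathcal{V}(\nabla_X Y+\nabla_Y X)\ \ (X,Y\in\mathcal{H}).$$ The foliation $\mathcal{F}$ is conformal if there is a vector field $V\in\mathcal{V}$ such that $B^{\mathcal{H}}(X,Y)=g(X,Y)\,V$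 for all $X,Y\in\mathcal{H}$. It is totally geodesic if $B^{\mathcal{V}}=0$. *)

theory Defs
  imports
    "HOL-Analysis.Analysis"
    "HOL-Library.Function_Algebras"
    "HOL-Algebra.Group"
begin

section \<open>Linear algebra\<close>

text \<open>Tangent vectors below are operators on real-valued functions and vector fields are families
  of such operators, so both live in function spaces with the pointwise vector space structure.\<close>

instantiation "fun" :: (type, real_vector) real_vector
begin

definition scaleR_fun_def: "scaleR c f = (\<lambda>x. c *\<^sub>R f x)"

instance
  by standard (auto simp: scaleR_fun_def fun_eq_iff algebra_simps)

end

text \<open>The trace of a linear endomorphism \<open>T\<close> of the finite-dimensional subspace \<open>L\<close>; it does not
  depend on the basis. \<open>T\<close> need not be linear, or map into \<open>L\<close>, outside of \<open>L\<close>.\<close>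

definition trace_on :: "'v::real_vector set \<Rightarrow> ('v \<Rightarrow> 'v) \<Rightarrow> real" where
  "trace_on L T =
     (let B = (SOME B. independent B \<and> span B = L) in \<Sum>b\<in>B. representation B (T b) b)"

definition proj_along :: "'v::real_vector set \<Rightarrow> 'v set \<Rightarrow> 'v \<Rightarrow> 'v" where
  "proj_along A B v = (THE a. a \<in> A \<and> (\<exists>b\<in>B. v = a + b))"


section \<open>Lie algebras, given by a carrier subspace and a bracket\<close>

definition lie_ideal :: "('v::real_vector \<Rightarrow> 'v \<Rightarrow> 'v) \<Rightarrow> 'v set \<Rightarrow> 'v set \<Rightarrow> bool" where
  "lie_ideal br L I \<longleftrightarrow> subspace I \<and> I \<subseteq> L \<and> (\<forall>x\<in>L. \<forall>y\<in>I. br x y \<in> I)"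

definition derived_algebra :: "('v::real_vector \<Rightarrow> 'v \<Rightarrow> 'v) \<Rightarrow> 'v set \<Rightarrow> 'v set" where
  "derived_algebra br L = span {br x y |x y. x \<in> L \<and> y \<in> L}"

definition solvable_lie_algebra :: "('v::real_vector \<Rightarrow> 'v \<Rightarrow> 'v) \<Rightarrow> 'v set \<Rightarrow> bool" where
  "solvable_lie_algebra br L \<longleftrightarrow> (\<exists>n. (derived_algebra br ^^ n) L = {0})"

definition semisimple_lie_algebra :: "('v::real_vector \<Rightarrow> 'v \<Rightarrow> 'v) \<Rightarrow> 'v set \<Rightarrow> bool" where
  "semisimple_lie_algebra br L \<longleftrightarrow>
     (\<forall>I. lie_ideal br L I \<and> solvable_lie_algebra br I \<longrightarrow> I = {0})"

definition killing_form ::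
    "('v::real_vector \<Rightarrow> 'v \<Rightarrow> 'v) \<Rightarrow> 'v set \<Rightarrow> 'v \<Rightarrow> 'v \<Rightarrow> real" where
  "killing_form br L x y = trace_on L (br x \<circ> br y)"


section \<open>Smooth manifolds\<close>

text \<open>\<open>C\<^sup>k\<close> maps on an open subset of a finite-dimensional normed space, by recursion on
  directional derivatives.\<close>

primrec Ck_on ::
    "nat \<Rightarrow> 'e::real_normed_vector set \<Rightarrow> ('e \<Rightarrow> 'f::real_normed_vector) \<Rightarrow> bool" where
  "Ck_on 0 S f \<longleftrightarrow> continuous_on S f"
| "Ck_on (Suc k) S f \<longleftrightarrow>
     (\<forall>x\<in>S. f differentiable (at x)) \<and> (\<forall>v. Ck_on k S (\<lambda>x. frechet_derivative f (at x) v))"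

definition smooth_on ::
    "'e::real_normed_vector set \<Rightarrow> ('e \<Rightarrow> 'f::real_normed_vector) \<Rightarrow> bool" where
  "smooth_on S f \<longleftrightarrow> (\<forall>k. Ck_on k S f)"

text \<open>A manifold carries its own topology, so that an immersed subgroup can have a finer topology
  than the subspace topology. A chart \<open>(U, \<phi>)\<close> is a coordinate map \<open>\<phi>\<close> on the open set \<open>U\<close>;
  the values of \<open>\<phi>\<close> outside of \<open>U\<close> are irrelevant. The atlas need not be maximal. The model is a
  finite-dimensional normed space rather than a Euclidean one to allow dimension zero.\<close>

record ('a, 'e) mfd =
  mtop :: "'a topology"
  atlas :: "('a set \<times> ('a \<Rightarrow> 'e)) set"

definition smooth_manifold :: "('a, 'e::real_normed_vector) mfd \<Rightarrow> bool" where
  "smooth_manifold M \<longleftrightarrow>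
     (\<exists>B::'e set. finite B \<and> span B = UNIV) \<and>
     Hausdorff_space (mtop M) \<and> second_countable (mtop M) \<and>
     (\<Union>(U, \<phi>)\<in>atlas M. U) = topspace (mtop M) \<and>
     (\<forall>(U, \<phi>)\<in>atlas M.
        openin (mtop M) U \<and> open (\<phi> ` U) \<and>
        homeomorphic_map (subtopology (mtop M) U) (top_of_set (\<phi> ` U)) \<phi>) \<and>
     (\<forall>(U, \<phi>)\<in>atlas M. \<forall>(V, \<psi>)\<in>atlas M. smooth_on (\<phi> ` (U \<inter> V)) (\<psi> \<circ> inv_into U \<phi>))"

definition prod_mfd :: "('a, 'e) mfd \<Rightarrow> ('b, 'f) mfd \<Rightarrow> ('a \<times> 'b, 'e \<times> 'f) mfd" where
  "prod_mfd M N =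
     \<lparr>mtop = prod_topology (mtop M) (mtop N),
      atlas = {(U \<times> V, map_prod \<phi> \<psi>) |U \<phi> V \<psi>. (U, \<phi>) \<in> atlas M \<and> (V, \<psi>) \<in> atlas N}\<rparr>"

definition smooth_map :: "('a, 'e::real_normed_vector) mfd \<Rightarrow>
    ('b, 'f::real_normed_vector) mfd \<Rightarrow> ('a \<Rightarrow> 'b) \<Rightarrow> bool" where
  "smooth_map M N F \<longleftrightarrow>
     continuous_map (mtop M) (mtop N) F \<and>
     (\<forall>(U, \<phi>)\<in>atlas M. \<forall>(V, \<psi>)\<in>atlas N.
        smooth_on (\<phi> ` (U \<inter> F -` V)) (\<psi> \<circ> F \<circ> inv_into U \<phi>))"

definition smooth_fun ::
    "('a, 'e::real_normed_vector) mfd \<Rightarrow> 'a set \<Rightarrow> ('a \<Rightarrow> real) \<Rightarrow> bool" where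
  "smooth_fun M W f \<longleftrightarrow> (\<forall>(U, \<phi>)\<in>atlas M. smooth_on (\<phi> ` (U \<inter> W)) (f \<circ> inv_into U \<phi>))"

definition smooth_near ::
    "('a, 'e::real_normed_vector) mfd \<Rightarrow> 'a \<Rightarrow> ('a \<Rightarrow> real) \<Rightarrow> bool" where
  "smooth_near M p f \<longleftrightarrow> (\<exists>W. openin (mtop M) W \<and> p \<in> W \<and> smooth_fun M W f)"


section \<open>Tangent vectors and vector fields\<close>

text \<open>A tangent vector at \<open>p\<close> is the operator \<open>\<Sum>\<^sub>i u\<^sup>i \<partial>/\<partial>x\<^sup>i\<close> on functions smooth near \<open>p\<close>, with
  value \<open>0\<close> by convention on all other functions.\<close>

type_synonym 'a tvec = "('a \<Rightarrow> real) \<Rightarrow> real"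
type_synonym 'a vfield = "'a \<Rightarrow> 'a tvec"

definition tangent_space :: "('a, 'e::real_normed_vector) mfd \<Rightarrow> 'a \<Rightarrow> 'a tvec set" where
  "tangent_space M p =
     {v. \<exists>(U, \<phi>)\<in>atlas M. p \<in> U \<and>
        (\<exists>u. v = (\<lambda>f. if smooth_near M p f
                      then frechet_derivative (f \<circ> inv_into U \<phi>) (at (\<phi> p)) u else 0))}"

text \<open>The differential of \<open>F\<close>, a smooth map into \<open>N\<close>, at \<open>p\<close>.\<close>

definition differential ::
    "('b, 'f::real_normed_vector) mfd \<Rightarrow> ('a \<Rightarrow> 'b) \<Rightarrow> 'a \<Rightarrow> 'a tvec \<Rightarrow> 'b tvec" where
  "differential N F p v = (\<lambda>f. if smooth_near N (F p) f then v (f \<circ> F) else 0)"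

text \<open>Vector fields are smooth, and vanish outside of the manifold by convention.\<close>

definition vector_field :: "('a, 'e::real_normed_vector) mfd \<Rightarrow> 'a vfield \<Rightarrow> bool" where
  "vector_field M X \<longleftrightarrow>
     (\<forall>p\<in>topspace (mtop M). X p \<in> tangent_space M p) \<and>
     (\<forall>p. p \<notin> topspace (mtop M) \<longrightarrow> X p = 0) \<and>
     (\<forall>W f. openin (mtop M) W \<and> smooth_fun M W f \<longrightarrow> smooth_fun M W (\<lambda>p. X p f))"

definition lie_bracket ::
    "('a, 'e::real_normed_vector) mfd \<Rightarrow> 'a vfield \<Rightarrow> 'a vfield \<Rightarrow> 'a vfield" where
  "lie_bracket M X Y =
     (\<lambda>p f. if smooth_near M p f then X p (\<lambda>q. Y q f) - Y p (\<lambda>q. X q f) else 0)"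


section \<open>Semi-Riemannian metrics and the Levi-Civita connection\<close>

type_synonym 'a metric_field = "'a \<Rightarrow> 'a tvec \<Rightarrow> 'a tvec \<Rightarrow> real"

text \<open>Only the values of \<open>g p\<close> on \<open>tangent_space M p\<close>, for \<open>p\<close> in \<open>M\<close>, matter. Nondegeneracy makes
  the index locally constant; it is constant for left-invariant metrics.\<close>

definition semi_riemannian_metric ::
    "('a, 'e::real_normed_vector) mfd \<Rightarrow> 'a metric_field \<Rightarrow> bool" where
  "semi_riemannian_metric M g \<longleftrightarrow>
     (\<forall>p\<in>topspace (mtop M). \<forall>u\<in>tangent_space M p. \<forall>v\<in>tangent_space M p.
        g p u v = g p v u \<and>
        (\<forall>c. g p (c *\<^sub>R u) v = c * g p u v) \<and>
        (\<forall>w\<in>tangent_space M p. g p (u + v) w = g p u w + g p v w)) \<and>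
     (\<forall>p\<in>topspace (mtop M). \<forall>u\<in>tangent_space M p.
        (\<forall>v\<in>tangent_space M p. g p u v = 0) \<longrightarrow> u = 0) \<and>
     (\<forall>X Y. vector_field M X \<and> vector_field M Y \<longrightarrow>
        smooth_fun M (topspace (mtop M)) (\<lambda>p. g p (X p) (Y p)))"

text \<open>The pull-back of \<open>g\<close>, a metric on \<open>N\<close>, along \<open>F\<close>.\<close>

definition pullback_metric ::
    "('b, 'f::real_normed_vector) mfd \<Rightarrow> ('a \<Rightarrow> 'b) \<Rightarrow> 'b metric_field \<Rightarrow> 'a metric_field" where
  "pullback_metric N F g =
     (\<lambda>p v w. g (F p) (differential N F p v) (differential N F p w))"

definition levi_civita_connection :: "('a, 'e::real_normed_vector) mfd \<Rightarrow> 'a metric_field \<Rightarrow>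
    ('a vfield \<Rightarrow> 'a vfield \<Rightarrow> 'a vfield) \<Rightarrow> bool" where
  "levi_civita_connection M g nabla \<longleftrightarrow>
     (\<forall>X Y. vector_field M X \<and> vector_field M Y \<longrightarrow> vector_field M (nabla X Y)) \<and>
     (\<forall>X Y Z. vector_field M X \<and> vector_field M Y \<and> vector_field M Z \<longrightarrow>
        nabla (X + Y) Z = nabla X Z + nabla Y Z \<and>
        nabla X (Y + Z) = nabla X Y + nabla X Z) \<and>
     (\<forall>f X Y. smooth_fun M (topspace (mtop M)) f \<and> vector_field M X \<and> vector_field M Y \<longrightarrow>
        nabla (\<lambda>p. f p *\<^sub>R X p) Y = (\<lambda>p. f p *\<^sub>R nabla X Y p) \<and>
        nabla X (\<lambda>p. f p *\<^sub>R Y p) = (\<lambda>p. X p f *\<^sub>R Y p + f p *\<^sub>R nabla X Y p)) \<and>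
     (\<forall>X Y. vector_field M X \<and> vector_field M Y \<longrightarrow>
        nabla X Y - nabla Y X = lie_bracket M X Y) \<and>
     (\<forall>X Y Z. vector_field M X \<and> vector_field M Y \<and> vector_field M Z \<longrightarrow>
        (\<forall>p\<in>topspace (mtop M).
           X p (\<lambda>q. g q (Y q) (Z q)) = g p (nabla X Y p) (Z p) + g p (Y p) (nabla X Z p)))"


section \<open>Distributions and foliations\<close>

text \<open>A distribution assigns to each point a subspace of the tangent space. A foliation is
  represented by the distribution tangent to it.\<close>

type_synonym 'a distribution = "'a \<Rightarrow> 'a tvec set"

definition is_section ::
    "('a, 'e::real_normed_vector) mfd \<Rightarrow> 'a distribution \<Rightarrow> 'a vfield \<Rightarrow> bool" where
  "is_section M D X \<longleftrightarrow> vector_field M X \<and> (\<forall>p\<in>topspace (mtop M). X p \<in> D p)"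

definition orth_distribution ::
    "('a, 'e::real_normed_vector) mfd \<Rightarrow> 'a metric_field \<Rightarrow> 'a distribution \<Rightarrow> 'a distribution" where
  "orth_distribution M g D = (\<lambda>p. {w \<in> tangent_space M p. \<forall>v\<in>D p. g p v w = 0})"

definition vert_proj :: "('a, 'e::real_normed_vector) mfd \<Rightarrow> 'a metric_field \<Rightarrow>
    'a distribution \<Rightarrow> 'a vfield \<Rightarrow> 'a vfield" where
  "vert_proj M g D X = (\<lambda>p. proj_along (D p) (orth_distribution M g D p) (X p))"

definition hor_proj :: "('a, 'e::real_normed_vector) mfd \<Rightarrow> 'a metric_field \<Rightarrow>
    'a distribution \<Rightarrow> 'a vfield \<Rightarrow> 'a vfield" where
  "hor_proj M g D X = (\<lambda>p. proj_along (orth_distribution M g D p) (D p) (X p))"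

definition second_form_vert :: "('a, 'e::real_normed_vector) mfd \<Rightarrow> 'a metric_field \<Rightarrow>
    ('a vfield \<Rightarrow> 'a vfield \<Rightarrow> 'a vfield) \<Rightarrow> 'a distribution \<Rightarrow>
    'a vfield \<Rightarrow> 'a vfield \<Rightarrow> 'a vfield" where
  "second_form_vert M g nabla D V W = (1/2) *\<^sub>R hor_proj M g D (nabla V W + nabla W V)"

definition second_form_hor :: "('a, 'e::real_normed_vector) mfd \<Rightarrow> 'a metric_field \<Rightarrow>
    ('a vfield \<Rightarrow> 'a vfield \<Rightarrow> 'a vfield) \<Rightarrow> 'a distribution \<Rightarrow>
    'a vfield \<Rightarrow> 'a vfield \<Rightarrow> 'a vfield" where
  "second_form_hor M g nabla D X Y = (1/2) *\<^sub>R vert_proj M g D (nabla X Y + nabla Y X)"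

definition conformal_foliation :: "('a, 'e::real_normed_vector) mfd \<Rightarrow> 'a metric_field \<Rightarrow>
    ('a vfield \<Rightarrow> 'a vfield \<Rightarrow> 'a vfield) \<Rightarrow> 'a distribution \<Rightarrow> bool" where
  "conformal_foliation M g nabla D \<longleftrightarrow>
     (\<exists>V. is_section M D V \<and>
        (\<forall>X Y. is_section M (orth_distribution M g D) X \<and>
               is_section M (orth_distribution M g D) Y \<longrightarrow>
           (\<forall>p\<in>topspace (mtop M).
              second_form_hor M g nabla D X Y p = g p (X p) (Y p) *\<^sub>R V p)))"

definition totally_geodesic_foliation :: "('a, 'e::real_normed_vector) mfd \<Rightarrow> 'a metric_field \<Rightarrow>
    ('a vfield \<Rightarrow> 'a vfield \<Rightarrow> 'a vfield) \<Rightarrow> 'a distribution \<Rightarrow> bool" where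
  "totally_geodesic_foliation M g nabla D \<longleftrightarrow>
     (\<forall>V W. is_section M D V \<and> is_section M D W \<longrightarrow>
        (\<forall>p\<in>topspace (mtop M). second_form_vert M g nabla D V W p = 0))"


section \<open>Lie groups\<close>

definition lie_group :: "'a monoid \<Rightarrow> ('a, 'e::real_normed_vector) mfd \<Rightarrow> bool" where
  "lie_group G M \<longleftrightarrow>
     group G \<and> smooth_manifold M \<and> topspace (mtop M) = carrier G \<and>
     smooth_map (prod_mfd M M) M (\<lambda>(x, y). x \<otimes>\<^bsub>G\<^esub> y) \<and>
     smooth_map M M (\<lambda>x. inv\<^bsub>G\<^esub> x)"

text \<open>The Lie algebra of left-invariant vector fields, with bracket \<open>lie_bracket M\<close>.\<close>

definition lie_algebra :: "'a monoid \<Rightarrow> ('a, 'e::real_normed_vector) mfd \<Rightarrow> 'a vfield set" where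
  "lie_algebra G M =
     {X. vector_field M X \<and>
         (\<forall>a\<in>carrier G. \<forall>b\<in>carrier G.
            X (a \<otimes>\<^bsub>G\<^esub> b) = differential M (\<lambda>x. a \<otimes>\<^bsub>G\<^esub> x) b (X b))}"

definition semisimple_lie_group :: "'a monoid \<Rightarrow> ('a, 'e::real_normed_vector) mfd \<Rightarrow> bool" where
  "semisimple_lie_group G M \<longleftrightarrow>
     lie_group G M \<and> semisimple_lie_algebra (lie_bracket M) (lie_algebra G M)"

definition left_invariant_metric ::
    "'a monoid \<Rightarrow> ('a, 'e::real_normed_vector) mfd \<Rightarrow> 'a metric_field \<Rightarrow> bool" where
  "left_invariant_metric G M g \<longleftrightarrow>
     (\<forall>a\<in>carrier G. \<forall>b\<in>carrier G. \<forall>v\<in>tangent_space M b. \<forall>w\<in>tangent_space M b.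
        g (a \<otimes>\<^bsub>G\<^esub> b) (differential M (\<lambda>x. a \<otimes>\<^bsub>G\<^esub> x) b v)
                      (differential M (\<lambda>x. a \<otimes>\<^bsub>G\<^esub> x) b w) = g b v w)"

text \<open>A Lie subgroup is a subgroup \<open>K\<close> with a Lie group structure, given by the manifold \<open>N\<close>, for
  which the inclusion is an immersion.\<close>

definition lie_subgroup :: "'a monoid \<Rightarrow> ('a, 'e::real_normed_vector) mfd \<Rightarrow> 'a set \<Rightarrow>
    ('a, 'f::real_normed_vector) mfd \<Rightarrow> bool" where
  "lie_subgroup G M K N \<longleftrightarrow>
     subgroup K G \<and> lie_group (G\<lparr>carrier := K\<rparr>) N \<and> smooth_map N M id \<and>
     (\<forall>p\<in>K. inj_on (differential M id p) (tangent_space N p))"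

text \<open>The Lie algebra of \<open>K\<close> as a subalgebra of that of \<open>G\<close>: the image of the homomorphism induced
  by the inclusion, which sends a left-invariant field \<open>Y\<close> on \<open>K\<close> to the left-invariant field on
  \<open>G\<close> with the same value at the identity.\<close>

definition subgroup_algebra :: "'a monoid \<Rightarrow> ('a, 'e::real_normed_vector) mfd \<Rightarrow> 'a set \<Rightarrow>
    ('a, 'f::real_normed_vector) mfd \<Rightarrow> 'a vfield set" where
  "subgroup_algebra G M K N =
     {X \<in> lie_algebra G M. \<exists>Y\<in>lie_algebra (G\<lparr>carrier := K\<rparr>) N.
        X \<one>\<^bsub>G\<^esub> = differential M id \<one>\<^bsub>G\<^esub> (Y \<one>\<^bsub>G\<^esub>)}"

definition subgroup_foliation :: "'a monoid \<Rightarrow> ('a, 'e::real_normed_vector) mfd \<Rightarrow> 'a set \<Rightarrow>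
    ('a, 'f::real_normed_vector) mfd \<Rightarrow> 'a distribution" where
  "subgroup_foliation G M K N = (\<lambda>p. {X p |X. X \<in> subgroup_algebra G M K N})"

end

theory Submission
  imports Defs
begin

text \<open>Why the theorem is true. Write \<open>\<gg>\<close>, \<open>\<kk>\<close> for the Lie algebras of \<open>G\<close>, \<open>K\<close> and \<open>H\<close> for the orthogonal
complement of \<open>\<kk>\<close> in \<open>\<gg>\<close>, which has rank two. By the Koszul formula, conformality of the foliation
says that for every \<open>V\<close> in \<open>\<kk>\<close> the \<open>H\<close>-part of \<open>ad V\<close> is an infinitesimal conformal map of \<open>H\<close>: a
multiple of the identity plus a skew map. On a space of rank two the skew maps form a line, so
these maps commute. Modulo \<open>\<kk>\<close>, \<open>ad\<close> is a representation of \<open>\<kk>\<close> on \<open>H\<close>, hence brackets of \<open>\<kk>\<close> act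
trivially on \<open>H\<close> (\<open>brackets_act_trivially\<close>). The Killing form of \<open>\<kk>\<close> is nondegenerate, being up to
sign the metric of \<open>K\<close>, and an element orthogonal to all brackets is central and therefore null for
the Killing form; so a functional on \<open>\<kk>\<close> that vanishes on brackets is zero
(\<open>functional_vanishing_on_brackets\<close>), and all of \<open>\<kk>\<close> acts trivially. This means that \<open>[X, V]\<close> lies in
\<open>\<kk>\<close> for \<open>X\<close> in \<open>H\<close> and \<open>V\<close> in \<open>\<kk>\<close>. So \<open>ad X\<close> is a derivation of \<open>\<kk>\<close>, and derivations are skew for the
Killing form (\<open>killing_form_derivation\<close>), that is, for the metric. By the Koszul formula again,
\<open>g([X, V], W) + g(V, [X, W])\<close> is the \<open>X\<close>-component of \<open>\<nabla>\<^sub>V W + \<nabla>\<^sub>W V\<close>, which therefore vanishes.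

Passing between the manifolds and their Lie algebras takes the following facts. Every tangent
vector extends to a smooth left-invariant field (\<open>left_ext_in_lie_algebra\<close>), which identifies \<open>\<gg>\<close> with
the tangent space at the identity and gives the dimension count. The bracket of two vector fields is a
vector field (\<open>vector_field_lie_bracket\<close>); this rests on the symmetry of second derivatives. Brackets
of related fields are related (\<open>vf_related_lie_bracket\<close>), so left-invariant fields and the fields
coming from \<open>K\<close> are closed under brackets. Finally the second fundamental form of arbitrary sections
reduces to left-invariant ones, since the basis of \<open>\<kk>\<close> is a global frame of the foliation whose
coefficient functions are smooth because the metric is (\<open>nabla_section\<close>).\<close>

section \<open>Coordinates in finite-dimensional normed spaces\<close>

text \<open>The model space of a manifold is only known to be spanned by a finite set; it need not be of class
\<open>euclidean_space\<close>, so bases are carried explicitly.\<close>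

definition finite_basis :: "'e::real_vector set \<Rightarrow> bool" where
  "finite_basis B \<longleftrightarrow> finite B \<and> independent B \<and> span B = UNIV"

lemma ex_finite_basis:
  fixes C :: "'e::real_vector set"
  assumes "finite C" "span C = UNIV"
  obtains B where "finite_basis (B :: 'e set)"
proof -
  obtain B where B: "B \<subseteq> C" "independent B" "C \<subseteq> span B"
    using maximal_independent_subset by blast
  then have "span B = UNIV"
    by (metis assms(2) span_eq top.extremum_uniqueI span_minimal subspace_span)
  with B assms show thesis
    by (intro that[of B]) (auto simp: finite_basis_def intro: finite_subset)
qed

lemma finite_basis_card:
  fixes B :: "'e::real_vector set"
  shows "finite_basis B \<Longrightarrow> card B = dim (UNIV :: 'e set)"
  unfolding finite_basis_def by (metis dim_eq_card_independent dim_span)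

lemma finite_basis_expand:
  assumes "finite_basis B"
  shows "(\<Sum>b\<in>B. representation B x b *\<^sub>R b) = x"
  using assms unfolding finite_basis_def by (simp add: real_vector.sum_representation_eq)

text \<open>Induction on the basis. If the coefficients over \<open>B\<close> are bounded by the norm, then \<open>span B\<close> is closed:
the coefficients of a convergent sequence are Cauchy. A new basis vector \<open>v\<close> thus has a positive
distance from \<open>span B\<close>, which bounds the coefficient of \<open>v\<close> and then the remaining ones.\<close>

lemma coefficients_bounded:
  fixes B :: "'e::real_normed_vector set"
  assumes "finite B" "independent B"
  shows "\<exists>C>0. \<forall>a. \<forall>b\<in>B. \<bar>a b\<bar> \<le> C * norm (\<Sum>b\<in>B. a b *\<^sub>R b)"
  using assms
proof (induction B rule: finite_induct)
  case empty
  then show ?case by (auto intro: exI[of _ 1])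
next
  case (insert v B)
  then have ind: "independent B" and v: "v \<notin> span B"
    by (auto simp: independent_insert)
  obtain C where C: "C > 0" "\<And>a b. b \<in> B \<Longrightarrow> \<bar>a b\<bar> \<le> C * norm (\<Sum>b\<in>B. a b *\<^sub>R b)"
    using insert.IH[OF ind] by blast
  have "closed (span B)"
    unfolding closed_sequential_limits
  proof (intro allI impI, elim conjE)
    fix x l assume x: "\<forall>n. x n \<in> span B" and xl: "x \<longlonglongrightarrow> l"
    have "\<forall>n. \<exists>a. x n = (\<Sum>b\<in>B. a b *\<^sub>R b)"
      using x span_finite[OF insert.hyps(1)] by auto
    then obtain a where a: "\<And>n. x n = (\<Sum>b\<in>B. a n b *\<^sub>R b)" by metis
    have "Cauchy (\<lambda>n. a n b)" if "b \<in> B" for b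
    proof (rule metric_CauchyI)
      fix e :: real assume "e > 0"
      then obtain N where N: "\<And>m n. m \<ge> N \<Longrightarrow> n \<ge> N \<Longrightarrow> dist (x m) (x n) < e / C"
        using LIMSEQ_imp_Cauchy[OF xl] C(1) unfolding Cauchy_def by (meson divide_pos_pos)
      have "dist (a m b) (a n b) < e" if "m \<ge> N" "n \<ge> N" for m n
      proof -
        have "\<bar>a m b - a n b\<bar> \<le> C * norm (x m - x n)"
          using C(2)[OF \<open>b \<in> B\<close>, of "\<lambda>b. a m b - a n b"]
          by (simp add: a scaleR_diff_left sum_subtractf)
        also have "\<dots> < e" using N[OF that] C(1) by (simp add: dist_norm field_simps)
        finally show ?thesis by (simp add: dist_real_def)
      qed
      then show "\<exists>M. \<forall>m\<ge>M. \<forall>n\<ge>M. dist (a m b) (a n b) < e" by blast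
    qed
    then have "\<forall>b\<in>B. \<exists>c. (\<lambda>n. a n b) \<longlonglongrightarrow> c"
      using Cauchy_convergent convergent_def by blast
    then obtain c where c: "\<And>b. b \<in> B \<Longrightarrow> (\<lambda>n. a n b) \<longlonglongrightarrow> c b" by metis
    have "x \<longlonglongrightarrow> (\<Sum>b\<in>B. c b *\<^sub>R b)"
      unfolding a[abs_def] by (intro tendsto_sum tendsto_scaleR c tendsto_const)
    then have "l = (\<Sum>b\<in>B. c b *\<^sub>R b)" using xl LIMSEQ_unique by blast
    then show "l \<in> span B" by (simp add: span_sum span_scale span_base)
  qed
  then obtain e where e: "e > 0" "\<And>w. w \<in> span B \<Longrightarrow> e \<le> dist v w"
    using v open_contains_ball[of "- span B"] unfolding closed_def
    by (metis ComplI ComplD mem_ball not_less subsetD)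
  define C' where "C' = max (1/e) (C * (1 + norm v / e))"
  have "\<bar>a b\<bar> \<le> C' * norm (\<Sum>b\<in>insert v B. a b *\<^sub>R b)" if b: "b \<in> insert v B" for a b
  proof -
    define w where "w = (\<Sum>b\<in>B. a b *\<^sub>R b)"
    have w: "w \<in> span B" by (simp add: w_def span_sum span_scale span_base)
    define s where "s = a v *\<^sub>R v + w"
    have s: "(\<Sum>b\<in>insert v B. a b *\<^sub>R b) = s"
      using insert.hyps by (simp add: s_def w_def)
    have av: "\<bar>a v\<bar> * e \<le> norm s"
    proof (cases "a v = 0")
      case False
      have "e \<le> dist v ((- 1 / a v) *\<^sub>R w)" using e(2) w span_scale by blast
      then have "\<bar>a v\<bar> * e \<le> norm (a v *\<^sub>R (v - (- 1 / a v) *\<^sub>R w))"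
        by (simp add: dist_norm mult_left_mono)
      also have "a v *\<^sub>R (v - (- 1 / a v) *\<^sub>R w) = s"
        using False by (simp add: s_def scaleR_add_right)
      finally show ?thesis .
    qed simp
    then have av': "\<bar>a v\<bar> \<le> (1/e) * norm s" using e(1) by (simp add: field_simps)
    show ?thesis
    proof (cases "b = v")
      case True
      have "(1/e) * norm s \<le> C' * norm s" by (intro mult_right_mono) (auto simp: C'_def)
      with av' True s show ?thesis by simp
    next
      case False
      then have "\<bar>a b\<bar> \<le> C * norm w" using C(2) b w_def by auto
      also have "norm w \<le> norm s + \<bar>a v\<bar> * norm v"
        using norm_triangle_ineq4[of s "a v *\<^sub>R v"] by (simp add: s_def)
      also have "\<dots> \<le> norm s + (1/e) * norm s * norm v"
        using av' by (intro add_left_mono mult_right_mono) auto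
      also have "C * (norm s + (1/e) * norm s * norm v) = C * (1 + norm v / e) * norm s"
        by (simp add: field_simps)
      also have "\<dots> \<le> C' * norm s" by (intro mult_right_mono) (auto simp: C'_def)
      finally show ?thesis using s C(1) by simp
    qed
  qed
  moreover have "C' > 0" using e(1) by (simp add: C'_def less_max_iff_disj)
  ultimately show ?case by blast
qed

lemma bounded_linear_representation:
  fixes B :: "'e::real_normed_vector set"
  assumes "finite_basis B" and "b \<in> B"
  shows "bounded_linear (\<lambda>x. representation B x b)"
proof -
  have fin: "finite B" and ind: "independent B" and sp: "\<And>x. x \<in> span B"
    using assms(1) by (simp_all add: finite_basis_def)
  obtain C where C: "C > 0" "\<forall>a. \<forall>b\<in>B. \<bar>a b\<bar> \<le> C * norm (\<Sum>b\<in>B. a b *\<^sub>R b)"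
    using coefficients_bounded[OF fin ind] by (elim exE conjE)
  show ?thesis
  proof (rule bounded_linear_intro)
    show "representation B (x + y) b = representation B x b + representation B y b" for x y
      by (simp only: real_vector.representation_add[OF ind sp sp])
    show "representation B (r *\<^sub>R x) b = r *\<^sub>R representation B x b" for r x
      by (simp only: real_vector.representation_scale[OF ind sp] real_scaleR_def)
    show "norm (representation B x b) \<le> norm x * C" for x
    proof -
      have "\<bar>representation B x b\<bar> \<le> C * norm (\<Sum>b\<in>B. representation B x b *\<^sub>R b)"
        using C(2) assms(2) by (elim allE ballE) auto
      then show ?thesis by (simp add: finite_basis_expand[OF assms(1)] mult.commute)
    qed
  qed
qed

section \<open>Calculus of \<open>C\<^sup>k\<close> maps\<close>

lemma Ck_on_subset: "Ck_on k S f \<Longrightarrow> T \<subseteq> S \<Longrightarrow> Ck_on k T f"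
  by (induction k arbitrary: f) (auto intro: continuous_on_subset)

lemma Ck_on_cong:
  assumes "open S" "\<And>x. x \<in> S \<Longrightarrow> f x = g x" "Ck_on k S f"
  shows "Ck_on k S g"
  using assms(2,3)
proof (induction k arbitrary: f g)
  case 0
  then show ?case using continuous_on_cong[OF refl, of S f g] by simp
next
  case (Suc k)
  have hd: "(g has_derivative frechet_derivative f (at x)) (at x)" if "x \<in> S" for x
    using Suc.prems that assms(1) has_derivative_transform_within_open[of f _ x UNIV S g]
    by (auto simp: frechet_derivative_works)
  then have "frechet_derivative g (at x) = frechet_derivative f (at x)" if "x \<in> S" for x
    using that frechet_derivative_at by metis
  then show ?case using hd Suc.prems Suc.IH[of "\<lambda>x. frechet_derivative f (at x) _" "\<lambda>x. frechet_derivative g (at x) _"]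
    by (auto simp: differentiable_def)
qed

lemma Ck_on_local:
  assumes "\<And>x. x \<in> S \<Longrightarrow> \<exists>T. open T \<and> x \<in> T \<and> Ck_on k T f"
  shows "Ck_on k S f"
  using assms
proof (induction k arbitrary: f)
  case 0
  have "continuous (at x within S) f" if "x \<in> S" for x
    using 0[OF that] by (auto simp: continuous_on_eq_continuous_at continuous_at_imp_continuous_at_within)
  then show ?case by (simp add: continuous_on_eq_continuous_within)
next
  case (Suc k)
  show ?case
    unfolding Ck_on.simps
  proof (intro conjI ballI allI)
    show "f differentiable at x" if "x \<in> S" for x
      using Suc.prems[OF that] by auto
    show "Ck_on k S (\<lambda>x. frechet_derivative f (at x) v)" for v
    proof (rule Suc.IH)
      show "\<exists>T. open T \<and> x \<in> T \<and> Ck_on k T (\<lambda>x. frechet_derivative f (at x) v)" if "x \<in> S" for x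
        using Suc.prems[OF that] by auto
    qed
  qed
qed

lemma Ck_on_SucD: "Ck_on (Suc k) S f \<Longrightarrow> Ck_on k S f"
proof (induction k arbitrary: f)
  case 0
  then have "continuous (at x within S) f" if "x \<in> S" for x
    using that by (simp add: differentiable_imp_continuous_within continuous_at_imp_continuous_at_within)
  then show ?case by (simp add: continuous_on_eq_continuous_within)
next
  case (Suc k)
  then show ?case by simp
qed

lemma Ck_on_SucI:
  assumes "open S" "\<And>x. x \<in> S \<Longrightarrow> (f has_derivative D x) (at x)" "\<And>v. Ck_on k S (\<lambda>x. D x v)"
  shows "Ck_on (Suc k) S f"
proof -
  have "frechet_derivative f (at x) = D x" if "x \<in> S" for x
    using assms(2)[OF that] frechet_derivative_at by metis
  then show ?thesis
    using assms Ck_on_cong[OF assms(1), of "\<lambda>x. D x _" "\<lambda>x. frechet_derivative f (at x) _"]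
    by (auto simp: differentiable_def)
qed

lemma Ck_on_has_derivative:
  assumes "Ck_on (Suc k) S f" "x \<in> S"
  shows "(f has_derivative frechet_derivative f (at x)) (at x)"
  using assms by (simp add: frechet_derivative_works)

lemma Ck_on_const: "open S \<Longrightarrow> Ck_on k S (\<lambda>x. c)"
  by (induction k arbitrary: c) auto

lemma Ck_on_add: "open S \<Longrightarrow> Ck_on k S f \<Longrightarrow> Ck_on k S g \<Longrightarrow> Ck_on k S (\<lambda>x. f x + g x)"
proof (induction k arbitrary: f g)
  case 0
  then show ?case by (simp add: continuous_on_add)
next
  case (Suc k)
  show ?case
  proof (rule Ck_on_SucI[OF Suc.prems(1)])
    show "((\<lambda>x. f x + g x) has_derivative
        (\<lambda>v. frechet_derivative f (at x) v + frechet_derivative g (at x) v)) (at x)" if "x \<in> S" for x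
      using Ck_on_has_derivative[OF Suc.prems(2) that] Ck_on_has_derivative[OF Suc.prems(3) that]
      by (rule has_derivative_add)
  qed (use Suc in auto)
qed

lemma Ck_on_sum:
  assumes "open S" "finite I" "\<And>i. i \<in> I \<Longrightarrow> Ck_on k S (f i)"
  shows "Ck_on k S (\<lambda>x. \<Sum>i\<in>I. f i x)"
  using assms(2,3) by (induction I rule: finite_induct) (auto intro: Ck_on_const Ck_on_add assms(1))

lemma Ck_on_scaleR:
  fixes f :: "_ \<Rightarrow> real"
  shows "open S \<Longrightarrow> Ck_on k S f \<Longrightarrow> Ck_on k S g \<Longrightarrow> Ck_on k S (\<lambda>x. f x *\<^sub>R g x)"
proof (induction k arbitrary: f g)
  case 0
  then show ?case by (simp add: continuous_on_scaleR)
next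
  case (Suc k)
  show ?case
  proof (rule Ck_on_SucI[OF Suc.prems(1)])
    show "((\<lambda>x. f x *\<^sub>R g x) has_derivative
        (\<lambda>v. f x *\<^sub>R frechet_derivative g (at x) v + frechet_derivative f (at x) v *\<^sub>R g x)) (at x)" if "x \<in> S" for x
      using Ck_on_has_derivative[OF Suc.prems(2) that] Ck_on_has_derivative[OF Suc.prems(3) that]
      by (rule has_derivative_scaleR)
    show "Ck_on k S (\<lambda>x. f x *\<^sub>R frechet_derivative g (at x) v + frechet_derivative f (at x) v *\<^sub>R g x)" for v
      using Suc.prems Ck_on_SucD[OF Suc.prems(2)] Ck_on_SucD[OF Suc.prems(3)]
      by (intro Ck_on_add Suc.IH) auto
  qed
qed

lemma Ck_on_mult:
  fixes f g :: "_ \<Rightarrow> real"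
  shows "open S \<Longrightarrow> Ck_on k S f \<Longrightarrow> Ck_on k S g \<Longrightarrow> Ck_on k S (\<lambda>x. f x * g x)"
  using Ck_on_scaleR[of S k f g] by simp

lemma Ck_on_bounded_linear_comp:
  assumes "bounded_linear l" "open S"
  shows "Ck_on k S f \<Longrightarrow> Ck_on k S (\<lambda>x. l (f x))"
proof (induction k arbitrary: f)
  case 0
  then show ?case using linear_continuous_on[OF assms(1)] 
    by (simp add: bounded_linear.continuous_on[OF assms(1)])
next
  case (Suc k)
  show ?case
  proof (rule Ck_on_SucI[OF assms(2)])
    show "((\<lambda>x. l (f x)) has_derivative (\<lambda>v. l (frechet_derivative f (at x) v))) (at x)" if "x \<in> S" for x
      using bounded_linear.has_derivative[OF assms(1) Ck_on_has_derivative[OF Suc.prems that]] .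
  qed (use Suc in auto)
qed

lemma Ck_on_ident: "open S \<Longrightarrow> Ck_on k S (\<lambda>x. x)"
  by (cases k) (auto intro: Ck_on_const)

lemma Ck_on_Pair:
  assumes "open S" "Ck_on k S f" "Ck_on k S g"
  shows "Ck_on k S (\<lambda>x. (f x, g x))"
proof -
  have "Ck_on k S (\<lambda>x. (f x, 0) + (0, g x))"
    using assms
    by (intro Ck_on_add Ck_on_bounded_linear_comp[where f = f and l = "\<lambda>y. (y, 0)"]
        Ck_on_bounded_linear_comp[where f = g and l = "\<lambda>y. (0, y)"])
      (auto intro!: bounded_linear_Pair bounded_linear_ident bounded_linear_zero)
  then show ?thesis by simp
qed

text \<open>The derivative \<open>Dg(f x)(Df(x) v)\<close> evaluates \<open>Dg\<close> in a direction that varies with \<open>x\<close>, whereas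
\<open>Ck_on\<close> speaks of fixed directions only. Expanding \<open>Df(x) v\<close> in a basis turns it into a sum of products
to which the induction hypothesis applies; this is where finite dimension enters.\<close>

lemma Ck_on_compose:
  fixes f :: "'d::real_normed_vector \<Rightarrow> 'e::real_normed_vector"
    and g :: "'e \<Rightarrow> 'f::real_normed_vector"
  assumes "finite_basis (B :: 'e set)" and "open S" and "open T"
  shows "Ck_on k S f \<Longrightarrow> Ck_on k T g \<Longrightarrow> f ` S \<subseteq> T \<Longrightarrow> Ck_on k S (\<lambda>x. g (f x))"
proof (induction k arbitrary: f g)
  case 0
  then show ?case using continuous_on_compose2[of T g S f] by auto
next
  case (Suc k)
  let ?D = "\<lambda>x v. \<Sum>b\<in>B. representation B (frechet_derivative f (at x) v) b *\<^sub>R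
     frechet_derivative g (at (f x)) b"
  show ?case
  proof (rule Ck_on_SucI[OF \<open>open S\<close>])
    fix x assume x: "x \<in> S"
    then have lin: "linear (frechet_derivative g (at (f x)))"
      using Suc.prems by (intro linear_frechet_derivative) auto
    have eq: "frechet_derivative g (at (f x)) (frechet_derivative f (at x) v) = ?D x v" for v
      by (subst finite_basis_expand[OF assms(1), symmetric])
        (simp add: linear_sum[OF lin] linear_scale[OF lin])
    have "((\<lambda>x. g (f x)) has_derivative
       (\<lambda>v. frechet_derivative g (at (f x)) (frechet_derivative f (at x) v))) (at x)"
      using has_derivative_compose[OF Ck_on_has_derivative[OF Suc.prems(1) x], 
          of g "frechet_derivative g (at (f x))"]
       Ck_on_has_derivative[OF Suc.prems(2), of "f x"] Suc.prems(3) x by auto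
    then show "((\<lambda>x. g (f x)) has_derivative ?D x) (at x)" by (simp add: eq)
  next
    fix v
    show "Ck_on k S (\<lambda>x. ?D x v)"
      using assms Suc.prems Ck_on_SucD[OF Suc.prems(1)]
      by (intro Ck_on_sum Ck_on_scaleR Suc.IH Ck_on_bounded_linear_comp[OF bounded_linear_representation])
        (auto simp: finite_basis_def)
  qed
qed

section \<open>Symmetry of second derivatives\<close>

lemma has_real_derivative_along_line:
  fixes f :: "'e::real_normed_vector \<Rightarrow> real"
  assumes "f differentiable (at (y + t *\<^sub>R u))"
  shows "((\<lambda>t. f (y + t *\<^sub>R u)) has_real_derivative frechet_derivative f (at (y + t *\<^sub>R u)) u) (at t)"
proof -
  have "((\<lambda>t. y + t *\<^sub>R u) has_derivative (\<lambda>h. h *\<^sub>R u)) (at t)"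
    by (auto intro!: derivative_eq_intros)
  moreover have "(f has_derivative frechet_derivative f (at (y + t *\<^sub>R u))) (at (y + t *\<^sub>R u))"
    using assms by (simp add: frechet_derivative_works)
  ultimately have "((\<lambda>t. f (y + t *\<^sub>R u)) has_derivative
      (\<lambda>h. frechet_derivative f (at (y + t *\<^sub>R u)) (h *\<^sub>R u))) (at t)"
    by (rule has_derivative_compose)
  moreover have "frechet_derivative f (at (y + t *\<^sub>R u)) (h *\<^sub>R u) =
      frechet_derivative f (at (y + t *\<^sub>R u)) u * h" for h
    using linear_scale[OF linear_frechet_derivative[OF assms]] by simp
  ultimately show ?thesis by (simp add: has_field_derivative_def)
qed

text \<open>The mean value theorem applied twice. The left-hand side of the equation is symmetric in \<open>u\<close> and \<open>v\<close>,
which is what makes the second derivative symmetric.\<close>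

lemma second_difference_mvt:
  fixes f :: "'e::real_normed_vector \<Rightarrow> real"
  assumes C2: "Ck_on (Suc (Suc 0)) S f" and s: "s > 0"
    and sub: "\<And>\<sigma> \<tau>. 0 \<le> \<sigma> \<Longrightarrow> \<sigma> \<le> s \<Longrightarrow> 0 \<le> \<tau> \<Longrightarrow> \<tau> \<le> s \<Longrightarrow> x + \<sigma> *\<^sub>R u + \<tau> *\<^sub>R v \<in> S"
  obtains \<sigma> \<tau> where "0 \<le> \<sigma>" "\<sigma> \<le> s" "0 \<le> \<tau>" "\<tau> \<le> s"
    "f (x + s *\<^sub>R u + s *\<^sub>R v) - f (x + s *\<^sub>R u) - f (x + s *\<^sub>R v) + f x =
     s * (s * frechet_derivative (\<lambda>y. frechet_derivative f (at y) u) (at (x + \<sigma> *\<^sub>R u + \<tau> *\<^sub>R v)) v)"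
proof -
  let ?D = "\<lambda>y. frechet_derivative f (at y) u"
  have df: "f differentiable (at y)" "?D differentiable (at y)" if "y \<in> S" for y
    using C2 that by auto
  \<comment> \<open>in direction \<open>u\<close>, for the increment of \<open>f\<close> along \<open>s v\<close>\<close>
  have "\<exists>\<sigma>>0. \<sigma> < s \<and> (f (x + s *\<^sub>R v + s *\<^sub>R u) - f (x + s *\<^sub>R u)) - (f (x + s *\<^sub>R v + 0 *\<^sub>R u) - f (x + 0 *\<^sub>R u)) =
      (s - 0) * (?D (x + s *\<^sub>R v + \<sigma> *\<^sub>R u) - ?D (x + \<sigma> *\<^sub>R u))"
  proof (rule MVT2[OF s])
    fix \<sigma> assume "0 \<le> \<sigma>" "\<sigma> \<le> s"
    then show "((\<lambda>\<sigma>. f (x + s *\<^sub>R v + \<sigma> *\<^sub>R u) - f (x + \<sigma> *\<^sub>R u)) has_real_derivative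
        ?D (x + s *\<^sub>R v + \<sigma> *\<^sub>R u) - ?D (x + \<sigma> *\<^sub>R u)) (at \<sigma>)"
      using s sub[of \<sigma> s] sub[of \<sigma> 0]
      by (intro DERIV_diff has_real_derivative_along_line df) (auto simp: algebra_simps)
  qed
  then obtain \<sigma> where \<sigma>: "0 < \<sigma>" "\<sigma> < s" and eq1:
    "(f (x + s *\<^sub>R v + s *\<^sub>R u) - f (x + s *\<^sub>R u)) - (f (x + s *\<^sub>R v) - f x) =
      s * (?D (x + s *\<^sub>R v + \<sigma> *\<^sub>R u) - ?D (x + \<sigma> *\<^sub>R u))" by auto
  \<comment> \<open>in direction \<open>v\<close>, for the directional derivative along \<open>u\<close>\<close>
  have "\<exists>\<tau>>0. \<tau> < s \<and> ?D ((x + \<sigma> *\<^sub>R u) + s *\<^sub>R v) - ?D ((x + \<sigma> *\<^sub>R u) + 0 *\<^sub>R v) =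
      (s - 0) * frechet_derivative ?D (at ((x + \<sigma> *\<^sub>R u) + \<tau> *\<^sub>R v)) v"
    using \<sigma> by (intro MVT2[OF s] has_real_derivative_along_line df sub) auto
  then obtain \<tau> where "0 < \<tau>" "\<tau> < s" and
    "?D (x + s *\<^sub>R v + \<sigma> *\<^sub>R u) - ?D (x + \<sigma> *\<^sub>R u) = s * frechet_derivative ?D (at (x + \<sigma> *\<^sub>R u + \<tau> *\<^sub>R v)) v"
    by (auto simp: algebra_simps)
  then show thesis using eq1 \<sigma> by (intro that[of \<sigma> \<tau>]) (auto simp: algebra_simps)
qed

text \<open>On a small parallelogram at \<open>x\<close> both mixed derivatives take a common value, namely the second
difference of \<open>f\<close> divided by the square of the side; both are continuous at \<open>x\<close>.\<close>

lemma second_derivative_symmetric: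
  fixes f :: "'e::real_normed_vector \<Rightarrow> real"
  assumes "open S" and C2: "Ck_on (Suc (Suc 0)) S f" and "x \<in> S"
  shows "frechet_derivative (\<lambda>y. frechet_derivative f (at y) u) (at x) v =
         frechet_derivative (\<lambda>y. frechet_derivative f (at y) v) (at x) u"
proof (rule ccontr)
  define H where "H u v y = frechet_derivative (\<lambda>y. frechet_derivative f (at y) u) (at y) v" for u v y
  assume "\<not> ?thesis"
  then have ne: "H u v x \<noteq> H v u x" by (simp add: H_def)
  define e where "e = dist (H u v x) (H v u x) / 2"
  have e: "e > 0" using ne by (simp add: e_def)
  have cont: "isCont (H u v) x" for u v
    using C2 assms(1,3) by (simp add: H_def[abs_def] continuous_on_eq_continuous_at)
  obtain d1 where d1: "d1 > 0" "\<And>y. dist y x < d1 \<Longrightarrow> dist (H u v y) (H u v x) < e"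
    using cont[of u v] e unfolding continuous_at_eps_delta by blast
  obtain d2 where d2: "d2 > 0" "\<And>y. dist y x < d2 \<Longrightarrow> dist (H v u y) (H v u x) < e"
    using cont[of v u] e unfolding continuous_at_eps_delta by blast
  obtain d3 where d3: "d3 > 0" "\<And>y. dist y x < d3 \<Longrightarrow> y \<in> S"
    using assms(1,3) unfolding open_dist by blast
  define d where "d = min d1 (min d2 d3)"
  define s where "s = d / (norm u + norm v + 1)"
  have dpos: "d > 0" using d1 d2 d3 by (simp add: d_def)
  have pos: "norm u + norm v + 1 > 0" by (simp add: add_nonneg_pos)
  have s: "s > 0" using dpos pos by (simp add: s_def)
  have near: "dist (x + \<sigma> *\<^sub>R u + \<tau> *\<^sub>R v) x < d" "dist (x + \<tau> *\<^sub>R v + \<sigma> *\<^sub>R u) x < d"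
    if "0 \<le> \<sigma>" "\<sigma> \<le> s" "0 \<le> \<tau>" "\<tau> \<le> s" for \<sigma> \<tau>
  proof -
    have "dist (x + \<sigma> *\<^sub>R u + \<tau> *\<^sub>R v) x = norm (\<sigma> *\<^sub>R u + \<tau> *\<^sub>R v)"
      by (simp add: dist_norm add.assoc)
    also have "\<dots> \<le> \<sigma> * norm u + \<tau> * norm v"
      using norm_triangle_ineq[of "\<sigma> *\<^sub>R u" "\<tau> *\<^sub>R v"] that by simp
    also have "\<dots> \<le> s * norm u + s * norm v"
      using that by (intro add_mono mult_right_mono) auto
    also have "\<dots> < s * (norm u + norm v + 1)" using s by (simp add: algebra_simps)
    also have "\<dots> = d" using pos by (simp add: s_def)
    finally show "dist (x + \<sigma> *\<^sub>R u + \<tau> *\<^sub>R v) x < d" .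
    then show "dist (x + \<tau> *\<^sub>R v + \<sigma> *\<^sub>R u) x < d" by (simp add: ac_simps)
  qed
  have inS: "y \<in> S" if "dist y x < d" for y using d3 that by (simp add: d_def)
  obtain \<sigma> \<tau> where 1: "0 \<le> \<sigma>" "\<sigma> \<le> s" "0 \<le> \<tau>" "\<tau> \<le> s"
    "f (x + s *\<^sub>R u + s *\<^sub>R v) - f (x + s *\<^sub>R u) - f (x + s *\<^sub>R v) + f x =
     s * (s * H u v (x + \<sigma> *\<^sub>R u + \<tau> *\<^sub>R v))"
    unfolding H_def by (rule second_difference_mvt[OF C2 s, of x u v]) (use near inS in blast)+
  obtain \<sigma>' \<tau>' where 2: "0 \<le> \<sigma>'" "\<sigma>' \<le> s" "0 \<le> \<tau>'" "\<tau>' \<le> s"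
    "f (x + s *\<^sub>R v + s *\<^sub>R u) - f (x + s *\<^sub>R v) - f (x + s *\<^sub>R u) + f x =
     s * (s * H v u (x + \<sigma>' *\<^sub>R v + \<tau>' *\<^sub>R u))"
    unfolding H_def by (rule second_difference_mvt[OF C2 s, of x v u]) (use near inS in blast)+
  have "s * (s * H u v (x + \<sigma> *\<^sub>R u + \<tau> *\<^sub>R v)) = s * (s * H v u (x + \<sigma>' *\<^sub>R v + \<tau>' *\<^sub>R u))"
    unfolding 1(5)[symmetric] 2(5)[symmetric] by (simp add: ac_simps)
  then have eq: "H u v (x + \<sigma> *\<^sub>R u + \<tau> *\<^sub>R v) = H v u (x + \<sigma>' *\<^sub>R v + \<tau>' *\<^sub>R u)"
    using s by simp
  have "dist (H u v (x + \<sigma> *\<^sub>R u + \<tau> *\<^sub>R v)) (H u v x) < e"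
    using near(1)[OF 1(1-4)] by (intro d1) (simp add: d_def)
  moreover have "dist (H v u (x + \<sigma>' *\<^sub>R v + \<tau>' *\<^sub>R u)) (H v u x) < e"
    using near(2)[OF 2(3,4,1,2)] by (intro d2) (simp add: d_def)
  ultimately have "dist (H u v x) (H v u x) < e + e"
    using eq dist_triangle_less_add[of "H u v x" _ e "H v u x" e] by (metis dist_commute)
  then show False by (simp add: e_def)
qed

section \<open>Smooth functions on manifolds\<close>

text \<open>This weakening of \<open>smooth_manifold\<close> is what most arguments below use, and it passes to products at
once, so that multiplication can be treated as a map on a product without showing that
products are manifolds.\<close>

definition open_charts :: "('a, 'e::real_normed_vector) mfd \<Rightarrow> bool" where
  "open_charts M \<longleftrightarrow> (\<Union>(U, \<phi>)\<in>atlas M. U) = topspace (mtop M) \<and>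
     (\<forall>(U, \<phi>)\<in>atlas M. openin (mtop M) U \<and> inj_on \<phi> U \<and>
        (\<forall>W. openin (mtop M) W \<longrightarrow> open (\<phi> ` (U \<inter> W))))"

lemma smooth_manifold_open_charts:
  assumes "smooth_manifold M"
  shows "open_charts M"
proof -
  have cover: "(\<Union>(U, \<phi>)\<in>atlas M. U) = topspace (mtop M)"
    using assms by (simp add: smooth_manifold_def)
  moreover have "openin (mtop M) U \<and> inj_on \<phi> U \<and>
      (\<forall>W. openin (mtop M) W \<longrightarrow> open (\<phi> ` (U \<inter> W)))" if "(U, \<phi>) \<in> atlas M" for U \<phi>
  proof -
    have U: "openin (mtop M) U" "open (\<phi> ` U)"
      "homeomorphic_map (subtopology (mtop M) U) (top_of_set (\<phi> ` U)) \<phi>"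
      using assms that unfolding smooth_manifold_def by blast+
    have ts: "topspace (subtopology (mtop M) U) = U"
      using U(1) openin_subset by (auto simp: topspace_subtopology)
    have "inj_on \<phi> U" using U(3) ts by (simp add: homeomorphic_eq_everything_map)
    moreover have "open (\<phi> ` (U \<inter> W))" if W: "openin (mtop M) W" for W
    proof -
      have "openin (subtopology (mtop M) U) (U \<inter> W)"
        using W by (auto simp: openin_subtopology)
      moreover have "open_map (subtopology (mtop M) U) (top_of_set (\<phi> ` U)) \<phi>"
        using U(3) by (simp add: homeomorphic_eq_everything_map)
      ultimately have "openin (top_of_set (\<phi> ` U)) (\<phi> ` (U \<inter> W))"
        by (simp add: open_map_def)
      then show ?thesis using U(2) by (simp add: openin_open_eq)
    qed
    ultimately show ?thesis using U(1) by blast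
  qed
  ultimately show ?thesis unfolding open_charts_def by blast
qed

lemma open_charts_prod:
  assumes "open_charts M" "open_charts N"
  shows "open_charts (prod_mfd M N)"
proof -
  have chart: "(R, \<theta>) \<in> atlas (prod_mfd M N) \<longleftrightarrow>
      (\<exists>U \<phi> V \<psi>. R = U \<times> V \<and> \<theta> = map_prod \<phi> \<psi> \<and> (U, \<phi>) \<in> atlas M \<and> (V, \<psi>) \<in> atlas N)" for R \<theta>
    by (simp add: prod_mfd_def)
  have "(\<Union>(U, \<phi>)\<in>atlas M. U) \<times> (\<Union>(V, \<psi>)\<in>atlas N. V) = (\<Union>(R, \<theta>)\<in>atlas (prod_mfd M N). R)"
  proof (intro equalityI subsetI)
    fix z assume "z \<in> (\<Union>(U, \<phi>)\<in>atlas M. U) \<times> (\<Union>(V, \<psi>)\<in>atlas N. V)"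
    then obtain U \<phi> V \<psi> where z: "(U, \<phi>) \<in> atlas M" "(V, \<psi>) \<in> atlas N" "z \<in> U \<times> V" by auto
    then have "(U \<times> V, map_prod \<phi> \<psi>) \<in> atlas (prod_mfd M N)" unfolding chart by blast
    with z(3) show "z \<in> (\<Union>(R, \<theta>)\<in>atlas (prod_mfd M N). R)" by blast
  next
    fix z assume "z \<in> (\<Union>(R, \<theta>)\<in>atlas (prod_mfd M N). R)"
    then obtain R \<theta> where "(R, \<theta>) \<in> atlas (prod_mfd M N)" "z \<in> R" by blast
    then show "z \<in> (\<Union>(U, \<phi>)\<in>atlas M. U) \<times> (\<Union>(V, \<psi>)\<in>atlas N. V)"
      unfolding chart by blast
  qed
  then have "(\<Union>(U, \<phi>)\<in>atlas (prod_mfd M N). U) = topspace (mtop (prod_mfd M N))"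
    using assms by (simp add: open_charts_def prod_mfd_def)
  moreover have "openin (prod_topology (mtop M) (mtop N)) (U \<times> V) \<and>
      inj_on (map_prod \<phi> \<psi>) (U \<times> V) \<and>
      (\<forall>W. openin (prod_topology (mtop M) (mtop N)) W \<longrightarrow> open (map_prod \<phi> \<psi> ` (U \<times> V \<inter> W)))"
    if "(U, \<phi>) \<in> atlas M" "(V, \<psi>) \<in> atlas N" for U \<phi> V \<psi>
  proof -
    have M: "openin (mtop M) U" "inj_on \<phi> U" "\<And>W. openin (mtop M) W \<Longrightarrow> open (\<phi> ` (U \<inter> W))"
      using that(1) assms(1) unfolding open_charts_def by blast+
    have N: "openin (mtop N) V" "inj_on \<psi> V" "\<And>W. openin (mtop N) W \<Longrightarrow> open (\<psi> ` (V \<inter> W))"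
      using that(2) assms(2) unfolding open_charts_def by blast+
    have "open (map_prod \<phi> \<psi> ` (U \<times> V \<inter> W))"
      if W: "openin (prod_topology (mtop M) (mtop N)) W" for W
      unfolding open_prod_def
    proof
      fix z assume "z \<in> map_prod \<phi> \<psi> ` (U \<times> V \<inter> W)"
      then obtain p q where pq: "p \<in> U" "q \<in> V" "(p, q) \<in> W" "z = (\<phi> p, \<psi> q)" by auto
      obtain A C where AC: "openin (mtop M) A" "openin (mtop N) C" "p \<in> A" "q \<in> C" "A \<times> C \<subseteq> W"
        using W pq(3) unfolding openin_prod_topology_alt by metis
      show "\<exists>A B. open A \<and> open B \<and> z \<in> A \<times> B \<and> A \<times> B \<subseteq> map_prod \<phi> \<psi> ` (U \<times> V \<inter> W)"
        using M(3)[OF AC(1)] N(3)[OF AC(2)] pq AC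
        by (intro exI[of _ "\<phi> ` (U \<inter> A)"] exI[of _ "\<psi> ` (V \<inter> C)"]) fastforce
    qed
    moreover have "inj_on (map_prod \<phi> \<psi>) (U \<times> V)"
      using M(2) N(2) by (rule map_prod_inj_on)
    ultimately show ?thesis using M(1) N(1) by (simp add: openin_prod_Times_iff)
  qed
  moreover have "mtop (prod_mfd M N) = prod_topology (mtop M) (mtop N)" by (simp add: prod_mfd_def)
  ultimately show ?thesis
    unfolding open_charts_def case_prod_beta' by (auto simp: chart)
qed

lemma open_chartsD:
  assumes "open_charts M" "(U, \<phi>) \<in> atlas M"
  shows "openin (mtop M) U" "inj_on \<phi> U" "openin (mtop M) W \<Longrightarrow> open (\<phi> ` (U \<inter> W))"
    "U \<subseteq> topspace (mtop M)"
  using assms unfolding open_charts_def by blast+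

lemma chart_at:
  assumes "open_charts M" "p \<in> topspace (mtop M)"
  obtains U \<phi> where "(U, \<phi>) \<in> atlas M" "p \<in> U"
proof -
  have "p \<in> (\<Union>(U, \<phi>)\<in>atlas M. U)" using assms by (simp add: open_charts_def)
  then show thesis using that by blast
qed

lemma smooth_funI:
  assumes "\<And>U \<phi> k. (U, \<phi>) \<in> atlas M \<Longrightarrow> Ck_on k (\<phi> ` (U \<inter> W)) (f \<circ> inv_into U \<phi>)"
  shows "smooth_fun M W f"
  using assms unfolding smooth_fun_def smooth_on_def by blast

lemma smooth_funD:
  "smooth_fun M W f \<Longrightarrow> (U, \<phi>) \<in> atlas M \<Longrightarrow> Ck_on k (\<phi> ` (U \<inter> W)) (f \<circ> inv_into U \<phi>)"
  unfolding smooth_fun_def smooth_on_def by blast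

lemma smooth_fun_subset: "smooth_fun M W f \<Longrightarrow> V \<subseteq> W \<Longrightarrow> smooth_fun M V f"
  by (rule smooth_funI, rule Ck_on_subset[OF smooth_funD]) auto

lemma smooth_fun_cong:
  assumes "open_charts M" "openin (mtop M) W" "\<And>q. q \<in> W \<Longrightarrow> f q = h q" "smooth_fun M W f"
  shows "smooth_fun M W h"
proof (rule smooth_funI)
  fix U \<phi> k assume c: "(U, \<phi>) \<in> atlas M"
  show "Ck_on k (\<phi> ` (U \<inter> W)) (h \<circ> inv_into U \<phi>)"
    using open_chartsD[OF assms(1) c] assms(2,3)
    by (intro Ck_on_cong[OF _ _ smooth_funD[OF assms(4) c]]) auto
qed

lemma smooth_fun_const: "open_charts M \<Longrightarrow> openin (mtop M) W \<Longrightarrow> smooth_fun M W (\<lambda>_. c)"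
  by (rule smooth_funI) (simp add: comp_def Ck_on_const open_chartsD)

lemma smooth_fun_add:
  assumes "open_charts M" "openin (mtop M) W" "smooth_fun M W f" "smooth_fun M W h"
  shows "smooth_fun M W (\<lambda>q. f q + h q)"
proof (rule smooth_funI)
  fix U \<phi> k assume c: "(U, \<phi>) \<in> atlas M"
  show "Ck_on k (\<phi> ` (U \<inter> W)) ((\<lambda>q. f q + h q) \<circ> inv_into U \<phi>)"
    using Ck_on_add[OF open_chartsD(3)[OF assms(1) c assms(2)] smooth_funD[OF assms(3) c, of k] smooth_funD[OF assms(4) c]]
    by (simp add: comp_def)
qed

lemma smooth_fun_mult:
  assumes "open_charts M" "openin (mtop M) W" "smooth_fun M W f" "smooth_fun M W h"
  shows "smooth_fun M W (\<lambda>q. f q * h q)"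
proof (rule smooth_funI)
  fix U \<phi> k assume c: "(U, \<phi>) \<in> atlas M"
  show "Ck_on k (\<phi> ` (U \<inter> W)) ((\<lambda>q. f q * h q) \<circ> inv_into U \<phi>)"
    using Ck_on_mult[OF open_chartsD(3)[OF assms(1) c assms(2)] smooth_funD[OF assms(3) c, of k] smooth_funD[OF assms(4) c]]
    by (simp add: comp_def)
qed

lemma smooth_fun_diff:
  assumes "open_charts M" "openin (mtop M) W" "smooth_fun M W f" "smooth_fun M W h"
  shows "smooth_fun M W (\<lambda>q. f q - h q)"
  using smooth_fun_add[OF assms(1-3) smooth_fun_mult[OF assms(1,2) smooth_fun_const[OF assms(1,2), of "- 1"] assms(4)]]
  by simp

lemma smooth_mapD:
  "smooth_map M N F \<Longrightarrow> (U, \<phi>) \<in> atlas M \<Longrightarrow> (V, \<psi>) \<in> atlas N \<Longrightarrow>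
    Ck_on k (\<phi> ` (U \<inter> F -` V)) (\<psi> \<circ> F \<circ> inv_into U \<phi>)"
  unfolding smooth_map_def smooth_on_def by blast

lemma smooth_map_openin:
  assumes "smooth_map M N F" "openin (mtop N) V"
  shows "openin (mtop M) (topspace (mtop M) \<inter> F -` V)"
  using assms unfolding smooth_map_def continuous_map_alt by (metis inf_commute)

lemma smooth_map_topspace:
  "smooth_map M N F \<Longrightarrow> p \<in> topspace (mtop M) \<Longrightarrow> F p \<in> topspace (mtop N)"
  unfolding smooth_map_def continuous_map_def by blast

lemma smooth_map_id:
  assumes "smooth_manifold M"
  shows "smooth_map M M id"
  using assms unfolding smooth_manifold_def smooth_map_def by (simp add: Int_def)

lemma smooth_manifold_finite_basis:
  fixes M :: "('a, 'e::real_normed_vector) mfd"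
  assumes "smooth_manifold M"
  obtains B where "finite_basis (B :: 'e set)"
  using assms ex_finite_basis unfolding smooth_manifold_def by metis

lemma smooth_fun_pullback:
  assumes M: "open_charts M" and N: "smooth_manifold N" and F: "smooth_map M N F"
    and W: "openin (mtop N) W" and f: "smooth_fun N W f"
  shows "smooth_fun M (topspace (mtop M) \<inter> F -` W) (f \<circ> F)"
proof (rule smooth_funI, rule Ck_on_local)
  fix U \<phi> k x assume c: "(U, \<phi>) \<in> atlas M" and "x \<in> \<phi> ` (U \<inter> (topspace (mtop M) \<inter> F -` W))"
  then obtain p where p: "p \<in> U" "p \<in> topspace (mtop M)" "F p \<in> W" "x = \<phi> p" by blast
  note Nc = smooth_manifold_open_charts[OF N]
  obtain V \<psi> where V: "(V, \<psi>) \<in> atlas N" "F p \<in> V"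
    using chart_at[OF Nc] smooth_map_topspace[OF F p(2)] by blast
  let ?O = "topspace (mtop M) \<inter> F -` (V \<inter> W)"
  have O: "openin (mtop M) ?O"
    using open_chartsD(1)[OF Nc V(1)] W by (intro smooth_map_openin[OF F]) blast
  let ?S = "\<phi> ` (U \<inter> ?O)"
  note S = open_chartsD(3)[OF M c O]
  obtain B :: "'d set" where B: "finite_basis B" using smooth_manifold_finite_basis[OF N] .
  have "Ck_on k ?S (\<lambda>y. (f \<circ> inv_into V \<psi>) ((\<psi> \<circ> F \<circ> inv_into U \<phi>) y))"
  proof (rule Ck_on_compose[OF B S open_chartsD(3)[OF Nc V(1) W]])
    show "Ck_on k ?S (\<psi> \<circ> F \<circ> inv_into U \<phi>)"
      by (rule Ck_on_subset[OF smooth_mapD[OF F c V(1)]]) auto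
    show "Ck_on k (\<psi> ` (V \<inter> W)) (f \<circ> inv_into V \<psi>)" by (rule smooth_funD[OF f V(1)])
    show "(\<psi> \<circ> F \<circ> inv_into U \<phi>) ` ?S \<subseteq> \<psi> ` (V \<inter> W)"
      using open_chartsD(2)[OF M c] by auto
  qed
  then have "Ck_on k ?S (f \<circ> F \<circ> inv_into U \<phi>)"
    using open_chartsD(2)[OF M c] open_chartsD(2)[OF Nc V(1)]
    by (rule_tac Ck_on_cong[OF S]) auto
  then show "\<exists>T. open T \<and> x \<in> T \<and> Ck_on k T (f \<circ> F \<circ> inv_into U \<phi>)"
    using S p V by (intro exI[of _ ?S]) auto
qed

lemma smooth_nearI: "smooth_fun M W f \<Longrightarrow> openin (mtop M) W \<Longrightarrow> p \<in> W \<Longrightarrow> smooth_near M p f"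
  unfolding smooth_near_def by (intro exI[of _ W] conjI)

lemma smooth_near_pullback:
  assumes "open_charts M" "smooth_manifold N" "smooth_map M N F" "p \<in> topspace (mtop M)"
    "smooth_near N (F p) f"
  shows "smooth_near M p (f \<circ> F)"
proof -
  obtain W where "openin (mtop N) W" "F p \<in> W" "smooth_fun N W f"
    using assms(5) unfolding smooth_near_def by blast
  then show ?thesis
    using smooth_fun_pullback[OF assms(1-3)] smooth_map_openin[OF assms(3)] assms(4)
    unfolding smooth_near_def by (intro exI[of _ "topspace (mtop M) \<inter> F -` W"]) auto
qed

text \<open>Coordinate functions are smooth, because changes of charts are.\<close>

lemma smooth_fun_chart:
  assumes M: "smooth_manifold M" and c: "(U, \<phi>) \<in> atlas M" and l: "bounded_linear l"
  shows "smooth_fun M U (l \<circ> \<phi>)"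
proof (rule smooth_funI)
  fix V \<psi> k assume c': "(V, \<psi>) \<in> atlas M"
  note Mc = smooth_manifold_open_charts[OF M]
  have "Ck_on k (\<psi> ` (V \<inter> id -` U)) (\<phi> \<circ> id \<circ> inv_into V \<psi>)"
    by (rule smooth_mapD[OF smooth_map_id[OF M] c' c])
  then show "Ck_on k (\<psi> ` (V \<inter> U)) (l \<circ> \<phi> \<circ> inv_into V \<psi>)"
    using Ck_on_bounded_linear_comp[OF l open_chartsD(3)[OF Mc c' open_chartsD(1)[OF Mc c]]]
    by (simp add: comp_def)
qed

lemma smooth_near_cong:
  assumes "open_charts M" "openin (mtop M) W" "p \<in> W" "\<And>q. q \<in> W \<Longrightarrow> f q = h q" "smooth_near M p f"
  shows "smooth_near M p h"
proof -
  obtain V where "openin (mtop M) V" "p \<in> V" "smooth_fun M V f"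
    using assms(5) unfolding smooth_near_def by blast
  then have "smooth_fun M (V \<inter> W) h" "openin (mtop M) (V \<inter> W)" "p \<in> V \<inter> W"
    using assms by (auto intro!: smooth_fun_cong[of M "V \<inter> W" f h] intro: smooth_fun_subset)
  then show ?thesis unfolding smooth_near_def by blast
qed

lemma smooth_near_combine:
  assumes "open_charts M" "smooth_near M p f" "smooth_near M p h"
  shows "smooth_near M p (\<lambda>q. f q + h q)" "smooth_near M p (\<lambda>q. f q - h q)"
proof -
  obtain V W where "openin (mtop M) V" "p \<in> V" "smooth_fun M V f"
    "openin (mtop M) W" "p \<in> W" "smooth_fun M W h"
    using assms(2,3) unfolding smooth_near_def by blast
  then have *: "openin (mtop M) (V \<inter> W)" "p \<in> V \<inter> W" "smooth_fun M (V \<inter> W) f" "smooth_fun M (V \<inter> W) h"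
    by (auto intro: smooth_fun_subset)
  then show "smooth_near M p (\<lambda>q. f q + h q)" "smooth_near M p (\<lambda>q. f q - h q)"
    using smooth_nearI[OF smooth_fun_add[OF assms(1) *(1,3,4)] *(1,2)]
      smooth_nearI[OF smooth_fun_diff[OF assms(1) *(1,3,4)] *(1,2)] by simp_all
qed

section \<open>Tangent vectors\<close>

text \<open>The tangent vector at \<open>p\<close> with components \<open>u\<close> in the chart \<open>\<phi>\<close>.\<close>

definition chart_vec ::
    "('a, 'e::real_normed_vector) mfd \<Rightarrow> 'a set \<Rightarrow> ('a \<Rightarrow> 'e) \<Rightarrow> 'a \<Rightarrow> 'e \<Rightarrow> 'a tvec" where
  "chart_vec M U \<phi> p u = (\<lambda>f. if smooth_near M p f
     then frechet_derivative (f \<circ> inv_into U \<phi>) (at (\<phi> p)) u else 0)"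

lemma tangent_space_chart_vec:
  "tangent_space M p = {v. \<exists>(U, \<phi>)\<in>atlas M. p \<in> U \<and> (\<exists>u. v = chart_vec M U \<phi> p u)}"
  by (simp add: tangent_space_def chart_vec_def)

lemma smooth_near_differentiable:
  assumes "open_charts M" "(U, \<phi>) \<in> atlas M" "p \<in> U" "smooth_near M p f"
  shows "(f \<circ> inv_into U \<phi>) differentiable (at (\<phi> p))"
proof -
  obtain W where "openin (mtop M) W" "p \<in> W" "smooth_fun M W f"
    using assms(4) unfolding smooth_near_def by blast
  then show ?thesis using smooth_funD[OF _ assms(2), of W f "Suc 0"] assms(3) by auto
qed

text \<open>In charts the differential is the Jacobian. For the identity map this is the transformation rule for
the components of a tangent vector under a change of charts.\<close>

lemma differential_chart_vec:
  assumes M: "smooth_manifold M" and N: "smooth_manifold N" and F: "smooth_map M N F"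
    and c: "(U, \<phi>) \<in> atlas M" "p \<in> U" and d: "(V, \<psi>) \<in> atlas N" "F p \<in> V"
  shows "differential N F p (chart_vec M U \<phi> p u) =
    chart_vec N V \<psi> (F p) (frechet_derivative (\<psi> \<circ> F \<circ> inv_into U \<phi>) (at (\<phi> p)) u)"
proof
  fix f
  note Mc = smooth_manifold_open_charts[OF M] and Nc = smooth_manifold_open_charts[OF N]
  have p: "p \<in> topspace (mtop M)" using open_chartsD(4)[OF Mc c(1)] c(2) by blast
  show "differential N F p (chart_vec M U \<phi> p u) f =
    chart_vec N V \<psi> (F p) (frechet_derivative (\<psi> \<circ> F \<circ> inv_into U \<phi>) (at (\<phi> p)) u) f"
  proof (cases "smooth_near N (F p) f")
    case True
    let ?h = "\<psi> \<circ> F \<circ> inv_into U \<phi>"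
    let ?O = "topspace (mtop M) \<inter> F -` V"
    have "openin (mtop M) ?O" by (rule smooth_map_openin[OF F open_chartsD(1)[OF Nc d(1)]])
    note S = open_chartsD(3)[OF Mc c(1) this]
    have x: "\<phi> p \<in> \<phi> ` (U \<inter> ?O)" using p c d by blast
    have h: "?h differentiable (at (\<phi> p))"
      using smooth_mapD[OF F c(1) d(1), of "Suc 0"] x by auto
    have hp: "?h (\<phi> p) = \<psi> (F p)" using open_chartsD(2)[OF Mc c(1)] c(2) by simp
    have f: "(f \<circ> inv_into V \<psi>) differentiable (at (?h (\<phi> p)))"
      unfolding hp by (rule smooth_near_differentiable[OF Nc d True])
    have eq: "frechet_derivative ((f \<circ> inv_into V \<psi>) \<circ> ?h) (at (\<phi> p)) =
        frechet_derivative (f \<circ> F \<circ> inv_into U \<phi>) (at (\<phi> p))"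
      using open_chartsD(2)[OF Mc c(1)] open_chartsD(2)[OF Nc d(1)]
      by (intro frechet_derivative_transform_within_open[OF differentiable_chain_at[OF h f] S x]) auto
    have "smooth_near M p (f \<circ> F)" by (rule smooth_near_pullback[OF Mc N F p True])
    then have "differential N F p (chart_vec M U \<phi> p u) f =
        frechet_derivative (f \<circ> F \<circ> inv_into U \<phi>) (at (\<phi> p)) u"
      using True by (simp add: differential_def chart_vec_def)
    also have "\<dots> = frechet_derivative (f \<circ> inv_into V \<psi>) (at (\<psi> (F p)))
        (frechet_derivative ?h (at (\<phi> p)) u)"
      unfolding eq[symmetric] frechet_derivative_compose[OF h f] hp by (simp only: o_apply)
    finally show ?thesis using True by (simp add: chart_vec_def)
  qed (simp add: differential_def chart_vec_def)
qed

text \<open>One chart suffices, by the transformation rule of components.\<close>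

lemma tangent_space_chart:
  assumes M: "smooth_manifold M" and c: "(U, \<phi>) \<in> atlas M" "p \<in> U"
  shows "tangent_space M p = range (chart_vec M U \<phi> p)"
proof -
  have "chart_vec M V \<psi> p u \<in> range (chart_vec M U \<phi> p)" if "(V, \<psi>) \<in> atlas M" "p \<in> V" for V \<psi> u
  proof -
    have "differential M id p (chart_vec M V \<psi> p u) = chart_vec M V \<psi> p u"
      by (auto simp: differential_def chart_vec_def)
    then show ?thesis
      using differential_chart_vec[OF M M smooth_map_id[OF M] that, of U \<phi> u] c rangeI
      by (metis id_apply)
  qed
  then show ?thesis using c unfolding tangent_space_chart_vec by blast
qed

lemma differential_in_tangent_space:
  assumes M: "smooth_manifold M" and N: "smooth_manifold N" and F: "smooth_map M N F"
    and p: "p \<in> topspace (mtop M)" and v: "v \<in> tangent_space M p"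
  shows "differential N F p v \<in> tangent_space N (F p)"
proof -
  obtain V \<psi> where d: "(V, \<psi>) \<in> atlas N" "F p \<in> V"
    using chart_at[OF smooth_manifold_open_charts[OF N]] smooth_map_topspace[OF F p] by blast
  then show ?thesis
    using v unfolding tangent_space_chart[OF N d] unfolding tangent_space_chart_vec
    using differential_chart_vec[OF M N F _ _ d] by fast
qed

lemma linear_chart_vec:
  assumes "open_charts M" "(U, \<phi>) \<in> atlas M" "p \<in> U"
  shows "linear (chart_vec M U \<phi> p)"
proof (rule linearI)
  note lin = linear_frechet_derivative[OF smooth_near_differentiable[OF assms]]
  show "chart_vec M U \<phi> p (x + y) = chart_vec M U \<phi> p x + chart_vec M U \<phi> p y" for x y
    by (auto simp: chart_vec_def fun_eq_iff linear_add[OF lin])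
  show "chart_vec M U \<phi> p (c *\<^sub>R x) = c *\<^sub>R chart_vec M U \<phi> p x" for c x
    by (auto simp: chart_vec_def fun_eq_iff scaleR_fun_def linear_scale[OF lin])
qed

text \<open>Applying a tangent vector to the coordinate functions recovers its components, so they are unique.\<close>

lemma chart_vec_coordinate:
  assumes M: "smooth_manifold M" and c: "(U, \<phi>) \<in> atlas M" "p \<in> U" and l: "bounded_linear l"
  shows "chart_vec M U \<phi> p u (l \<circ> \<phi>) = l u"
proof -
  note Mc = smooth_manifold_open_charts[OF M]
  note S = open_chartsD(3)[OF Mc c(1) open_chartsD(1)[OF Mc c(1)]]
  have "smooth_near M p (l \<circ> \<phi>)"
    by (rule smooth_nearI[OF smooth_fun_chart[OF M c(1) l] open_chartsD(1)[OF Mc c(1)] c(2)])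
  moreover have "frechet_derivative l (at (\<phi> p)) = frechet_derivative (l \<circ> \<phi> \<circ> inv_into U \<phi>) (at (\<phi> p))"
    using open_chartsD(2)[OF Mc c(1)] c(2)
    by (intro frechet_derivative_transform_within_open[OF _ S])
      (auto simp: bounded_linear_imp_differentiable[OF l])
  moreover have "frechet_derivative l (at (\<phi> p)) = l"
    using frechet_derivative_at[OF bounded_linear_imp_has_derivative[OF l]] by simp
  ultimately show ?thesis by (simp add: chart_vec_def)
qed

lemma inj_chart_vec:
  assumes M: "smooth_manifold M" and c: "(U, \<phi>) \<in> atlas M" "p \<in> U"
  shows "inj (chart_vec M U \<phi> p)"
proof (rule injI)
  fix u w assume eq: "chart_vec M U \<phi> p u = chart_vec M U \<phi> p w"
  obtain B where B: "finite_basis (B :: 'b set)" using smooth_manifold_finite_basis[OF M] .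
  have "representation B u b = representation B w b" if "b \<in> B" for b
    using chart_vec_coordinate[OF M c bounded_linear_representation[OF B that], of u]
      chart_vec_coordinate[OF M c bounded_linear_representation[OF B that], of w] eq by simp
  then have "(\<Sum>b\<in>B. representation B u b *\<^sub>R b) = (\<Sum>b\<in>B. representation B w b *\<^sub>R b)"
    by (intro sum.cong refl) (simp only:)
  then show "u = w" by (simp only: finite_basis_expand[OF B])
qed

lemma subspace_tangent_space:
  assumes "smooth_manifold M" "p \<in> topspace (mtop M)"
  shows "subspace (tangent_space M p)"
proof -
  note Mc = smooth_manifold_open_charts[OF assms(1)]
  obtain U \<phi> where c: "(U, \<phi>) \<in> atlas M" "p \<in> U" using chart_at[OF Mc assms(2)] .
  show ?thesis
    using real_vector.linear_subspace_image[OF linear_chart_vec[OF Mc c] subspace_UNIV]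
    by (simp add: tangent_space_chart[OF assms(1) c])
qed

lemma tangent_vec_not_smooth:
  "v \<in> tangent_space M p \<Longrightarrow> \<not> smooth_near M p f \<Longrightarrow> v f = 0"
  by (auto simp: tangent_space_def)

text \<open>Tangent vectors are local operators; the convention that they vanish on functions that are not
smooth near \<open>p\<close> depends on germs only as well.\<close>

lemma tangent_vec_cong:
  assumes "open_charts M" "v \<in> tangent_space M p" "openin (mtop M) W" "p \<in> W"
    "\<And>q. q \<in> W \<Longrightarrow> f q = h q"
  shows "v f = v h"
proof (cases "smooth_near M p f")
  case True
  then have h: "smooth_near M p h" using smooth_near_cong[of M W p f h] assms by simp
  obtain U \<phi> u where c: "(U, \<phi>) \<in> atlas M" "p \<in> U" "v = chart_vec M U \<phi> p u"
    using assms(2) unfolding tangent_space_chart_vec by blast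
  have "frechet_derivative (f \<circ> inv_into U \<phi>) (at (\<phi> p)) = frechet_derivative (h \<circ> inv_into U \<phi>) (at (\<phi> p))"
    using open_chartsD(2)[OF assms(1) c(1)] assms(4,5) c(2)
    by (intro frechet_derivative_transform_within_open[OF
          smooth_near_differentiable[OF assms(1) c(1,2) True] open_chartsD(3)[OF assms(1) c(1) assms(3)]]) auto
  then show ?thesis using True h c(3) by (simp add: chart_vec_def)
next
  case False
  then have "\<not> smooth_near M p h" using smooth_near_cong[of M W p h f] assms by auto
  then show ?thesis using False tangent_vec_not_smooth[OF assms(2)] by simp
qed

lemma tangent_vec_const:
  assumes "open_charts M" "v \<in> tangent_space M p"
  shows "v (\<lambda>_. c) = 0"
  using assms(2) unfolding tangent_space_chart_vec
  by (auto simp: chart_vec_def comp_def)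

lemma tangent_vec_combine:
  assumes "open_charts M" "v \<in> tangent_space M p" "smooth_near M p f" "smooth_near M p h"
  shows "v (\<lambda>q. f q + h q) = v f + v h" "v (\<lambda>q. f q - h q) = v f - v h"
proof -
  obtain U \<phi> u where c: "(U, \<phi>) \<in> atlas M" "p \<in> U" "v = chart_vec M U \<phi> p u"
    using assms(2) unfolding tangent_space_chart_vec by blast
  note df = smooth_near_differentiable[OF assms(1) c(1,2) assms(3), unfolded frechet_derivative_works]
  note dh = smooth_near_differentiable[OF assms(1) c(1,2) assms(4), unfolded frechet_derivative_works]
  note s = smooth_near_combine[OF assms(1,3,4)]
  show "v (\<lambda>q. f q + h q) = v f + v h" 
    using frechet_derivative_at[OF has_derivative_add[OF df dh], symmetric] s assms(3,4)
    by (simp add: c(3) chart_vec_def comp_def)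
  show "v (\<lambda>q. f q - h q) = v f - v h" 
    using frechet_derivative_at[OF has_derivative_diff[OF df dh], symmetric] s assms(3,4)
    by (simp add: c(3) chart_vec_def comp_def)
qed

lemma differential_linear:
  "differential N F p (v + w) = differential N F p v + differential N F p w"
  "differential N F p (c *\<^sub>R v) = c *\<^sub>R differential N F p v"
  by (auto simp: differential_def scaleR_fun_def fun_eq_iff)

lemma linear_differential: "linear (differential N F p)"
  by (rule linearI) (simp_all add: differential_linear)

section \<open>Vector fields and their brackets\<close>

lemma vector_fieldD:
  assumes "vector_field M X"
  shows "p \<in> topspace (mtop M) \<Longrightarrow> X p \<in> tangent_space M p"
    "p \<notin> topspace (mtop M) \<Longrightarrow> X p = 0"
    "openin (mtop M) W \<Longrightarrow> smooth_fun M W f \<Longrightarrow> smooth_fun M W (\<lambda>p. X p f)"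
  using assms unfolding vector_field_def by blast+

lemma vector_fieldI:
  assumes "\<And>p. p \<in> topspace (mtop M) \<Longrightarrow> X p \<in> tangent_space M p"
    "\<And>p. p \<notin> topspace (mtop M) \<Longrightarrow> X p = 0"
    "\<And>W f. openin (mtop M) W \<Longrightarrow> smooth_fun M W f \<Longrightarrow> smooth_fun M W (\<lambda>p. X p f)"
  shows "vector_field M X"
  unfolding vector_field_def using assms by blast

lemma smooth_near_topspace: "smooth_near M p f \<Longrightarrow> p \<in> topspace (mtop M)"
  unfolding smooth_near_def using openin_subset by blast

lemma smooth_near_vector_field:
  assumes "vector_field M X" "smooth_near M p f"
  shows "smooth_near M p (\<lambda>q. X q f)"
proof -
  obtain W where "openin (mtop M) W" "p \<in> W" "smooth_fun M W f"
    using assms(2) unfolding smooth_near_def by blast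
  then show ?thesis using vector_fieldD(3)[OF assms(1)] by (intro smooth_nearI[of M W]) auto
qed

lemma vector_field_add:
  assumes M: "smooth_manifold M" and X: "vector_field M X" and Y: "vector_field M Y"
  shows "vector_field M (X + Y)"
proof (rule vector_fieldI)
  show "(X + Y) p \<in> tangent_space M p" if p: "p \<in> topspace (mtop M)" for p
    unfolding plus_fun_apply[of X Y]
    by (rule subspace_add[OF subspace_tangent_space[OF M p] vector_fieldD(1)[OF X p] vector_fieldD(1)[OF Y p]])
  show "(X + Y) p = 0" if "p \<notin> topspace (mtop M)" for p
    unfolding plus_fun_apply[of X Y] vector_fieldD(2)[OF X that] vector_fieldD(2)[OF Y that] by (rule add_0)
  show "smooth_fun M W (\<lambda>p. (X + Y) p f)" if W: "openin (mtop M) W" and f: "smooth_fun M W f" for W f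
    unfolding plus_fun_apply
    by (rule smooth_fun_add[OF smooth_manifold_open_charts[OF M] W
          vector_fieldD(3)[OF X W f] vector_fieldD(3)[OF Y W f]])
qed

lemma vector_field_mult:
  assumes M: "smooth_manifold M" and X: "vector_field M X"
    and f: "smooth_fun M (topspace (mtop M)) f"
  shows "vector_field M (\<lambda>p. f p *\<^sub>R X p)"
proof (rule vector_fieldI)
  note Mc = smooth_manifold_open_charts[OF M]
  show "f p *\<^sub>R X p \<in> tangent_space M p" if "p \<in> topspace (mtop M)" for p
    using subspace_scale[OF subspace_tangent_space[OF M that]] vector_fieldD(1)[OF X that] by simp
  show "f p *\<^sub>R X p = 0" if "p \<notin> topspace (mtop M)" for p
    using vector_fieldD(2)[OF X that] by simp
  show "smooth_fun M W (\<lambda>p. (f p *\<^sub>R X p) h)" if W: "openin (mtop M) W" and h: "smooth_fun M W h" for W h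
    unfolding scaleR_fun_def real_scaleR_def
    by (rule smooth_fun_mult[OF Mc W smooth_fun_subset[OF f openin_subset[OF W]] vector_fieldD(3)[OF X W h]])
qed

lemma vector_field_zero:
  assumes M: "smooth_manifold M"
  shows "vector_field M 0"
  unfolding vector_field_def
  using subspace_0[OF subspace_tangent_space[OF M]] smooth_fun_const[OF smooth_manifold_open_charts[OF M], of _ 0]
  by simp

lemma vector_field_sum:
  assumes M: "smooth_manifold M" and "finite I" "\<And>i. i \<in> I \<Longrightarrow> vector_field M (X i)"
  shows "vector_field M (\<Sum>i\<in>I. X i)"
  using assms(2,3)
  by (induction I rule: finite_induct) (auto intro: vector_field_zero[OF M] vector_field_add[OF M])

lemma tangent_vec_cmult:
  assumes "open_charts M" "v \<in> tangent_space M p" "smooth_near M p f"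
  shows "v (\<lambda>q. c * f q) = c * v f"
proof -
  obtain U \<phi> u where c: "(U, \<phi>) \<in> atlas M" "p \<in> U" "v = chart_vec M U \<phi> p u"
    using assms(2) unfolding tangent_space_chart_vec by blast
  note df = smooth_near_differentiable[OF assms(1) c(1,2) assms(3), unfolded frechet_derivative_works]
  obtain W where W: "openin (mtop M) W" "p \<in> W" "smooth_fun M W f"
    using assms(3) unfolding smooth_near_def by blast
  have "smooth_near M p (\<lambda>q. c * f q)"
    by (rule smooth_nearI[OF smooth_fun_mult[OF assms(1) W(1) smooth_fun_const[OF assms(1) W(1)] W(3)] W(1,2)])
  then show ?thesis
    using frechet_derivative_at[OF has_derivative_mult_right[OF df], symmetric] assms(3)
    by (simp add: c(3) chart_vec_def comp_def)
qed

text \<open>The components of a field are its values on the coordinate functions, hence smooth.\<close>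

lemma vector_field_in_chart:
  fixes M :: "('a, 'e::real_normed_vector) mfd"
  assumes M: "smooth_manifold M" and X: "vector_field M X" and c: "(U, \<phi>) \<in> atlas M" "q \<in> U"
    and B: "finite_basis (B :: 'e set)" and f: "smooth_near M q f"
  shows "X q f = (\<Sum>b\<in>B. X q ((\<lambda>u. representation B u b) \<circ> \<phi>) *
                   frechet_derivative (f \<circ> inv_into U \<phi>) (at (\<phi> q)) b)"
proof -
  note Mc = smooth_manifold_open_charts[OF M]
  have "X q \<in> range (chart_vec M U \<phi> q)"
    using vector_fieldD(1)[OF X] open_chartsD(4)[OF Mc c(1)] c tangent_space_chart[OF M c] by blast
  then obtain u where u: "X q = chart_vec M U \<phi> q u" by blast
  let ?D = "frechet_derivative (f \<circ> inv_into U \<phi>) (at (\<phi> q))"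
  have lin: "linear ?D"
    by (rule linear_frechet_derivative[OF smooth_near_differentiable[OF Mc c f]])
  have "X q f = ?D (\<Sum>b\<in>B. representation B u b *\<^sub>R b)"
    using f by (simp add: u chart_vec_def finite_basis_expand[OF B])
  also have "\<dots> = (\<Sum>b\<in>B. representation B u b * ?D b)"
    by (simp add: linear_sum[OF lin] linear_scale[OF lin])
  also have "\<dots> = (\<Sum>b\<in>B. X q ((\<lambda>u. representation B u b) \<circ> \<phi>) * ?D b)"
    unfolding u by (intro sum.cong refl) 
      (simp only: chart_vec_coordinate[OF M c bounded_linear_representation[OF B]])
  finally show ?thesis .
qed

text \<open>With components \<open>X\<^sub>a\<close>, \<open>Y\<^sub>b\<close> in a chart, \<open>X (Y f) - Y (X f)\<close> contains the second derivatives of \<open>f\<close> as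
\<open>\<Sum>\<^sub>a\<^sub>b (X\<^sub>a Y\<^sub>b - Y\<^sub>a X\<^sub>b) \<partial>\<^sub>a \<partial>\<^sub>b f\<close>, which cancels by symmetry. What remains is the first-order operator
with components \<open>X\<^sub>a \<partial>\<^sub>a Y\<^sub>b - Y\<^sub>a \<partial>\<^sub>a X\<^sub>b\<close>, the vector \<open>w\<close> of the proof.\<close>

lemma lie_bracket_tangent:
  fixes M :: "('a, 'e::real_normed_vector) mfd"
  assumes M: "smooth_manifold M" and X: "vector_field M X" and Y: "vector_field M Y"
    and p: "p \<in> topspace (mtop M)"
  shows "lie_bracket M X Y p \<in> tangent_space M p"
proof -
  note Mc = smooth_manifold_open_charts[OF M]
  obtain U \<phi> where c: "(U, \<phi>) \<in> atlas M" "p \<in> U" using chart_at[OF Mc p] .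
  note inj = open_chartsD(2)[OF Mc c(1)] and Uo = open_chartsD(1)[OF Mc c(1)]
  obtain B :: "'e set" where B: "finite_basis B" using smooth_manifold_finite_basis[OF M] .
  then have fin: "finite B" by (simp add: finite_basis_def)
  define x where "x = \<phi> p"
  \<comment> \<open>component functions in the chart, and their derivatives at \<open>x\<close>\<close>
  define cf where "cf Z b y = Z (inv_into U \<phi> y) ((\<lambda>u. representation B u b) \<circ> \<phi>)" for Z :: "'a vfield" and b y
  define d where "d Z b h = frechet_derivative (cf Z b) (at x) h" for Z b h
  have cf: "(cf Z b has_derivative d Z b) (at x)" if "vector_field M Z" "b \<in> B" for Z b
  proof -
    have "smooth_fun M U (\<lambda>q. Z q ((\<lambda>u. representation B u b) \<circ> \<phi>))"
      by (rule vector_fieldD(3)[OF that(1) Uo smooth_fun_chart[OF M c(1) bounded_linear_representation[OF B that(2)]]])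
    then have "Ck_on (Suc 0) (\<phi> ` (U \<inter> U)) (cf Z b)"
      unfolding cf_def[abs_def] by (rule smooth_funD[OF _ c(1), unfolded comp_def[of _ "inv_into U \<phi>"]])
    then show ?thesis
      unfolding d_def x_def using Ck_on_has_derivative c(2) by blast
  qed
  define w where "w = (\<Sum>b\<in>B. (\<Sum>a\<in>B. cf X a x * d Y b a - cf Y a x * d X b a) *\<^sub>R b)"
  have "lie_bracket M X Y p f = chart_vec M U \<phi> p w f" for f
  proof (cases "smooth_near M p f")
    case True
    then obtain W where W: "openin (mtop M) W" "p \<in> W" "smooth_fun M W f"
      unfolding smooth_near_def by blast
    let ?S = "\<phi> ` (U \<inter> W)"
    note S = open_chartsD(3)[OF Mc c(1) W(1)]
    have xS: "x \<in> ?S" using c(2) W(2) by (simp add: x_def)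
    define F where "F = f \<circ> inv_into U \<phi>"
    define D where "D b y = frechet_derivative F (at y) b" for b y
    define H where "H b a = frechet_derivative (D b) (at x) a" for b a
    have C2: "Ck_on (Suc (Suc 0)) ?S F" unfolding F_def by (rule smooth_funD[OF W(3) c(1)])
    have sym: "H b a = H a b" for a b
      unfolding H_def D_def by (rule second_derivative_symmetric[OF S C2 xS])
    have D: "(D b has_derivative H b) (at x)" for b
    proof -
      have "D b differentiable (at x)" using C2 xS by (auto simp: D_def[abs_def])
      then show ?thesis unfolding H_def[abs_def] by (simp only: frechet_derivative_works)
    qed
    have ZZ: "Z p (\<lambda>q. Z' q f) =
        (\<Sum>a\<in>B. cf Z a x * (\<Sum>b\<in>B. cf Z' b x * H b a + d Z' b a * D b x))"
      if Z: "vector_field M Z" and Z': "vector_field M Z'" for Z Z'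
    proof -
      have eq: "(\<Sum>b\<in>B. cf Z' b y * D b y) = ((\<lambda>q. Z' q f) \<circ> inv_into U \<phi>) y" if "y \<in> ?S" for y
      proof -
        obtain q where q: "q \<in> U" "q \<in> W" "y = \<phi> q" using \<open>y \<in> ?S\<close> by blast
        then show ?thesis
          using vector_field_in_chart[OF M Z' c(1) q(1) B smooth_nearI[OF W(3,1) q(2)]] inj
          by (simp add: cf_def D_def F_def)
      qed
      have "((\<lambda>y. \<Sum>b\<in>B. cf Z' b y * D b y) has_derivative
          (\<lambda>h. \<Sum>b\<in>B. cf Z' b x * H b h + d Z' b h * D b x)) (at x)"
        by (intro has_derivative_sum has_derivative_mult cf Z' D)
      then have "((\<lambda>q. Z' q f) \<circ> inv_into U \<phi> has_derivative
          (\<lambda>h. \<Sum>b\<in>B. cf Z' b x * H b h + d Z' b h * D b x)) (at x)"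
        by (rule has_derivative_transform_within_open[OF _ S xS eq])
      then have "frechet_derivative ((\<lambda>q. Z' q f) \<circ> inv_into U \<phi>) (at x) =
          (\<lambda>h. \<Sum>b\<in>B. cf Z' b x * H b h + d Z' b h * D b x)"
        by (rule frechet_derivative_at[symmetric])
      then show ?thesis
        using vector_field_in_chart[OF M Z c B smooth_near_vector_field[OF Z' True]] inj c(2)
        by (simp add: cf_def x_def)
    qed
    have lin: "linear (frechet_derivative F (at x))"
      using C2 xS by (intro linear_frechet_derivative) auto
    have "chart_vec M U \<phi> p w f = frechet_derivative F (at x) w"
      using True by (simp add: chart_vec_def F_def x_def)
    also have "\<dots> = (\<Sum>b\<in>B. (\<Sum>a\<in>B. cf X a x * d Y b a - cf Y a x * d X b a) * D b x)"
      by (simp add: w_def D_def linear_sum[OF lin] linear_scale[OF lin])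
    also have "\<dots> = (\<Sum>a\<in>B. \<Sum>b\<in>B. (cf X a x * d Y b a - cf Y a x * d X b a) * D b x)"
      unfolding sum_distrib_right by (rule sum.swap)
    \<comment> \<open>the second-order terms are added back; they cancel by symmetry\<close>
    also have "\<dots> = (\<Sum>a\<in>B. \<Sum>b\<in>B. (cf X a x * d Y b a - cf Y a x * d X b a) * D b x)
        + ((\<Sum>a\<in>B. \<Sum>b\<in>B. cf X a x * cf Y b x * H b a) - (\<Sum>a\<in>B. \<Sum>b\<in>B. cf X b x * cf Y a x * H a b))"
      using sum.swap[of "\<lambda>a b. cf X a x * cf Y b x * H b a" B B] by simp
    also have "\<dots> = X p (\<lambda>q. Y q f) - Y p (\<lambda>q. X q f)"
      unfolding ZZ[OF X Y] ZZ[OF Y X]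
      by (simp add: sum_distrib_left sum_distrib_right sum.distrib[symmetric] sum_subtractf[symmetric]
          algebra_simps sym)
    finally show ?thesis using True by (simp add: lie_bracket_def)
  qed (simp add: lie_bracket_def chart_vec_def)
  then have "lie_bracket M X Y p = chart_vec M U \<phi> p w" by (rule ext)
  then show ?thesis unfolding tangent_space_chart[OF M c] by (rule range_eqI)
qed

lemma lie_bracket_apply: "smooth_near M p f \<Longrightarrow>
   lie_bracket M X Y p f = X p (\<lambda>q. Y q f) - Y p (\<lambda>q. X q f)"
  by (simp add: lie_bracket_def)

lemma lie_bracket_not_smooth: "\<not> smooth_near M p f \<Longrightarrow> lie_bracket M X Y p f = 0"
  by (simp add: lie_bracket_def)

lemma vector_field_lie_bracket:
  assumes M: "smooth_manifold M" and X: "vector_field M X" and Y: "vector_field M Y"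
  shows "vector_field M (lie_bracket M X Y)"
proof (rule vector_fieldI)
  note Mc = smooth_manifold_open_charts[OF M]
  show "lie_bracket M X Y p \<in> tangent_space M p" if "p \<in> topspace (mtop M)" for p
    by (rule lie_bracket_tangent[OF M X Y that])
  show "lie_bracket M X Y p = 0" if "p \<notin> topspace (mtop M)" for p
    using that smooth_near_topspace[of M p] by (auto simp: lie_bracket_def fun_eq_iff)
  show "smooth_fun M W (\<lambda>p. lie_bracket M X Y p f)"
    if W: "openin (mtop M) W" and f: "smooth_fun M W f" for W f
  proof (rule smooth_fun_cong[OF Mc W _ smooth_fun_diff[OF Mc W]])
    show "smooth_fun M W (\<lambda>p. X p (\<lambda>q. Y q f))"
      by (rule vector_fieldD(3)[OF X W vector_fieldD(3)[OF Y W f]])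
    show "smooth_fun M W (\<lambda>p. Y p (\<lambda>q. X q f))"
      by (rule vector_fieldD(3)[OF Y W vector_fieldD(3)[OF X W f]])
    show "X p (\<lambda>q. Y q f) - Y p (\<lambda>q. X q f) = lie_bracket M X Y p f" if "p \<in> W" for p
      using lie_bracket_apply[OF smooth_nearI[OF f W that]] by simp
  qed
qed

lemma lie_bracket_add_left:
  assumes M: "smooth_manifold M" and X: "vector_field M X" and Y: "vector_field M Y" and Z: "vector_field M Z"
  shows "lie_bracket M (X + Y) Z = lie_bracket M X Z + lie_bracket M Y Z"
proof (intro ext)
  fix p f
  show "lie_bracket M (X + Y) Z p f = (lie_bracket M X Z + lie_bracket M Y Z) p f"
  proof (cases "smooth_near M p f")
    case True
    show ?thesis
      using tangent_vec_combine(1)[OF smooth_manifold_open_charts[OF M]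
          vector_fieldD(1)[OF Z smooth_near_topspace[OF True]]
          smooth_near_vector_field[OF X True] smooth_near_vector_field[OF Y True]]
      by (simp add: lie_bracket_apply[OF True])
  qed (simp add: lie_bracket_not_smooth)
qed

lemma lie_bracket_scaleR_left:
  assumes M: "smooth_manifold M" and X: "vector_field M X" and Z: "vector_field M Z"
  shows "lie_bracket M (c *\<^sub>R X) Z = c *\<^sub>R lie_bracket M X Z"
proof (intro ext)
  fix p f
  show "lie_bracket M (c *\<^sub>R X) Z p f = (c *\<^sub>R lie_bracket M X Z) p f"
  proof (cases "smooth_near M p f")
    case True
    show ?thesis
      using tangent_vec_cmult[OF smooth_manifold_open_charts[OF M]
          vector_fieldD(1)[OF Z smooth_near_topspace[OF True]]
          smooth_near_vector_field[OF X True], of c]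
      by (simp add: lie_bracket_apply[OF True] scaleR_fun_def right_diff_distrib)
  qed (simp add: lie_bracket_not_smooth scaleR_fun_def)
qed

lemma lie_bracket_antisym: "lie_bracket M X Y = - lie_bracket M Y X"
  by (auto simp: lie_bracket_def fun_eq_iff)

lemma lie_bracket_jacobi:
  assumes M: "smooth_manifold M" and X: "vector_field M X" and Y: "vector_field M Y" and Z: "vector_field M Z"
  shows "lie_bracket M X (lie_bracket M Y Z) =
     lie_bracket M (lie_bracket M X Y) Z + lie_bracket M Y (lie_bracket M X Z)"
proof (intro ext)
  fix p f
  note Mc = smooth_manifold_open_charts[OF M]
  show "lie_bracket M X (lie_bracket M Y Z) p f =
     (lie_bracket M (lie_bracket M X Y) Z + lie_bracket M Y (lie_bracket M X Z)) p f"
  proof (cases "smooth_near M p f")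
    case True
    then obtain W where W: "openin (mtop M) W" "p \<in> W" "smooth_fun M W f"
      unfolding smooth_near_def by blast
    have *: "A p (\<lambda>q. lie_bracket M P Q q f) = A p (\<lambda>q. P q (\<lambda>r. Q r f)) - A p (\<lambda>q. Q q (\<lambda>r. P r f))"
      if A: "vector_field M A" and P: "vector_field M P" and Q: "vector_field M Q" for A P Q
    proof -
      have t: "A p \<in> tangent_space M p" by (rule vector_fieldD(1)[OF A smooth_near_topspace[OF True]])
      have "A p (\<lambda>q. lie_bracket M P Q q f) = A p (\<lambda>q. P q (\<lambda>r. Q r f) - Q q (\<lambda>r. P r f))"
        using lie_bracket_apply[OF smooth_nearI[OF W(3,1)]]
        by (intro tangent_vec_cong[OF Mc t W(1,2)]) auto
      then show ?thesis
        using tangent_vec_combine(2)[OF Mc t] smooth_near_vector_field[OF _ smooth_near_vector_field[OF _ True]] P Q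
        by simp
    qed
    show ?thesis
      using X Y Z smooth_near_vector_field[OF _ True]
      by (simp add: lie_bracket_apply True *)
  qed (simp add: lie_bracket_not_smooth)
qed

section \<open>Related vector fields\<close>

text \<open>The relation \<open>dF \<circ> Y = X \<circ> F\<close>. With left translations it expresses left invariance, and with the
inclusion of a subgroup it expresses that a field on the group restricts to one on the subgroup.\<close>

definition vf_related ::
    "('a, 'e::real_normed_vector) mfd \<Rightarrow> ('b, 'f::real_normed_vector) mfd \<Rightarrow> ('a \<Rightarrow> 'b) \<Rightarrow>
     'a vfield \<Rightarrow> 'b vfield \<Rightarrow> bool" where
  "vf_related N M F Y X \<longleftrightarrow> (\<forall>q\<in>topspace (mtop N). X (F q) = differential M F q (Y q))"

lemma vf_related_lie_bracket:
  assumes N: "smooth_manifold N" and M: "smooth_manifold M" and F: "smooth_map N M F"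
    and Y: "vector_field N Y1" "vector_field N Y2" and X: "vector_field M X1" "vector_field M X2"
    and rel: "vf_related N M F Y1 X1" "vf_related N M F Y2 X2"
  shows "vf_related N M F (lie_bracket N Y1 Y2) (lie_bracket M X1 X2)"
  unfolding vf_related_def
proof (intro ballI ext)
  fix q f assume q: "q \<in> topspace (mtop N)"
  note Mc = smooth_manifold_open_charts[OF M] and Nc = smooth_manifold_open_charts[OF N]
  show "lie_bracket M X1 X2 (F q) f = differential M F q (lie_bracket N Y1 Y2 q) f"
  proof (cases "smooth_near M (F q) f")
    case True
    then obtain W where W: "openin (mtop M) W" "F q \<in> W" "smooth_fun M W f"
      unfolding smooth_near_def by blast
    let ?O = "topspace (mtop N) \<inter> F -` W"
    have O: "openin (mtop N) ?O" "q \<in> ?O" using smooth_map_openin[OF F W(1)] q W(2) by auto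
    have *: "A' (F q) (\<lambda>r. B' r f) = A q (\<lambda>r. B r (f \<circ> F))"
      if A: "vector_field N A" "vf_related N M F A A'" and B: "vector_field M B'" "vf_related N M F B B'"
      for A A' B B'
    proof -
      have "A' (F q) (\<lambda>r. B' r f) = A q ((\<lambda>r. B' r f) \<circ> F)"
        using A(2) q smooth_near_vector_field[OF B(1) True] by (simp add: vf_related_def differential_def)
      also have "\<dots> = A q (\<lambda>r. B r (f \<circ> F))"
        using B(2) smooth_nearI[OF W(3,1)]
        by (intro tangent_vec_cong[OF Nc vector_fieldD(1)[OF A(1) q] O])
          (auto simp: vf_related_def differential_def)
      finally show ?thesis .
    qed
    show ?thesis
      using True smooth_near_pullback[OF Nc M F q True] *[OF Y(1) rel(1) X(2) rel(2)] *[OF Y(2) rel(2) X(1) rel(1)]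
      by (simp add: lie_bracket_apply differential_def)
  qed (simp add: lie_bracket_not_smooth differential_def)
qed

section \<open>Left-invariant vector fields\<close>

lemma ex_finite_basis_prod:
  assumes "finite_basis (B :: 'e::real_vector set)" "finite_basis (C :: 'f::real_vector set)"
  obtains D where "finite_basis (D :: ('e \<times> 'f) set)"
proof (rule ex_finite_basis)
  let ?D = "(\<lambda>b. (b, 0)) ` B \<union> (\<lambda>c. (0, c)) ` C"
  show "finite ?D" using assms by (simp add: finite_basis_def)
  have "(x, y) \<in> span ?D" for x :: 'e and y :: 'f
  proof -
    have "(\<Sum>b\<in>B. representation B x b *\<^sub>R (b, 0::'f)) + (\<Sum>c\<in>C. representation C y c *\<^sub>R (0::'e, c)) \<in> span ?D"
      by (intro span_add span_sum span_scale span_base) auto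
    moreover have "(\<Sum>b\<in>B. representation B x b *\<^sub>R (b, 0::'f)) = (x, 0)"
      by (simp add: scaleR_prod_def prod_eq_iff fst_sum snd_sum finite_basis_expand[OF assms(1)])
    moreover have "(\<Sum>c\<in>C. representation C y c *\<^sub>R (0::'e, c)) = (0, y)"
      by (simp add: scaleR_prod_def prod_eq_iff fst_sum snd_sum finite_basis_expand[OF assms(2)])
    ultimately show ?thesis by simp
  qed
  then show "span ?D = UNIV" by auto
qed

lemma lie_groupD:
  assumes "lie_group G M"
  shows "group G" "smooth_manifold M" "topspace (mtop M) = carrier G"
    "smooth_map (prod_mfd M M) M (\<lambda>(x, y). x \<otimes>\<^bsub>G\<^esub> y)" "open_charts M"
  using assms smooth_manifold_open_charts unfolding lie_group_def by blast+

lemma prod_chart: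
  assumes M: "open_charts M" and "(A, \<alpha>) \<in> atlas M" "(U, \<phi>) \<in> atlas M"
  shows "(A \<times> U, map_prod \<alpha> \<phi>) \<in> atlas (prod_mfd M M)"
    "a \<in> A \<Longrightarrow> q \<in> U \<Longrightarrow> inv_into (A \<times> U) (map_prod \<alpha> \<phi>) (\<alpha> a, \<phi> q) = (a, q)"
proof -
  show c: "(A \<times> U, map_prod \<alpha> \<phi>) \<in> atlas (prod_mfd M M)"
    using assms(2,3) by (auto simp: prod_mfd_def)
  show "inv_into (A \<times> U) (map_prod \<alpha> \<phi>) (\<alpha> a, \<phi> q) = (a, q)" if "a \<in> A" "q \<in> U"
    using inv_into_f_f[OF open_chartsD(2)[OF open_charts_prod[OF M M] c], of "(a, q)"] that by simp
qed

text \<open>A left translation is multiplication restricted to a slice of the product.\<close>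

lemma smooth_map_left_mult:
  fixes M :: "('a, 'e::real_normed_vector) mfd"
  assumes L: "lie_group G M" and a: "a \<in> carrier G"
  shows "smooth_map M M (\<lambda>x. a \<otimes>\<^bsub>G\<^esub> x)"
  unfolding smooth_map_def smooth_on_def
proof (intro conjI allI ballI; clarify?)
  note G = lie_groupD[OF L]
  let ?m = "\<lambda>(x, y). x \<otimes>\<^bsub>G\<^esub> y"
  have "continuous_map (mtop M) (prod_topology (mtop M) (mtop M)) (\<lambda>y. (a, y))"
    using a G(3) by (simp add: continuous_map_pairedI)
  moreover have "continuous_map (prod_topology (mtop M) (mtop M)) (mtop M) ?m"
    using G(4) by (simp add: smooth_map_def prod_mfd_def)
  ultimately have "continuous_map (mtop M) (mtop M) (?m \<circ> (\<lambda>y. (a, y)))"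
    by (rule continuous_map_compose)
  then show cont: "continuous_map (mtop M) (mtop M) (\<lambda>x. a \<otimes>\<^bsub>G\<^esub> x)" by (simp add: comp_def)
  fix U \<phi> V \<psi> k assume U: "(U, \<phi>) \<in> atlas M" and V: "(V, \<psi>) \<in> atlas M"
  obtain A \<alpha> where A: "(A, \<alpha>) \<in> atlas M" "a \<in> A" using chart_at[OF G(5)] a G(3) by metis
  note P = prod_chart[OF G(5) A(1) U]
  note Pc = open_charts_prod[OF G(5) G(5)]
  have top: "topspace (mtop (prod_mfd M M)) = carrier G \<times> carrier G" using G(3) by (simp add: prod_mfd_def)
  let ?T = "map_prod \<alpha> \<phi> ` ((A \<times> U) \<inter> (topspace (mtop (prod_mfd M M)) \<inter> ?m -` V))"
  let ?S = "\<phi> ` (U \<inter> (topspace (mtop M) \<inter> (\<lambda>x. a \<otimes>\<^bsub>G\<^esub> x) -` V))"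
  have T: "open ?T"
    by (rule open_chartsD(3)[OF Pc P(1) smooth_map_openin[OF G(4) open_chartsD(1)[OF G(5) V]]])
  have "openin (mtop M) (topspace (mtop M) \<inter> (\<lambda>x. a \<otimes>\<^bsub>G\<^esub> x) -` V)"
    using cont open_chartsD(1)[OF G(5) V] unfolding continuous_map_alt by (metis inf_commute)
  note S = open_chartsD(3)[OF G(5) U this]
  obtain B :: "'e set" where B: "finite_basis B" using smooth_manifold_finite_basis[OF G(2)] .
  obtain D :: "('e \<times> 'e) set" where D: "finite_basis D" using ex_finite_basis_prod[OF B B] .
  have g: "Ck_on k ?T (\<psi> \<circ> ?m \<circ> inv_into (A \<times> U) (map_prod \<alpha> \<phi>))"
    by (rule Ck_on_subset[OF smooth_mapD[OF G(4) P(1) V]]) auto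
  have sub: "(\<lambda>y. (\<alpha> a, y)) ` ?S \<subseteq> ?T"
  proof (rule image_subsetI)
    fix y assume "y \<in> ?S"
    then obtain q where q: "q \<in> U" "q \<in> carrier G" "a \<otimes>\<^bsub>G\<^esub> q \<in> V" "y = \<phi> q" using G(3) by auto
    then have "(a, q) \<in> (A \<times> U) \<inter> (topspace (mtop (prod_mfd M M)) \<inter> ?m -` V)"
      unfolding top using A(2) a by simp
    then have "map_prod \<alpha> \<phi> (a, q) \<in> ?T" by (rule imageI)
    then show "(\<alpha> a, y) \<in> ?T" using q(4) by simp
  qed
  have comp: "Ck_on k ?S (\<lambda>y. (\<psi> \<circ> ?m \<circ> inv_into (A \<times> U) (map_prod \<alpha> \<phi>)) (\<alpha> a, y))"
    by (rule Ck_on_compose[OF D S T Ck_on_Pair[OF S Ck_on_const[OF S] Ck_on_ident[OF S]] g sub])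
  have "Ck_on k ?S (\<psi> \<circ> (\<lambda>x. a \<otimes>\<^bsub>G\<^esub> x) \<circ> inv_into U \<phi>)"
  proof (rule Ck_on_cong[OF S _ comp])
    fix y assume "y \<in> ?S"
    then obtain q where q: "q \<in> U" "y = \<phi> q" by blast
    then show "(\<psi> \<circ> ?m \<circ> inv_into (A \<times> U) (map_prod \<alpha> \<phi>)) (\<alpha> a, y) =
        (\<psi> \<circ> (\<lambda>x. a \<otimes>\<^bsub>G\<^esub> x) \<circ> inv_into U \<phi>) y"
      using P(2)[OF A(2) q(1)] inv_into_f_f[OF open_chartsD(2)[OF G(5) U] q(1)] by simp
  qed
  moreover have "U \<inter> (topspace (mtop M) \<inter> (\<lambda>x. a \<otimes>\<^bsub>G\<^esub> x) -` V) = U \<inter> (\<lambda>x. a \<otimes>\<^bsub>G\<^esub> x) -` V"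
    using open_chartsD(4)[OF G(5) U] by blast
  ultimately show "Ck_on k (\<phi> ` (U \<inter> (\<lambda>x. a \<otimes>\<^bsub>G\<^esub> x) -` V)) (\<psi> \<circ> (\<lambda>x. a \<otimes>\<^bsub>G\<^esub> x) \<circ> inv_into U \<phi>)"
    by (simp only:)
qed

text \<open>The left-invariant field with value \<open>v\<close> at the identity; off the group it is zero, as required of
vector fields.\<close>

definition left_ext :: "'a monoid \<Rightarrow> ('a, 'e::real_normed_vector) mfd \<Rightarrow> 'a tvec \<Rightarrow> 'a vfield" where
  "left_ext G M v = (\<lambda>a. if a \<in> carrier G then differential M (\<lambda>x. a \<otimes>\<^bsub>G\<^esub> x) \<one>\<^bsub>G\<^esub> v else 0)"

lemma linear_left_ext: "linear (left_ext G M)"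
proof (rule linearI; rule ext)
  show "left_ext G M (v + w) a = (left_ext G M v + left_ext G M w) a" for v w a
    by (simp add: left_ext_def differential_linear)
  show "left_ext G M (c *\<^sub>R v) a = (c *\<^sub>R left_ext G M v) a" for c v a
    by (simp add: left_ext_def differential_linear scaleR_fun_def[of c "\<lambda>a. if a \<in> carrier G then _ a else _"])
qed

lemma differential_left_mult:
  assumes L: "lie_group G M" and a: "a \<in> carrier G" and b: "b \<in> carrier G" and c: "c \<in> carrier G"
    and v: "v \<in> tangent_space M c"
  shows "differential M (\<lambda>x. a \<otimes>\<^bsub>G\<^esub> x) (b \<otimes>\<^bsub>G\<^esub> c) (differential M (\<lambda>x. b \<otimes>\<^bsub>G\<^esub> x) c v) =
     differential M (\<lambda>x. (a \<otimes>\<^bsub>G\<^esub> b) \<otimes>\<^bsub>G\<^esub> x) c v"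
proof
  fix f
  note G = lie_groupD[OF L]
  interpret group G by (rule G(1))
  have assoc: "a \<otimes>\<^bsub>G\<^esub> (b \<otimes>\<^bsub>G\<^esub> q) = (a \<otimes>\<^bsub>G\<^esub> b) \<otimes>\<^bsub>G\<^esub> q" if "q \<in> carrier G" for q
    using m_assoc[OF a b that] by simp
  show "differential M (\<lambda>x. a \<otimes>\<^bsub>G\<^esub> x) (b \<otimes>\<^bsub>G\<^esub> c) (differential M (\<lambda>x. b \<otimes>\<^bsub>G\<^esub> x) c v) f =
     differential M (\<lambda>x. (a \<otimes>\<^bsub>G\<^esub> b) \<otimes>\<^bsub>G\<^esub> x) c v f"
  proof (cases "smooth_near M (a \<otimes>\<^bsub>G\<^esub> (b \<otimes>\<^bsub>G\<^esub> c)) f")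
    case True
    have "smooth_near M (b \<otimes>\<^bsub>G\<^esub> c) (f \<circ> (\<lambda>x. a \<otimes>\<^bsub>G\<^esub> x))"
      using b c G(3) by (intro smooth_near_pullback[OF G(5) G(2) smooth_map_left_mult[OF L a] _ True]) simp
    moreover have "v (f \<circ> (\<lambda>x. a \<otimes>\<^bsub>G\<^esub> x) \<circ> (\<lambda>x. b \<otimes>\<^bsub>G\<^esub> x)) = v (f \<circ> (\<lambda>x. (a \<otimes>\<^bsub>G\<^esub> b) \<otimes>\<^bsub>G\<^esub> x))"
      using c G(3) assoc by (intro tangent_vec_cong[OF G(5) v openin_topspace]) simp_all
    ultimately show ?thesis using True assoc[OF c] by (simp add: differential_def)
  next
    case False
    then show ?thesis using assoc[OF c] by (simp add: differential_def)
  qed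
qed

lemma differential_mult_one:
  assumes L: "lie_group G M" and c: "c \<in> carrier G" and v: "v \<in> tangent_space M c"
  shows "differential M (\<lambda>x. \<one>\<^bsub>G\<^esub> \<otimes>\<^bsub>G\<^esub> x) c v = v"
proof
  fix f
  note G = lie_groupD[OF L]
  interpret group G by (rule G(1))
  have "v (f \<circ> (\<lambda>x. \<one>\<^bsub>G\<^esub> \<otimes>\<^bsub>G\<^esub> x)) = v f"
    using c G(3) by (intro tangent_vec_cong[OF G(5) v openin_topspace]) simp_all
  then show "differential M (\<lambda>x. \<one>\<^bsub>G\<^esub> \<otimes>\<^bsub>G\<^esub> x) c v f = v f"
    using c tangent_vec_not_smooth[OF v] by (simp add: differential_def)
qed

lemma left_ext_one:
  assumes L: "lie_group G M" and v: "v \<in> tangent_space M \<one>\<^bsub>G\<^esub>"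
  shows "left_ext G M v \<one>\<^bsub>G\<^esub> = v"
  using differential_mult_one[OF L _ v] group.is_monoid[OF lie_groupD(1)[OF L]]
  by (simp add: left_ext_def monoid.one_closed)

text \<open>Near a point of a chart \<open>\<alpha>\<close>, and with \<open>v\<close> of components \<open>u\<close> in a chart \<open>\<phi>\<close> at the identity \<open>e\<close>, let
\<open>H(x, y)\<close> be the coordinate expression of \<open>f(a b)\<close>. The function in question is the derivative of \<open>H\<close>
at \<open>(x, \<phi> e)\<close> in the direction \<open>(0, u)\<close>, which is as smooth as needed in \<open>x\<close>.\<close>

lemma smooth_left_ext:
  fixes M :: "('a, 'e::real_normed_vector) mfd"
  assumes L: "lie_group G M" and v: "v \<in> tangent_space M \<one>\<^bsub>G\<^esub>"
    and W: "openin (mtop M) W" and f: "smooth_fun M W f"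
  shows "smooth_fun M W (\<lambda>p. left_ext G M v p f)"
proof (rule smooth_funI)
  fix A \<alpha> k assume A: "(A, \<alpha>) \<in> atlas M"
  note G = lie_groupD[OF L]
  interpret group G by (rule G(1))
  let ?m = "\<lambda>(x, y). x \<otimes>\<^bsub>G\<^esub> y" and ?e = "\<one>\<^bsub>G\<^esub>"
  obtain U \<phi> u where U: "(U, \<phi>) \<in> atlas M" "?e \<in> U" "v = chart_vec M U \<phi> ?e u"
    using v unfolding tangent_space_chart_vec by blast
  note P = prod_chart[OF G(5) A U(1)]
  note Pc = open_charts_prod[OF G(5) G(5)]
  have top: "topspace (mtop (prod_mfd M M)) = carrier G \<times> carrier G" using G(3) by (simp add: prod_mfd_def)
  let ?O = "topspace (mtop (prod_mfd M M)) \<inter> ?m -` W"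
  let ?T = "map_prod \<alpha> \<phi> ` ((A \<times> U) \<inter> ?O)"
  let ?S = "\<alpha> ` (A \<inter> W)"
  have T: "open ?T" by (rule open_chartsD(3)[OF Pc P(1) smooth_map_openin[OF G(4) W]])
  note S = open_chartsD(3)[OF G(5) A W]
  have WG: "W \<subseteq> carrier G" using openin_subset[OF W] G(3) by simp
  obtain B :: "'e set" where B: "finite_basis B" using smooth_manifold_finite_basis[OF G(2)] .
  obtain D :: "('e \<times> 'e) set" where D: "finite_basis D" using ex_finite_basis_prod[OF B B] .
  define H where "H = (f \<circ> ?m) \<circ> inv_into (A \<times> U) (map_prod \<alpha> \<phi>)"
  have H: "Ck_on k ?T H" for k
    unfolding H_def by (rule smooth_funD[OF smooth_fun_pullback[OF Pc G(2) G(4) W f] P(1)])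
  have inT: "(\<alpha> a, \<phi> ?e) \<in> ?T" if "a \<in> A" "a \<in> W" for a
  proof -
    have "(a, ?e) \<in> (A \<times> U) \<inter> ?O" using that U(2) WG top by auto
    then have "map_prod \<alpha> \<phi> (a, ?e) \<in> ?T" by (rule imageI)
    then show ?thesis by simp
  qed
  have g: "Ck_on k ?T (\<lambda>z. frechet_derivative H (at z) (0, u))" using H[of "Suc k"] by simp
  have sub: "(\<lambda>x. (x, \<phi> ?e)) ` ?S \<subseteq> ?T" using inT by blast
  have deriv: "Ck_on k ?S (\<lambda>x. frechet_derivative H (at (x, \<phi> ?e)) (0, u))"
    by (rule Ck_on_compose[OF D S T Ck_on_Pair[OF S Ck_on_ident[OF S] Ck_on_const[OF S]] g sub])
  have eq: "frechet_derivative H (at (x, \<phi> ?e)) (0, u) = ((\<lambda>p. left_ext G M v p f) \<circ> inv_into A \<alpha>) x"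
    if x: "x \<in> ?S" for x
  proof -
    obtain a where a: "a \<in> A" "a \<in> W" "x = \<alpha> a" using x by blast
    have aG: "a \<in> carrier G" using a WG by blast
    have near: "smooth_near M a f" by (rule smooth_nearI[OF f W a(2)])
    have near': "smooth_near M ?e (f \<circ> (\<lambda>y. a \<otimes>\<^bsub>G\<^esub> y))"
      using near aG G(3) by (intro smooth_near_pullback[OF G(5) G(2) smooth_map_left_mult[OF L aG]]) simp_all
    have inv: "inv_into A \<alpha> x = a" using a open_chartsD(2)[OF G(5) A] by simp
    have dH: "H differentiable (at (x, \<phi> ?e))"
      using Ck_on_has_derivative[OF H[of "Suc 0"] inT[OF a(1,2)]] unfolding a(3) by (rule differentiableI)
    have dP: "((\<lambda>y. (x, y)) has_derivative (\<lambda>h. (0, h))) (at (\<phi> ?e))"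
      by (auto intro!: derivative_eq_intros)
    have "((\<lambda>y. H (x, y)) has_derivative (\<lambda>h. frechet_derivative H (at (x, \<phi> ?e)) (0, h))) (at (\<phi> ?e))"
      using has_derivative_compose[OF dP] dH by (simp add: frechet_derivative_works)
    then have "(f \<circ> (\<lambda>y. a \<otimes>\<^bsub>G\<^esub> y) \<circ> inv_into U \<phi> has_derivative
        (\<lambda>h. frechet_derivative H (at (x, \<phi> ?e)) (0, h))) (at (\<phi> ?e))"
    proof (rule has_derivative_transform_within_open)
      show "open (\<phi> ` (U \<inter> U))" by (rule open_chartsD(3)[OF G(5) U(1) open_chartsD(1)[OF G(5) U(1)]])
      show "\<phi> ?e \<in> \<phi> ` (U \<inter> U)" using U(2) by simp
      show "H (x, y) = (f \<circ> (\<lambda>y. a \<otimes>\<^bsub>G\<^esub> y) \<circ> inv_into U \<phi>) y" if "y \<in> \<phi> ` (U \<inter> U)" for y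
        using that P(2)[OF a(1)] a(3) open_chartsD(2)[OF G(5) U(1)] by (auto simp: H_def)
    qed
    then have "frechet_derivative (f \<circ> (\<lambda>y. a \<otimes>\<^bsub>G\<^esub> y) \<circ> inv_into U \<phi>) (at (\<phi> ?e)) =
        (\<lambda>h. frechet_derivative H (at (x, \<phi> ?e)) (0, h))"
      by (rule frechet_derivative_at[symmetric])
    then show ?thesis
      using inv aG near near' U(3) by (simp add: left_ext_def differential_def chart_vec_def)
  qed
  show "Ck_on k ?S ((\<lambda>p. left_ext G M v p f) \<circ> inv_into A \<alpha>)"
    by (rule Ck_on_cong[OF S eq deriv])
qed

lemma lie_algebraD:
  assumes "lie_group G M" "X \<in> lie_algebra G M"
  shows "vector_field M X" "a \<in> carrier G \<Longrightarrow> vf_related M M (\<lambda>x. a \<otimes>\<^bsub>G\<^esub> x) X X"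
  using assms(2) lie_groupD(3)[OF assms(1)] unfolding lie_algebra_def vf_related_def by auto

lemma lie_algebraI:
  assumes "lie_group G M" "vector_field M X"
    "\<And>a. a \<in> carrier G \<Longrightarrow> vf_related M M (\<lambda>x. a \<otimes>\<^bsub>G\<^esub> x) X X"
  shows "X \<in> lie_algebra G M"
  using assms(2,3) lie_groupD(3)[OF assms(1)] unfolding lie_algebra_def vf_related_def by auto

lemma left_ext_in_lie_algebra:
  assumes L: "lie_group G M" and v: "v \<in> tangent_space M \<one>\<^bsub>G\<^esub>"
  shows "left_ext G M v \<in> lie_algebra G M"
proof (rule lie_algebraI[OF L])
  note G = lie_groupD[OF L]
  interpret group G by (rule G(1))
  show "vector_field M (left_ext G M v)"
  proof (rule vector_fieldI)
    show "left_ext G M v p \<in> tangent_space M p" if "p \<in> topspace (mtop M)" for p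
    proof -
      have p: "p \<in> carrier G" using that G(3) by simp
      show ?thesis
        using differential_in_tangent_space[OF G(2) G(2) smooth_map_left_mult[OF L p] _ v] p G(3)
        by (simp add: left_ext_def)
    qed
    show "left_ext G M v p = 0" if "p \<notin> topspace (mtop M)" for p
      using that G(3) by (simp add: left_ext_def)
    show "smooth_fun M W (\<lambda>p. left_ext G M v p f)" if "openin (mtop M) W" "smooth_fun M W f" for W f
      by (rule smooth_left_ext[OF L v that])
  qed
  show "vf_related M M (\<lambda>x. a \<otimes>\<^bsub>G\<^esub> x) (left_ext G M v) (left_ext G M v)" if "a \<in> carrier G" for a
    using differential_left_mult[OF L that _ one_closed v] that G(3)
    by (simp add: vf_related_def left_ext_def)
qed

lemma left_invariant_apply:
  assumes L: "lie_group G M" and X: "X \<in> lie_algebra G M" and a: "a \<in> carrier G"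
  shows "X a = differential M (\<lambda>x. a \<otimes>\<^bsub>G\<^esub> x) \<one>\<^bsub>G\<^esub> (X \<one>\<^bsub>G\<^esub>)"
proof -
  note G = lie_groupD[OF L]
  interpret group G by (rule G(1))
  show ?thesis
    using lie_algebraD(2)[OF L X a] a G(3) unfolding vf_related_def by (metis one_closed r_one)
qed

lemma left_invariant_eq_left_ext:
  assumes L: "lie_group G M" and X: "X \<in> lie_algebra G M"
  shows "left_ext G M (X \<one>\<^bsub>G\<^esub>) = X"
proof
  fix a
  show "left_ext G M (X \<one>\<^bsub>G\<^esub>) a = X a"
    using left_invariant_apply[OF L X, of a] vector_fieldD(2)[OF lie_algebraD(1)[OF L X], of a] lie_groupD(3)[OF L]
    by (simp add: left_ext_def)
qed

lemma one_in_topspace: "lie_group G M \<Longrightarrow> \<one>\<^bsub>G\<^esub> \<in> topspace (mtop M)"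
  using monoid.one_closed[OF group.is_monoid[OF lie_groupD(1)]] lie_groupD(3) by fastforce

text \<open>Evaluation at the identity is an isomorphism from the Lie algebra to the tangent space.\<close>

lemma lie_algebra_eq:
  assumes L: "lie_group G M"
  shows "lie_algebra G M = left_ext G M ` tangent_space M \<one>\<^bsub>G\<^esub>"
proof (intro equalityI subsetI)
  show "X \<in> left_ext G M ` tangent_space M \<one>\<^bsub>G\<^esub>" if "X \<in> lie_algebra G M" for X
    by (rule image_eqI[where f = "left_ext G M" and x = "X \<one>\<^bsub>G\<^esub>", OF left_invariant_eq_left_ext[OF L that, symmetric]
          vector_fieldD(1)[OF lie_algebraD(1)[OF L that] one_in_topspace[OF L]]])
qed (use left_ext_in_lie_algebra[OF L] in blast)

lemma subspace_lie_algebra: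
  assumes L: "lie_group G M"
  shows "subspace (lie_algebra G M)"
  unfolding lie_algebra_eq[OF L]
  by (rule real_vector.linear_subspace_image[OF linear_left_ext
        subspace_tangent_space[OF lie_groupD(2)[OF L] one_in_topspace[OF L]]])

lemma left_invariant_through:
  assumes L: "lie_group G M" and p: "p \<in> carrier G" and w: "w \<in> tangent_space M p"
  obtains X where "X \<in> lie_algebra G M" "X p = w"
proof -
  note G = lie_groupD[OF L]
  interpret group G by (rule G(1))
  let ?v = "differential M (\<lambda>x. (inv\<^bsub>G\<^esub> p) \<otimes>\<^bsub>G\<^esub> x) p w"
  have "?v \<in> tangent_space M ((inv\<^bsub>G\<^esub> p) \<otimes>\<^bsub>G\<^esub> p)"
    using differential_in_tangent_space[OF G(2) G(2) smooth_map_left_mult[OF L inv_closed[OF p]] _ w] p G(3)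
    by simp
  then have v: "?v \<in> tangent_space M \<one>\<^bsub>G\<^esub>" using p by simp
  have "left_ext G M ?v p = w"
    using differential_left_mult[OF L p inv_closed[OF p] p w] differential_mult_one[OF L p w] p
    by (simp add: left_ext_def)
  then show thesis using that[OF left_ext_in_lie_algebra[OF L v]] by blast
qed

lemma lie_algebra_bracket:
  assumes L: "lie_group G M" and X: "X \<in> lie_algebra G M" and Y: "Y \<in> lie_algebra G M"
  shows "lie_bracket M X Y \<in> lie_algebra G M"
proof (rule lie_algebraI[OF L])
  note G = lie_groupD[OF L] and X' = lie_algebraD[OF L X] and Y' = lie_algebraD[OF L Y]
  show "vector_field M (lie_bracket M X Y)"
    by (rule vector_field_lie_bracket[OF G(2) X'(1) Y'(1)])
  show "vf_related M M (\<lambda>x. a \<otimes>\<^bsub>G\<^esub> x) (lie_bracket M X Y) (lie_bracket M X Y)" if a: "a \<in> carrier G" for a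
    by (rule vf_related_lie_bracket[OF G(2) G(2) smooth_map_left_mult[OF L a]
          X'(1) Y'(1) X'(1) Y'(1) X'(2)[OF a] Y'(2)[OF a]])
qed

lemma lie_algebra_spanning_set:
  fixes M :: "('a, 'e::real_normed_vector) mfd"
  assumes L: "lie_group G M"
  obtains E where "finite E" "card E \<le> dim (UNIV :: 'e set)" "lie_algebra G M \<subseteq> span E"
proof -
  note G = lie_groupD[OF L]
  obtain B :: "'e set" where B: "finite_basis B" using smooth_manifold_finite_basis[OF G(2)] .
  obtain U \<phi> where c: "(U, \<phi>) \<in> atlas M" "\<one>\<^bsub>G\<^esub> \<in> U" using chart_at[OF G(5) one_in_topspace[OF L]] .
  let ?F = "left_ext G M \<circ> chart_vec M U \<phi> \<one>\<^bsub>G\<^esub>"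
  have lin: "linear ?F"
    by (rule linear_compose[OF linear_chart_vec[OF G(5) c] linear_left_ext])
  have "lie_algebra G M = ?F ` span B"
    using B by (simp add: lie_algebra_eq[OF L] tangent_space_chart[OF G(2) c] finite_basis_def image_comp)
  also have "\<dots> = span (?F ` B)" by (rule linear_span_image[OF lin, symmetric])
  finally have "lie_algebra G M \<subseteq> span (?F ` B)" by simp
  moreover have "finite B" using B by (simp add: finite_basis_def)
  ultimately show thesis
    using that[of "?F ` B"] card_image_le[of B ?F] finite_basis_card[OF B] by simp
qed

section \<open>The Lie algebra of a Lie subgroup\<close>

lemma lie_subgroupD:
  assumes "lie_subgroup G M K N"
  shows "subgroup K G" "lie_group (G\<lparr>carrier := K\<rparr>) N" "smooth_map N M id" "topspace (mtop N) = K"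
    "p \<in> K \<Longrightarrow> inj_on (differential M id p) (tangent_space N p)"
  using assms lie_groupD(3)[of "G\<lparr>carrier := K\<rparr>" N] unfolding lie_subgroup_def by auto

lemma differential_inclusion_left_mult:
  assumes L: "lie_group G M" and S: "lie_subgroup G M K N" and k: "k \<in> K" and c: "c \<in> K"
    and v: "v \<in> tangent_space N c"
  shows "differential M id (k \<otimes>\<^bsub>G\<^esub> c) (differential N (\<lambda>x. k \<otimes>\<^bsub>G\<^esub> x) c v) =
     differential M (\<lambda>x. k \<otimes>\<^bsub>G\<^esub> x) c (differential M id c v)"
proof
  fix f
  note G = lie_groupD[OF L] and K = lie_subgroupD[OF S]
  have kG: "k \<in> carrier G" "c \<in> carrier G" using subgroup.subset[OF K(1)] k c by auto
  have kc: "k \<otimes>\<^bsub>G\<^esub> c \<in> K" using subgroup.m_closed[OF K(1) k c] .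
  show "differential M id (k \<otimes>\<^bsub>G\<^esub> c) (differential N (\<lambda>x. k \<otimes>\<^bsub>G\<^esub> x) c v) f =
     differential M (\<lambda>x. k \<otimes>\<^bsub>G\<^esub> x) c (differential M id c v) f"
  proof (cases "smooth_near M (k \<otimes>\<^bsub>G\<^esub> c) f")
    case True
    have "smooth_near N (k \<otimes>\<^bsub>G\<^esub> c) (f \<circ> id)"
      using True kc K(4)
      by (intro smooth_near_pullback[OF lie_groupD(5)[OF K(2)] G(2) K(3)]) simp_all
    moreover have "smooth_near M c (f \<circ> (\<lambda>x. k \<otimes>\<^bsub>G\<^esub> x))"
      using True kG G(3) by (intro smooth_near_pullback[OF G(5) G(2) smooth_map_left_mult[OF L kG(1)]]) simp_all
    ultimately show ?thesis using True by (simp add: differential_def)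
  qed (simp add: differential_def)
qed

text \<open>The definition compares the two fields at the identity only; left invariance of both spreads this over
the subgroup.\<close>

lemma subgroup_algebraD:
  assumes L: "lie_group G M" and S: "lie_subgroup G M K N" and X: "X \<in> subgroup_algebra G M K N"
  obtains Y where "Y \<in> lie_algebra (G\<lparr>carrier := K\<rparr>) N" "vf_related N M id Y X"
proof -
  note K = lie_subgroupD[OF S]
  obtain Y where XG: "X \<in> lie_algebra G M" and Y: "Y \<in> lie_algebra (G\<lparr>carrier := K\<rparr>) N"
      "X \<one>\<^bsub>G\<^esub> = differential M id \<one>\<^bsub>G\<^esub> (Y \<one>\<^bsub>G\<^esub>)"
    using X unfolding subgroup_algebra_def by blast
  have oneK: "\<one>\<^bsub>G\<^esub> \<in> K" by (rule subgroup.one_closed[OF K(1)])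
  interpret group G by (rule lie_groupD(1)[OF L])
  have Y1: "Y \<one>\<^bsub>G\<^esub> \<in> tangent_space N \<one>\<^bsub>G\<^esub>"
    using vector_fieldD(1)[OF lie_algebraD(1)[OF K(2) Y(1)]] oneK K(4) by simp
  have "X k = differential M id k (Y k)" if k: "k \<in> K" for k
  proof -
    have kG: "k \<in> carrier G" using subgroup.subset[OF K(1)] k by blast
    have "X k = differential M (\<lambda>x. k \<otimes>\<^bsub>G\<^esub> x) \<one>\<^bsub>G\<^esub> (differential M id \<one>\<^bsub>G\<^esub> (Y \<one>\<^bsub>G\<^esub>))"
      using left_invariant_apply[OF L XG kG] Y(2) by simp
    also have "\<dots> = differential M id (k \<otimes>\<^bsub>G\<^esub> \<one>\<^bsub>G\<^esub>) (differential N (\<lambda>x. k \<otimes>\<^bsub>G\<^esub> x) \<one>\<^bsub>G\<^esub> (Y \<one>\<^bsub>G\<^esub>))"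
      by (rule differential_inclusion_left_mult[OF L S k oneK Y1, symmetric])
    also have "\<dots> = differential M id k (Y k)"
      using left_invariant_apply[OF K(2) Y(1), of k] k kG by simp
    finally show ?thesis .
  qed
  then have "vf_related N M id Y X" using K(4) by (simp add: vf_related_def)
  then show thesis using that Y(1) by blast
qed

lemma subgroup_algebra_bracket:
  assumes L: "lie_group G M" and S: "lie_subgroup G M K N"
    and X: "X1 \<in> subgroup_algebra G M K N" "X2 \<in> subgroup_algebra G M K N"
  shows "lie_bracket M X1 X2 \<in> subgroup_algebra G M K N"
proof -
  note K = lie_subgroupD[OF S]
  have XG: "X1 \<in> lie_algebra G M" "X2 \<in> lie_algebra G M" using X by (auto simp: subgroup_algebra_def)
  obtain Y1 where Y1: "Y1 \<in> lie_algebra (G\<lparr>carrier := K\<rparr>) N" "vf_related N M id Y1 X1"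
    using subgroup_algebraD[OF L S X(1)] .
  obtain Y2 where Y2: "Y2 \<in> lie_algebra (G\<lparr>carrier := K\<rparr>) N" "vf_related N M id Y2 X2"
    using subgroup_algebraD[OF L S X(2)] .
  have "vf_related N M id (lie_bracket N Y1 Y2) (lie_bracket M X1 X2)"
    by (rule vf_related_lie_bracket[OF lie_groupD(2)[OF K(2)] lie_groupD(2)[OF L] K(3)
          lie_algebraD(1)[OF K(2) Y1(1)] lie_algebraD(1)[OF K(2) Y2(1)]
          lie_algebraD(1)[OF L XG(1)] lie_algebraD(1)[OF L XG(2)] Y1(2) Y2(2)])
  then have "lie_bracket M X1 X2 \<one>\<^bsub>G\<^esub> = differential M id \<one>\<^bsub>G\<^esub> (lie_bracket N Y1 Y2 \<one>\<^bsub>G\<^esub>)"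
    using subgroup.one_closed[OF K(1)] K(4) unfolding vf_related_def by (metis id_apply)
  then show ?thesis
    using lie_algebra_bracket[OF L XG] lie_algebra_bracket[OF K(2) Y1(1) Y2(1)]
    unfolding subgroup_algebra_def by blast
qed

lemma subgroup_algebra_eq:
  assumes L: "lie_group G M" and S: "lie_subgroup G M K N"
  shows "subgroup_algebra G M K N =
    left_ext G M ` differential M id \<one>\<^bsub>G\<^esub> ` tangent_space N \<one>\<^bsub>G\<^esub>"
proof (intro equalityI subsetI)
  note K = lie_subgroupD[OF S]
  have one: "\<one>\<^bsub>G\<^esub> \<in> topspace (mtop N)" using subgroup.one_closed[OF K(1)] K(4) by simp
  show "X \<in> left_ext G M ` differential M id \<one>\<^bsub>G\<^esub> ` tangent_space N \<one>\<^bsub>G\<^esub>"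
    if X: "X \<in> subgroup_algebra G M K N" for X
  proof -
    obtain Y where XG: "X \<in> lie_algebra G M" and Y: "Y \<in> lie_algebra (G\<lparr>carrier := K\<rparr>) N"
      "X \<one>\<^bsub>G\<^esub> = differential M id \<one>\<^bsub>G\<^esub> (Y \<one>\<^bsub>G\<^esub>)"
      using X unfolding subgroup_algebra_def by blast
    have "X = left_ext G M (differential M id \<one>\<^bsub>G\<^esub> (Y \<one>\<^bsub>G\<^esub>))"
      using left_invariant_eq_left_ext[OF L XG] Y(2) by simp
    then show ?thesis using vector_fieldD(1)[OF lie_algebraD(1)[OF K(2) Y(1)] one] by blast
  qed
  show "X \<in> subgroup_algebra G M K N"
    if X: "X \<in> left_ext G M ` differential M id \<one>\<^bsub>G\<^esub> ` tangent_space N \<one>\<^bsub>G\<^esub>" for X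
  proof -
    obtain v where v: "v \<in> tangent_space N \<one>\<^bsub>G\<^esub>" "X = left_ext G M (differential M id \<one>\<^bsub>G\<^esub> v)"
      using X by blast
    have t: "differential M id \<one>\<^bsub>G\<^esub> v \<in> tangent_space M \<one>\<^bsub>G\<^esub>"
      using differential_in_tangent_space[OF lie_groupD(2)[OF K(2)] lie_groupD(2)[OF L] K(3) one v(1)] by simp
    have "left_ext (G\<lparr>carrier := K\<rparr>) N v \<in> lie_algebra (G\<lparr>carrier := K\<rparr>) N"
      "left_ext (G\<lparr>carrier := K\<rparr>) N v \<one>\<^bsub>G\<^esub> = v"
      using left_ext_in_lie_algebra[OF K(2), of v] left_ext_one[OF K(2), of v] v(1) by simp_all
    then show ?thesis
      using left_ext_in_lie_algebra[OF L t] left_ext_one[OF L t] v(2)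
      by (auto simp: subgroup_algebra_def intro!: bexI[of _ "left_ext (G\<lparr>carrier := K\<rparr>) N v"])
  qed
qed

text \<open>The Lie algebra of \<open>K\<close> is parametrised by the model space of \<open>K\<close>, injectively because the inclusion is
an immersion.\<close>

lemma subgroup_algebra_basis:
  fixes N :: "('a, 'f::real_normed_vector) mfd"
  assumes L: "lie_group G M" and S: "lie_subgroup G M K N"
  obtains C where "finite C" "independent C" "span C = subgroup_algebra G M K N" "card C = dim (UNIV :: 'f set)"
proof -
  note G = lie_groupD[OF L] and K = lie_subgroupD[OF S]
  note N = lie_groupD[OF K(2)]
  have oneK: "\<one>\<^bsub>G\<^esub> \<in> K" by (rule subgroup.one_closed[OF K(1)])
  then have one: "\<one>\<^bsub>G\<^esub> \<in> topspace (mtop N)" using K(4) by simp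
  obtain B :: "'f set" where B: "finite_basis B" using smooth_manifold_finite_basis[OF N(2)] .
  obtain U \<phi> where c: "(U, \<phi>) \<in> atlas N" "\<one>\<^bsub>G\<^esub> \<in> U" using chart_at[OF N(5) one] .
  let ?d = "differential M id \<one>\<^bsub>G\<^esub>"
  let ?F = "left_ext G M \<circ> (?d \<circ> chart_vec N U \<phi> \<one>\<^bsub>G\<^esub>)"
  have lin: "linear ?F"
    by (intro linear_compose[OF _ linear_left_ext] linear_compose[OF _ linear_differential] linear_chart_vec[OF N(5) c])
  have img: "?F ` UNIV = subgroup_algebra G M K N"
    by (simp add: subgroup_algebra_eq[OF L S] tangent_space_chart[OF N(2) c] image_comp)
  have t: "?d v \<in> tangent_space M \<one>\<^bsub>G\<^esub>" if "v \<in> tangent_space N \<one>\<^bsub>G\<^esub>" for v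
    using differential_in_tangent_space[OF N(2) G(2) K(3) one that] by simp
  have inj: "inj ?F"
  proof (rule injI)
    fix u w assume eq: "?F u = ?F w"
    have tv: "chart_vec N U \<phi> \<one>\<^bsub>G\<^esub> x \<in> tangent_space N \<one>\<^bsub>G\<^esub>" for x
      unfolding tangent_space_chart[OF N(2) c] by (rule rangeI)
    have "?d (chart_vec N U \<phi> \<one>\<^bsub>G\<^esub> u) = ?d (chart_vec N U \<phi> \<one>\<^bsub>G\<^esub> w)"
      using left_ext_one[OF L t[OF tv]] eq unfolding o_apply by metis
    then have "chart_vec N U \<phi> \<one>\<^bsub>G\<^esub> u = chart_vec N U \<phi> \<one>\<^bsub>G\<^esub> w"
      using K(5)[OF oneK] tv unfolding inj_on_def by blast
    then show "u = w" using inj_chart_vec[OF N(2) c] unfolding inj_def by blast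
  qed
  show thesis
  proof (rule that)
    show "finite (?F ` B)" using B by (simp add: finite_basis_def)
    show "independent (?F ` B)"
      using B by (intro real_vector.linear_independent_injective_image[OF lin])
        (auto simp: finite_basis_def intro: inj_on_subset[OF inj])
    show "span (?F ` B) = subgroup_algebra G M K N"
    proof -
      have "span B = UNIV" using B by (simp add: finite_basis_def)
      then show ?thesis by (simp only: linear_span_image[OF lin] img)
    qed
    show "card (?F ` B) = dim (UNIV :: 'f set)"
      using card_image[OF inj_on_subset[OF inj, of B]] finite_basis_card[OF B] by simp
  qed
qed

section \<open>Traces and the Killing form\<close>

text \<open>Endomorphisms of the carrier \<open>L\<close>. The bracket of vector fields is linear on \<open>L\<close> but not on the ambient
space of operators, so linearity has to be relative.\<close>

definition endo_on :: "'v::real_vector set \<Rightarrow> ('v \<Rightarrow> 'v) \<Rightarrow> bool" where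
  "endo_on L A \<longleftrightarrow> (\<forall>x\<in>L. A x \<in> L) \<and> (\<forall>x\<in>L. \<forall>y\<in>L. A (x + y) = A x + A y) \<and>
     (\<forall>c. \<forall>x\<in>L. A (c *\<^sub>R x) = c *\<^sub>R A x)"

lemma endo_onD:
  assumes "endo_on L A"
  shows "x \<in> L \<Longrightarrow> A x \<in> L" "x \<in> L \<Longrightarrow> y \<in> L \<Longrightarrow> A (x + y) = A x + A y"
    "x \<in> L \<Longrightarrow> A (c *\<^sub>R x) = c *\<^sub>R A x"
  using assms unfolding endo_on_def by blast+

lemma endo_on_sum:
  assumes L: "subspace L" and A: "endo_on L A" and "finite I" "\<And>i. i \<in> I \<Longrightarrow> x i \<in> L"
  shows "A (\<Sum>i\<in>I. a i *\<^sub>R x i) = (\<Sum>i\<in>I. a i *\<^sub>R A (x i))"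
  using assms(3,4)
proof (induction I rule: finite_induct)
  case empty
  show ?case using endo_onD(3)[OF A subspace_0[OF L], of 0] by simp
next
  case (insert i I)
  have "a i *\<^sub>R x i \<in> L" "(\<Sum>i\<in>I. a i *\<^sub>R x i) \<in> L"
    using insert.prems by (auto intro!: subspace_scale[OF L] subspace_sum[OF L])
  then show ?case using insert endo_onD(2,3)[OF A] by simp
qed

lemma endo_on_comp: "endo_on L A \<Longrightarrow> endo_on L B \<Longrightarrow> endo_on L (A \<circ> B)"
  unfolding endo_on_def by simp

lemma trace_on_basis:
  assumes "finite C" "independent C" "span C = L"
  obtains B where "finite B" "independent B" "span B = L"
    "\<forall>T. trace_on L T = (\<Sum>b\<in>B. representation B (T b) b)"
proof -
  define B where "B = (SOME B. independent B \<and> span B = L)"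
  have B: "independent B \<and> span B = L"
    unfolding B_def by (rule someI[of _ C]) (use assms in simp)
  have "finite B"
    using independent_span_bound[OF assms(1), of B] B assms(3) span_superset by blast
  then show thesis using B by (intro that) (auto simp: trace_on_def Let_def B_def)
qed

lemma trace_on_commute:
  assumes C: "finite C" "independent C" "span C = L" and A: "endo_on L A" and A': "endo_on L A'"
  shows "trace_on L (A \<circ> A') = trace_on L (A' \<circ> A)"
proof -
  obtain B where B: "finite B" "independent B" "span B = L"
    "\<forall>T. trace_on L T = (\<Sum>b\<in>B. representation B (T b) b)" by (rule trace_on_basis[OF C])
  have L: "subspace L" using B(3) subspace_span by blast
  have BL: "b \<in> L" if "b \<in> B" for b using B(3) span_base[OF that] by simp
  have *: "trace_on L (P \<circ> Q) = (\<Sum>b\<in>B. \<Sum>c\<in>B. representation B (Q b) c * representation B (P c) b)"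
    if P: "endo_on L P" and Q: "endo_on L Q" for P Q
    unfolding B(4)[rule_format]
  proof (rule sum.cong[OF refl])
    fix b assume b: "b \<in> B"
    have Qb: "Q b = (\<Sum>c\<in>B. representation B (Q b) c *\<^sub>R c)"
      using real_vector.sum_representation_eq[OF B(2) _ B(1) subset_refl, of "Q b"] B(3) endo_onD(1)[OF Q BL[OF b]] by simp
    have "P (Q b) = (\<Sum>c\<in>B. representation B (Q b) c *\<^sub>R P c)"
      by (subst Qb) (rule endo_on_sum[OF L P B(1) BL])
    then show "representation B ((P \<circ> Q) b) b = (\<Sum>c\<in>B. representation B (Q b) c * representation B (P c) b)"
      using endo_onD(1)[OF P BL] B(3)
      by (simp add: real_vector.representation_sum[OF B(2)] real_vector.representation_scale[OF B(2)]
          subspace_scale[OF L])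
  qed
  show ?thesis
    unfolding *[OF A A'] *[OF A' A] by (subst sum.swap) (simp add: mult.commute)
qed

lemma trace_on_add:
  assumes C: "finite C" "independent C" "span C = L"
    and T: "\<And>x. x \<in> L \<Longrightarrow> S x \<in> L" "\<And>x. x \<in> L \<Longrightarrow> T x \<in> L" "\<And>x. x \<in> L \<Longrightarrow> R x = S x + T x"
  shows "trace_on L R = trace_on L S + trace_on L T"
proof -
  obtain B where B: "finite B" "independent B" "span B = L"
    "\<forall>T. trace_on L T = (\<Sum>b\<in>B. representation B (T b) b)" by (rule trace_on_basis[OF C])
  have BL: "b \<in> L" if "b \<in> B" for b using B(3) span_base[OF that] by simp
  show ?thesis
    unfolding B(4)[rule_format] sum.distrib[symmetric]
    using T BL B(3) by (intro sum.cong refl) (simp add: real_vector.representation_add[OF B(2)])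
qed

lemma trace_on_zero:
  assumes C: "finite C" "independent C" "span C = L" and T: "\<And>x. x \<in> L \<Longrightarrow> T x = 0"
  shows "trace_on L T = 0"
proof -
  obtain B where B: "finite B" "independent B" "span B = L"
    "\<forall>T. trace_on L T = (\<Sum>b\<in>B. representation B (T b) b)" by (rule trace_on_basis[OF C])
  have BL: "b \<in> L" if "b \<in> B" for b using B(3) span_base[OF that] by simp
  show ?thesis unfolding B(4)[rule_format] using T BL by (simp add: real_vector.representation_zero)
qed

text \<open>For a derivation \<open>D\<close>, \<open>ad (D x)\<close> is the commutator of \<open>D\<close> and \<open>ad x\<close>. Hence the sum is the trace of
the commutator of \<open>D\<close> with \<open>ad x \<circ> ad y\<close>, which is zero.\<close>

lemma killing_form_derivation:
  assumes C: "finite C" "independent C" "span C = L"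
    and ad: "\<And>x. x \<in> L \<Longrightarrow> endo_on L (br x)" and D: "endo_on L D"
    and der: "\<And>x y. x \<in> L \<Longrightarrow> y \<in> L \<Longrightarrow> D (br x y) = br (D x) y + br x (D y)"
    and x: "x \<in> L" and y: "y \<in> L"
  shows "killing_form br L (D x) y + killing_form br L x (D y) = 0"
proof -
  have L: "subspace L" using C(3) subspace_span by blast
  note Dx = endo_onD(1)[OF D x] and Dy = endo_onD(1)[OF D y]
  let ?P = "br x \<circ> br y"
  have P: "endo_on L ?P" by (rule endo_on_comp[OF ad[OF x] ad[OF y]])
  note cl = endo_onD(1)[OF ad] endo_onD(1)[OF D]
  have "trace_on L (D \<circ> ?P) = trace_on L (\<lambda>z. br (D x) (br y z) + br x (br (D y) z)) + trace_on L (?P \<circ> D)"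
  proof (rule trace_on_add[OF C])
    fix z assume z: "z \<in> L"
    show "br (D x) (br y z) + br x (br (D y) z) \<in> L"
      by (intro subspace_add[OF L] cl x y z)
    show "(?P \<circ> D) z \<in> L" by (simp add: cl x y z)
    have "D (br x (br y z)) = br (D x) (br y z) + br x (br (D y) z + br y (D z))"
      using der x y z cl by simp
    also have "br x (br (D y) z + br y (D z)) = br x (br (D y) z) + br x (br y (D z))"
      by (intro endo_onD(2)[OF ad[OF x]] cl x y z)
    finally show "(D \<circ> ?P) z = br (D x) (br y z) + br x (br (D y) z) + (?P \<circ> D) z"
      by (simp add: add.assoc)
  qed
  moreover have "trace_on L (\<lambda>z. br (D x) (br y z) + br x (br (D y) z)) =
      trace_on L (br (D x) \<circ> br y) + trace_on L (br x \<circ> br (D y))"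
    by (rule trace_on_add[OF C]) (simp_all add: cl x y)
  moreover have "trace_on L (D \<circ> ?P) = trace_on L (?P \<circ> D)"
    by (rule trace_on_commute[OF C D P])
  ultimately show ?thesis by (simp add: killing_form_def)
qed

section \<open>Symmetric bilinear forms\<close>

text \<open>The form is bilinear and symmetric on the carrier \<open>L\<close> only. Below it is used with the metric on a
single tangent space and with the metric on left-invariant fields.\<close>

locale sym_form =
  fixes L :: "'v::real_vector set" and h :: "'v \<Rightarrow> 'v \<Rightarrow> real"
  assumes subspace_L: "subspace L"
    and h_sym: "x \<in> L \<Longrightarrow> y \<in> L \<Longrightarrow> h x y = h y x"
    and h_add: "x \<in> L \<Longrightarrow> y \<in> L \<Longrightarrow> z \<in> L \<Longrightarrow> h (x + y) z = h x z + h y z"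
    and h_scale: "x \<in> L \<Longrightarrow> z \<in> L \<Longrightarrow> h (c *\<^sub>R x) z = c * h x z"
begin

lemma h_add_right: "x \<in> L \<Longrightarrow> y \<in> L \<Longrightarrow> z \<in> L \<Longrightarrow> h z (x + y) = h z x + h z y"
  using h_add h_sym subspace_add[OF subspace_L] by metis

lemma h_scale_right: "x \<in> L \<Longrightarrow> z \<in> L \<Longrightarrow> h z (c *\<^sub>R x) = c * h z x"
  using h_scale h_sym subspace_scale[OF subspace_L] by metis

lemma h_diff: "x \<in> L \<Longrightarrow> y \<in> L \<Longrightarrow> z \<in> L \<Longrightarrow> h (x - y) z = h x z - h y z"
  using h_add[of "x - y" y z] subspace_diff[OF subspace_L] by fastforce

lemma h_diff_right: "x \<in> L \<Longrightarrow> y \<in> L \<Longrightarrow> z \<in> L \<Longrightarrow> h z (x - y) = h z x - h z y"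
  using h_add_right[of "x - y" y z] subspace_diff[OF subspace_L] by fastforce

lemma h_zero: "z \<in> L \<Longrightarrow> h 0 z = 0" "z \<in> L \<Longrightarrow> h z 0 = 0"
  using h_scale[of z z 0] h_scale_right[of z z 0] by simp_all

lemma h_sum:
  assumes "finite I" "\<And>i. i \<in> I \<Longrightarrow> x i \<in> L" "z \<in> L"
  shows "h (\<Sum>i\<in>I. a i *\<^sub>R x i) z = (\<Sum>i\<in>I. a i * h (x i) z)"
  using assms(1,2)
proof (induction I rule: finite_induct)
  case (insert i I)
  then have "a i *\<^sub>R x i \<in> L" "(\<Sum>i\<in>I. a i *\<^sub>R x i) \<in> L"
    by (auto intro!: subspace_scale[OF subspace_L] subspace_sum[OF subspace_L])
  then show ?case using insert assms(3) by (simp add: h_add h_scale)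
qed (simp add: h_zero assms)

lemma h_sum_right:
  assumes "finite I" "\<And>i. i \<in> I \<Longrightarrow> x i \<in> L" "z \<in> L"
  shows "h z (\<Sum>i\<in>I. a i *\<^sub>R x i) = (\<Sum>i\<in>I. a i * h z (x i))"
proof -
  have "(\<Sum>i\<in>I. a i *\<^sub>R x i) \<in> L"
    using assms by (auto intro!: subspace_scale[OF subspace_L] subspace_sum[OF subspace_L])
  then have "h z (\<Sum>i\<in>I. a i *\<^sub>R x i) = (\<Sum>i\<in>I. a i * h (x i) z)"
    using h_sum[of I x z a] h_sym assms by simp
  also have "\<dots> = (\<Sum>i\<in>I. a i * h z (x i))"
    using assms h_sym by (intro sum.cong refl) simp
  finally show ?thesis .
qed

text \<open>The map \<open>T\<close> that sends \<open>z\<close> to the vector with coordinates \<open>h z d\<close> is injective by nondegeneracy, so it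
is onto by counting; the dual basis is the preimage of the basis.\<close>

lemma ex_dual_basis:
  assumes C: "finite C" "independent C" "span C \<subseteq> L"
    and nd: "\<And>z. z \<in> span C \<Longrightarrow> (\<And>v. v \<in> span C \<Longrightarrow> h z v = 0) \<Longrightarrow> z = 0"
  obtains z where "\<forall>c\<in>C. z c \<in> span C" "\<forall>v\<in>span C. (\<Sum>c\<in>C. h (z c) v *\<^sub>R c) = v"
proof -
  have CL: "c \<in> L" if "c \<in> C" for c using C(3) span_base[OF that] by blast
  define T where "T = real_vector.construct C (\<lambda>c. \<Sum>d\<in>C. h c d *\<^sub>R d)"
  have lin: "linear T" unfolding T_def by (rule linear_construct[OF C(2)])
  have T: "T z = (\<Sum>d\<in>C. h z d *\<^sub>R d)" if z: "z \<in> span C" for z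
  proof -
    have e: "z = (\<Sum>c\<in>C. representation C z c *\<^sub>R c)"
      using real_vector.sum_representation_eq[OF C(2) z C(1) subset_refl] by simp
    have "T z = (\<Sum>c\<in>C. representation C z c *\<^sub>R (\<Sum>d\<in>C. h c d *\<^sub>R d))"
    proof -
      have "T z = (\<Sum>c\<in>C. representation C z c *\<^sub>R T c)"
        by (subst e) (simp only: linear_sum[OF lin] linear_scale[OF lin])
      then show ?thesis by (simp add: T_def real_vector.construct_basis[OF C(2)])
    qed
    also have "\<dots> = (\<Sum>d\<in>C. (\<Sum>c\<in>C. representation C z c * h c d) *\<^sub>R d)"
      unfolding scaleR_sum_right scaleR_sum_left by (subst sum.swap) simp
    also have "\<dots> = (\<Sum>d\<in>C. h z d *\<^sub>R d)"
    proof (intro sum.cong refl)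
      fix d assume "d \<in> C"
      then have "h (\<Sum>c\<in>C. representation C z c *\<^sub>R c) d = (\<Sum>c\<in>C. representation C z c * h c d)"
        by (intro h_sum[OF C(1)] CL)
      then show "(\<Sum>c\<in>C. representation C z c * h c d) *\<^sub>R d = h z d *\<^sub>R d" using e by simp
    qed
    finally show ?thesis .
  qed
  have coeff: "h z d = representation C (T z) d" if "z \<in> span C" "d \<in> C" for z d
  proof -
    have "T z = (\<Sum>e\<in>C. representation C (T z) e *\<^sub>R e)"
      using real_vector.sum_representation_eq[OF C(2) _ C(1) subset_refl, of "T z"] T[OF that(1)]
      by (simp add: span_sum span_scale span_base)
    then have "(\<Sum>e\<in>C. (h z e - representation C (T z) e) *\<^sub>R e) = 0"
      using T[OF that(1)] by (simp add: scaleR_diff_left sum_subtractf)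
    then have "h z d - representation C (T z) d = 0"
      by (rule real_vector.independentD[where u = "\<lambda>e. h z e - representation C (T z) e",
            OF C(2) C(1) subset_refl _ that(2)])
    then show ?thesis by simp
  qed
  have inj: "inj_on T (span C)"
  proof (rule linear_inj_on_iff_eq_0[OF lin subspace_span, THEN iffD2], intro ballI impI)
    fix z assume z: "z \<in> span C" "T z = 0"
    have zd: "h z d = 0" if "d \<in> C" for d
      using coeff[OF z(1) that] z(2) by (simp add: real_vector.representation_zero)
    show "z = 0"
    proof (rule nd[OF z(1)])
      fix v assume v: "v \<in> span C"
      have zL: "z \<in> L" using z(1) C(3) by blast
      have "h z (\<Sum>c\<in>C. representation C v c *\<^sub>R c) = 0"
        using h_sum_right[OF C(1) CL zL] zd by simp
      then show "h z v = 0" using real_vector.sum_representation_eq[OF C(2) v C(1) subset_refl] by simp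
    qed
  qed
  have TC: "T ` span C \<subseteq> span C" by (rule image_subsetI) (simp add: T span_sum span_scale span_base)
  have indT: "independent (T ` C)"
    using linear_independent_injective_image[OF lin C(2) inj] .
  have cardT: "card (T ` C) = card C"
    using inj_on_subset[OF inj span_superset] by (rule card_image)
  have "span C \<subseteq> T ` span C"
  proof
    fix w assume w: "w \<in> span C"
    show "w \<in> T ` span C"
    proof (rule ccontr)
      assume "w \<notin> T ` span C"
      then have nw: "w \<notin> span (T ` C)" by (simp add: linear_span_image[OF lin])
      then have "independent (insert w (T ` C))" using indT by (simp add: independent_insertI)
      moreover have "insert w (T ` C) \<subseteq> span C" using w TC span_superset by blast
      ultimately have "card (insert w (T ` C)) \<le> card C"
        using independent_span_bound[OF C(1)] by blast
      moreover have "w \<notin> T ` C" using nw span_base[of w "T ` C"] by blast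
      ultimately show False using C(1) cardT by simp
    qed
  qed
  then have "\<exists>z. z \<in> span C \<and> T z = c" if "c \<in> C" for c
    using subsetD[OF _ span_base[OF that]] by (auto simp: image_iff)
  then have "\<forall>c\<in>C. \<exists>z. z \<in> span C \<and> T z = c" by blast
  from bchoice[OF this] obtain z where "\<forall>c\<in>C. z c \<in> span C \<and> T (z c) = c" ..
  then have z: "z c \<in> span C" "T (z c) = c" if "c \<in> C" for c using that by simp_all
  show thesis
  proof (rule that[of z]; intro ballI)
    show "z c \<in> span C" if "c \<in> C" for c using z(1)[OF that] .
    fix v assume v: "v \<in> span C"
    have ev: "(\<Sum>d\<in>C. representation C v d *\<^sub>R d) = v"
      by (rule real_vector.sum_representation_eq[OF C(2) v C(1) subset_refl])
    have "h (z c) v = representation C v c" if c: "c \<in> C" for c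
    proof -
      have zL: "z c \<in> L" using z(1)[OF c] C(3) by blast
      have zd: "h (z c) d = (if d = c then 1 else 0)" if d: "d \<in> C" for d
        using coeff[OF z(1)[OF c] d] z(2)[OF c] real_vector.representation_basis[OF C(2) c] by simp
      have "h (z c) v = (\<Sum>d\<in>C. representation C v d * h (z c) d)"
        using h_sum_right[where x = "\<lambda>d. d" and a = "representation C v", OF C(1) CL zL] ev by simp
      also have "\<dots> = representation C v c"
        using C(1) c by (simp add: zd if_distrib[of "\<lambda>x. _ * x"] cong: if_cong)
      finally show ?thesis .
    qed
    then show "(\<Sum>c\<in>C. h (z c) v *\<^sub>R c) = v" using ev by simp
  qed
qed

end

section \<open>Conformal actions on a rank two complement\<close>

text \<open>The Lie algebra \<open>L\<close> of the group, that of the subgroup, \<open>K\<close>, and the metric \<open>h\<close>. The basis \<open>C\<close> of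
\<open>K\<close> and the spanning set \<open>E\<close> of \<open>L\<close> express that \<open>K\<close> has codimension at most two, which avoids
dimensions of subspaces of an infinite-dimensional ambient space.\<close>

locale lie_pair = sym_form L h
  for L :: "'v::real_vector set" and h +
  fixes K :: "'v set" and br :: "'v \<Rightarrow> 'v \<Rightarrow> 'v" and C E :: "'v set"
  assumes KL: "K \<subseteq> L"
    and endo_br: "x \<in> L \<Longrightarrow> endo_on L (br x)"
    and br_antisym: "x \<in> L \<Longrightarrow> y \<in> L \<Longrightarrow> br x y = - br y x"
    and jacobi: "x \<in> L \<Longrightarrow> y \<in> L \<Longrightarrow> z \<in> L \<Longrightarrow> br x (br y z) = br (br x y) z + br y (br x z)"
    and br_K: "x \<in> K \<Longrightarrow> y \<in> K \<Longrightarrow> br x y \<in> K"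
    and C: "finite C" "independent C" "span C = K"
    and E: "finite E" "L \<subseteq> span E" "card E \<le> card C + 2"
    and nondegenerate: "x \<in> L \<Longrightarrow> (\<And>y. y \<in> L \<Longrightarrow> h x y = 0) \<Longrightarrow> x = 0"
    and nondegenerate_K: "x \<in> K \<Longrightarrow> (\<And>y. y \<in> K \<Longrightarrow> h x y = 0) \<Longrightarrow> x = 0"
    and h_killing: "x \<in> K \<Longrightarrow> y \<in> K \<Longrightarrow> h x y = - killing_form br K x y"
begin

text \<open>The Lie algebra counterpart of the horizontal distribution.\<close>

definition H :: "'v set" where "H = {x \<in> L. \<forall>v\<in>K. h v x = 0}"

lemma HL: "x \<in> H \<Longrightarrow> x \<in> L" and KL': "x \<in> K \<Longrightarrow> x \<in> L"
  and KH: "v \<in> K \<Longrightarrow> x \<in> H \<Longrightarrow> h v x = 0" and HK: "v \<in> K \<Longrightarrow> x \<in> H \<Longrightarrow> h x v = 0"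
  using KL h_sym by (auto simp: H_def) 

lemma subspace_K: "subspace K" using C(3) subspace_span by blast

lemma br_L: "x \<in> L \<Longrightarrow> y \<in> L \<Longrightarrow> br x y \<in> L"
  and br_add: "x \<in> L \<Longrightarrow> y \<in> L \<Longrightarrow> z \<in> L \<Longrightarrow> br x (y + z) = br x y + br x z"
  and br_scale: "x \<in> L \<Longrightarrow> y \<in> L \<Longrightarrow> br x (c *\<^sub>R y) = c *\<^sub>R br x y"
  using endo_onD[OF endo_br] by blast+

lemma endo_br_K:
  assumes "x \<in> L" "\<And>v. v \<in> K \<Longrightarrow> br x v \<in> K"
  shows "endo_on K (br x)"
  using assms br_add br_scale KL' unfolding endo_on_def by simp

lemma subspace_H: "subspace H"
  unfolding subspace_def H_def
  using subspace_0[OF subspace_L] subspace_add[OF subspace_L] subspace_scale[OF subspace_L] KL'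
  by (auto simp: h_zero h_add_right h_scale_right)

lemma dual_basis:
  obtains z where "\<forall>c\<in>C. z c \<in> K" "\<forall>v\<in>K. (\<Sum>c\<in>C. h (z c) v *\<^sub>R c) = v"
proof -
  have sub: "span C \<subseteq> L" using C(3) KL by simp
  have nd: "z = 0" if "z \<in> span C" "\<And>v. v \<in> span C \<Longrightarrow> h z v = 0" for z
    using nondegenerate_K[of z] that C(3) by simp
  obtain z where "\<forall>c\<in>C. z c \<in> span C" "\<forall>v\<in>span C. (\<Sum>c\<in>C. h (z c) v *\<^sub>R c) = v"
    by (rule ex_dual_basis[OF C(1,2) sub nd])
  then show thesis unfolding C(3) by (rule that)
qed

text \<open>The projection to \<open>K\<close> has the coefficients \<open>h (z c) x\<close> for the dual basis \<open>z\<close>.\<close>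

lemma orthogonal_splitting:
  assumes x: "x \<in> L"
  obtains v y where "v \<in> K" "y \<in> H" "x = v + y"
proof -
  obtain z where z': "\<forall>c\<in>C. z c \<in> K" "\<forall>v\<in>K. (\<Sum>c\<in>C. h (z c) v *\<^sub>R c) = v"
    by (rule dual_basis)
  note z = bspec[OF z'(1)] bspec[OF z'(2)]
  have CK: "c \<in> K" if "c \<in> C" for c using C(3) span_base[OF that] by blast
  note zL = KL'[OF z(1)] and CL = KL'[OF CK]
  define p where "p = (\<Sum>c\<in>C. h (z c) x *\<^sub>R c)"
  have p: "p \<in> K" unfolding p_def by (intro subspace_sum[OF subspace_K] subspace_scale[OF subspace_K] CK)
  have "h v (x - p) = 0" if v: "v \<in> K" for v
  proof -
    note vL = KL'[OF v]
    have e: "(\<Sum>c\<in>C. h v c *\<^sub>R z c) = v"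
    proof -
      let ?s = "\<Sum>c\<in>C. h v c *\<^sub>R z c"
      have s: "?s \<in> K" by (intro subspace_sum[OF subspace_K] subspace_scale[OF subspace_K] z(1))
      have "?s - v = 0"
      proof (rule nondegenerate_K)
        show "?s - v \<in> K" by (rule subspace_diff[OF subspace_K s v])
        fix y assume y: "y \<in> K"
        have "h ?s y = (\<Sum>c\<in>C. h v c * h (z c) y)" by (rule h_sum[OF C(1) zL KL'[OF y]])
        also have "\<dots> = (\<Sum>c\<in>C. h (z c) y * h v c)" by (simp add: mult.commute)
        also have "\<dots> = h v (\<Sum>c\<in>C. h (z c) y *\<^sub>R c)"
          by (rule h_sum_right[OF C(1) CL vL, symmetric])
        also have "\<dots> = h v y" using z(2)[OF y] by simp
        finally show "h (?s - v) y = 0" using h_diff[OF KL'[OF s] vL KL'[OF y]] by simp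
      qed
      then show ?thesis by simp
    qed
    have "h v x = (\<Sum>c\<in>C. h v c * h (z c) x)" by (subst e[symmetric]) (rule h_sum[OF C(1) zL x])
    also have "\<dots> = (\<Sum>c\<in>C. h (z c) x * h v c)" by (simp add: mult.commute)
    also have "\<dots> = h v p" unfolding p_def by (rule h_sum_right[OF C(1) CL vL, symmetric])
    finally show ?thesis using h_diff_right[OF x KL'[OF p] vL] by simp
  qed
  then have "x - p \<in> H" using subspace_diff[OF subspace_L x KL'[OF p]] by (simp add: H_def)
  then show thesis using that[OF p] by simp
qed

lemma nondegenerate_H:
  assumes x: "x \<in> H" and 0: "\<And>y. y \<in> H \<Longrightarrow> h x y = 0"
  shows "x = 0"
proof (rule nondegenerate[OF HL[OF x]])
  fix z assume z: "z \<in> L"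
  obtain v y where vy: "v \<in> K" "y \<in> H" "z = v + y" using orthogonal_splitting[OF z] .
  then show "h x z = 0" using 0[OF vy(2)] HK[OF vy(1) x] h_add_right KL' HL x by simp
qed

text \<open>A basis of \<open>K\<close> and one of \<open>H\<close> are jointly independent because \<open>K\<close> and \<open>H\<close> meet in zero. A complement of
rank less than two is included by allowing \<open>e1\<close> and \<open>e2\<close> to be zero or equal.\<close>

lemma complement_rank_two: obtains e1 e2 where "e1 \<in> H" "e2 \<in> H" "\<forall>x\<in>H. \<exists>a b. x = a *\<^sub>R e1 + b *\<^sub>R e2"
proof -
  obtain D where D: "D \<subseteq> H" "independent D" "H \<subseteq> span D"
    using real_vector.maximal_independent_subset[of H] by blast
  have KH0: "x = 0" if "x \<in> K" "x \<in> H" for x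
    using nondegenerate_K[OF that(1)] HK that by blast
  have finD: "finite D"
    using independent_span_bound[OF E(1) D(2)] D(1) E(2) HL by blast
  have CK: "c \<in> K" if "c \<in> C" for c using C(3) span_base[OF that] by blast
  have disj: "C \<inter> D = {}"
  proof (rule ccontr)
    assume "C \<inter> D \<noteq> {}"
    then obtain x where "x \<in> C" "x \<in> D" by blast
    then show False using KH0[of x] CK D(1,2) dependent_zero by blast
  qed
  have "independent (C \<union> D)"
  proof (rule real_vector.independent_if_scalars_zero)
    show "finite (C \<union> D)" using C(1) finD by simp
    fix f x assume s: "(\<Sum>x\<in>C \<union> D. f x *\<^sub>R x) = 0" and x: "x \<in> C \<union> D"
    let ?c = "\<Sum>x\<in>C. f x *\<^sub>R x" and ?d = "\<Sum>x\<in>D. f x *\<^sub>R x"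
    have cd: "?c + ?d = 0" using s sum.union_disjoint[OF C(1) finD disj] by metis
    have c: "?c \<in> K" by (intro subspace_sum[OF subspace_K] subspace_scale[OF subspace_K] CK)
    have d: "?d \<in> H" using D(1) by (auto intro!: subspace_sum[OF subspace_H] subspace_scale[OF subspace_H])
    have "?c = - ?d" using cd by (simp add: eq_neg_iff_add_eq_0)
    then have c0: "?c = 0" using KH0[OF c] subspace_neg[OF subspace_H d] by simp
    then have d0: "?d = 0" using cd by simp
    show "f x = 0"
      using x real_vector.independentD[OF C(2) C(1) subset_refl c0] real_vector.independentD[OF D(2) finD subset_refl d0]
      by blast
  qed
  moreover have "C \<union> D \<subseteq> span E" using CK KL D(1) HL E(2) by blast
  ultimately have "card (C \<union> D) \<le> card E" using independent_span_bound[OF E(1)] by blast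
  then have "card D \<le> 2" using E(3) card_Un_disjoint[OF C(1) finD disj] by simp
  then consider "card D = 0" | "card D = 1" | "card D = 2" by linarith
  then obtain e1 e2 where e: "e1 \<in> H" "e2 \<in> H" "D \<subseteq> {e1, e2}"
  proof cases
    case 1 then show thesis using finD that[of 0 0] subspace_0[OF subspace_H] by simp
  next
    case 2 then show thesis using D(1) that by (auto simp: card_1_singleton_iff)
  next
    case 3 then show thesis using D(1) that by (auto simp: card_2_iff)
  qed
  have "\<exists>a b. x = a *\<^sub>R e1 + b *\<^sub>R e2" if "x \<in> H" for x
  proof -
    have "x \<in> span {e1, e2}" using D(3) that real_vector.span_mono[OF e(3)] by blast
    then obtain a where "x - a *\<^sub>R e1 \<in> span {e2}" using real_vector.span_breakdown_eq by blast
    then obtain b where "x - a *\<^sub>R e1 = b *\<^sub>R e2" using real_vector.span_singleton by auto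
    then have "x = a *\<^sub>R e1 + b *\<^sub>R e2" by (simp add: algebra_simps)
    then show ?thesis by blast
  qed
  with e show thesis using that by blast
qed

lemma derivation_skew:
  assumes D: "endo_on K D" and der: "\<And>x y. x \<in> K \<Longrightarrow> y \<in> K \<Longrightarrow> D (br x y) = br (D x) y + br x (D y)"
    and x: "x \<in> K" and y: "y \<in> K"
  shows "h (D x) y + h x (D y) = 0"
proof -
  have "killing_form br K (D x) y + killing_form br K x (D y) = 0"
  proof (rule killing_form_derivation[OF C _ D _ x y])
    show "endo_on K (br a)" if "a \<in> K" for a by (rule endo_br_K[OF KL'[OF that] br_K[OF that]])
    show "D (br a b) = br (D a) b + br a (D b)" if "a \<in> K" "b \<in> K" for a b by (rule der[OF that])
  qed
  then show ?thesis using h_killing endo_onD(1)[OF D] x y by simp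
qed

text \<open>By nondegeneracy the functional is represented by some \<open>Z\<close>, which is orthogonal to all brackets. As
\<open>ad u\<close> is skew, \<open>Z\<close> commutes with every \<open>u\<close>; so \<open>ad Z\<close> is zero, \<open>Z\<close> is null for the Killing form, and
\<open>Z\<close> vanishes. In other words \<open>K\<close> is perfect.\<close>

lemma functional_vanishing_on_brackets:
  assumes add: "\<And>x y. x \<in> K \<Longrightarrow> y \<in> K \<Longrightarrow> \<phi> (x + y) = \<phi> x + \<phi> y"
    and scale: "\<And>c x. x \<in> K \<Longrightarrow> \<phi> (c *\<^sub>R x) = c * (\<phi> x :: real)"
    and br0: "\<And>x y. x \<in> K \<Longrightarrow> y \<in> K \<Longrightarrow> \<phi> (br x y) = 0"
    and v: "v \<in> K"
  shows "\<phi> v = 0"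
proof -
  obtain z where z': "\<forall>c\<in>C. z c \<in> K" "\<forall>v\<in>K. (\<Sum>c\<in>C. h (z c) v *\<^sub>R c) = v"
    by (rule dual_basis)
  note z = bspec[OF z'(1)] bspec[OF z'(2)]
  have CK: "c \<in> K" if "c \<in> C" for c using C(3) span_base[OF that] by blast
  define Z where "Z = (\<Sum>c\<in>C. \<phi> c *\<^sub>R z c)"
  have ZK: "Z \<in> K" unfolding Z_def by (intro subspace_sum[OF subspace_K] subspace_scale[OF subspace_K] z(1))
  have phi_sum: "\<phi> (\<Sum>c\<in>S. a c *\<^sub>R c) = (\<Sum>c\<in>S. a c * \<phi> c)" if "finite S" "S \<subseteq> C" for S a
    using that
  proof (induction S rule: finite_induct)
    case empty show ?case using scale[OF v, of 0] by simp
  next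
    case (insert c S)
    have "a c *\<^sub>R c \<in> K" "(\<Sum>c\<in>S. a c *\<^sub>R c) \<in> K"
      using insert.prems CK by (auto intro!: subspace_sum[OF subspace_K] subspace_scale[OF subspace_K])
    then show ?case using insert add scale CK by simp
  qed
  have Z: "h Z u = \<phi> u" if u: "u \<in> K" for u
  proof -
    have "h Z u = (\<Sum>c\<in>C. \<phi> c * h (z c) u)"
      unfolding Z_def by (rule h_sum[OF C(1) KL'[OF z(1)] KL'[OF u]])
    also have "\<dots> = \<phi> (\<Sum>c\<in>C. h (z c) u *\<^sub>R c)"
      using phi_sum[OF C(1) subset_refl] by (simp add: mult.commute)
    finally show ?thesis using z(2)[OF u] by simp
  qed
  have central: "br u Z = 0" if u: "u \<in> K" for u
  proof (rule nondegenerate_K[OF br_K[OF u ZK]])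
    fix w assume w: "w \<in> K"
    have "h (br u Z) w + h Z (br u w) = 0"
      by (rule derivation_skew[OF endo_br_K[OF KL'[OF u] br_K[OF u]] jacobi[OF KL'[OF u] KL' KL'] ZK w])
    then show "h (br u Z) w = 0" using Z[OF br_K[OF u w]] br0[OF u w] by simp
  qed
  have "Z = 0"
  proof (rule nondegenerate_K[OF ZK])
    fix w assume w: "w \<in> K"
    have "killing_form br K Z w = 0"
      unfolding killing_form_def
    proof (rule trace_on_zero[OF C])
      fix u assume u: "u \<in> K"
      show "(br Z \<circ> br w) u = 0"
        using central[OF br_K[OF w u]] br_antisym[OF KL'[OF ZK] KL'[OF br_K[OF w u]]] by simp
    qed
    then show "h Z w = 0" using h_killing[OF ZK w] by simp
  qed
  then show ?thesis using Z[OF v] h_zero(1)[OF KL'[OF v]] by simp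
qed

end

text \<open>Conformality at the level of Lie algebras; \<open>\<mu> v\<close> is the conformal factor of the action of \<open>v\<close> on the
complement.\<close>

locale conformal_lie_pair = lie_pair L h K br C E
  for L :: "'v::real_vector set" and h K br C E +
  fixes \<mu> :: "'v \<Rightarrow> real"
  assumes conformal: "v \<in> K \<Longrightarrow> x \<in> H \<Longrightarrow> y \<in> H \<Longrightarrow>
    h (br v x) y + h (br v y) x = 2 * (h x y * \<mu> v)"
begin

text \<open>The trace-free part of the action of \<open>v\<close> on the complement, lowered to a bilinear form. Conformality
makes it alternating.\<close>

definition \<omega> :: "'v \<Rightarrow> 'v \<Rightarrow> 'v \<Rightarrow> real" where
  "\<omega> v x y = h (br v x) y - \<mu> v * h x y"

lemma omega_alternating:
  assumes "v \<in> K" "x \<in> H" "y \<in> H"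
  shows "\<omega> v x y = - \<omega> v y x"
  using conformal[OF assms] h_sym[OF HL[OF assms(2)] HL[OF assms(3)]]
  by (simp add: \<omega>_def algebra_simps)

lemma omega_expand:
  assumes v: "v \<in> K" and e: "e1 \<in> H" "e2 \<in> H"
  shows "\<omega> v (a *\<^sub>R e1 + b *\<^sub>R e2) (c *\<^sub>R e1 + d *\<^sub>R e2) = (a * d - b * c) * \<omega> v e1 e2"
proof -
  note eL = HL[OF e(1)] HL[OF e(2)] and vL = KL'[OF v]
  note cl = eL vL br_L subspace_scale[OF subspace_L] subspace_add[OF subspace_L]
  have "\<omega> v e1 e1 = 0" "\<omega> v e2 e2 = 0" "\<omega> v e2 e1 = - \<omega> v e1 e2"
    using omega_alternating[OF v e(1) e(1)] omega_alternating[OF v e(2) e(2)] omega_alternating[OF v e(2) e(1)]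
    by simp_all
  moreover have "\<omega> v (a *\<^sub>R e1 + b *\<^sub>R e2) (c *\<^sub>R e1 + d *\<^sub>R e2) =
      a * c * \<omega> v e1 e1 + a * d * \<omega> v e1 e2 + b * c * \<omega> v e2 e1 + b * d * \<omega> v e2 e2"
    by (simp add: \<omega>_def cl br_add br_scale h_add h_add_right h_scale h_scale_right algebra_simps)
  ultimately show ?thesis by (simp add: algebra_simps)
qed

text \<open>Alternating forms on a space of rank two are multiples of one determinant. This is where codimension
two is essential.\<close>

lemma omega_proportional:
  assumes v: "v \<in> K" and w: "w \<in> K"
  shows "(\<forall>x\<in>H. \<forall>y\<in>H. \<omega> v x y = 0) \<or> (\<exists>t. \<forall>x\<in>H. \<forall>y\<in>H. \<omega> w x y = t * \<omega> v x y)"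
proof -
  obtain e1 e2 where e: "e1 \<in> H" "e2 \<in> H" "\<forall>x\<in>H. \<exists>a b. x = a *\<^sub>R e1 + b *\<^sub>R e2"
    by (rule complement_rank_two)
  show ?thesis
  proof (cases "\<omega> v e1 e2 = 0")
    case True
    have "\<omega> v x y = 0" if "x \<in> H" "y \<in> H" for x y
      using bspec[OF e(3) that(1)] bspec[OF e(3) that(2)] omega_expand[OF v e(1,2)] True by auto
    then show ?thesis by blast
  next
    case False
    have "\<omega> w x y = (\<omega> w e1 e2 / \<omega> v e1 e2) * \<omega> v x y" if "x \<in> H" "y \<in> H" for x y
      using bspec[OF e(3) that(1)] bspec[OF e(3) that(2)] omega_expand[OF v e(1,2)] omega_expand[OF w e(1,2)] False
      by auto
    then show ?thesis by blast
  qed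
qed

text \<open>The decomposition of the action of \<open>v\<close> on \<open>x\<close> into a part in \<open>K\<close>, the conformal factor, and the
trace-free part \<open>j\<close>.\<close>

lemma ex_trace_free_part:
  assumes v: "v \<in> K" and x: "x \<in> H"
  obtains k j where "k \<in> K" "j \<in> H" "br v x = k + (\<mu> v *\<^sub>R x + j)" "\<forall>y\<in>H. h j y = \<omega> v x y"
proof -
  note vL = KL'[OF v] and xL = HL[OF x]
  obtain k r where kr: "k \<in> K" "r \<in> H" "br v x = k + r" using orthogonal_splitting[OF br_L[OF vL xL]] .
  let ?j = "r - \<mu> v *\<^sub>R x"
  have j: "?j \<in> H" by (intro subspace_diff[OF subspace_H] subspace_scale[OF subspace_H] kr x)
  have "h ?j y = \<omega> v x y" if y: "y \<in> H" for y
    using kr y x KH[OF kr(1) y]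
    by (simp add: \<omega>_def h_diff h_add h_scale HL KL' subspace_scale[OF subspace_L])
  then show thesis using kr j by (intro that[of k ?j]) simp_all
qed

text \<open>The trace-free parts of two elements are proportional, by proportionality of their forms and
nondegeneracy of the metric on \<open>H\<close>.\<close>

lemma trace_free_parts_commute:
  assumes v: "v \<in> K" and w: "w \<in> K" and x: "x \<in> H"
    and jv: "jv \<in> H" "\<forall>y\<in>H. h jv y = \<omega> v x y"
    and jw: "jw \<in> H" "\<forall>y\<in>H. h jw y = \<omega> w x y"
    and y: "y \<in> H"
  shows "\<omega> v jw y = \<omega> w jv y"
  using omega_proportional[OF v w]
proof
  assume 0: "\<forall>x\<in>H. \<forall>y\<in>H. \<omega> v x y = 0"
  then have "jv = 0" using nondegenerate_H[OF jv(1)] jv(2) x by simp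
  moreover have "\<omega> w 0 y = 0"
    using omega_expand[OF w y y, of 0 0 1 0] by simp
  ultimately show ?thesis using 0 jw(1) y by simp
next
  assume "\<exists>t. \<forall>x\<in>H. \<forall>y\<in>H. \<omega> w x y = t * \<omega> v x y"
  then obtain t where t: "\<And>x y. x \<in> H \<Longrightarrow> y \<in> H \<Longrightarrow> \<omega> w x y = t * \<omega> v x y" by blast
  have "jw - t *\<^sub>R jv = 0"
  proof (rule nondegenerate_H)
    show "jw - t *\<^sub>R jv \<in> H" by (intro subspace_diff[OF subspace_H] subspace_scale[OF subspace_H] jv(1) jw(1))
    show "h (jw - t *\<^sub>R jv) y = 0" if "y \<in> H" for y
      using that jv jw x t[OF x that] by (simp add: h_diff h_scale HL subspace_scale[OF subspace_L])
  qed
  then have jw_eq: "jw = t *\<^sub>R jv" by simp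
  have "\<omega> v (t *\<^sub>R jv) y = t * \<omega> v jv y"
    using omega_expand[OF v jv(1) y, of t 0 0 1] omega_expand[OF v jv(1) y, of 1 0 0 1] by simp
  then show ?thesis using jw_eq t[OF jv(1) y] by simp
qed

text \<open>Modulo \<open>K\<close> the action is a representation, and the operators \<open>\<mu> v + j\<close> of any two elements commute.\<close>

lemma brackets_act_trivially:
  assumes v: "v \<in> K" and w: "w \<in> K" and x: "x \<in> H" and y: "y \<in> H"
  shows "h (br (br v w) x) y = 0"
proof -
  note L = KL'[OF v] KL'[OF w] HL[OF x] HL[OF y]
  have main: "h (br v (br w x)) y = \<omega> v jw y + \<mu> v * \<omega> w x y + \<mu> w * \<omega> v x y + \<mu> v * \<mu> w * h x y"
    if v: "v \<in> K" and w: "w \<in> K" and kw: "kw \<in> K" and jw: "jw \<in> H"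
      "br w x = kw + (\<mu> w *\<^sub>R x + jw)" "\<forall>y\<in>H. h jw y = \<omega> w x y" for v w kw jw
  proof -
    note L' = KL'[OF v] KL'[OF w] KL'[OF kw] HL[OF jw(1)] HL[OF x] HL[OF y]
    note cl = L' br_L subspace_scale[OF subspace_L] subspace_add[OF subspace_L]
    have "h (br v (br w x)) y = h (br v kw) y + (\<mu> w * h (br v x) y + h (br v jw) y)"
      unfolding jw(2) by (simp add: cl br_add br_scale h_add h_scale)
    also have "h (br v kw) y = 0" by (rule KH[OF br_K[OF v kw] y])
    also have "h (br v x) y = \<omega> v x y + \<mu> v * h x y" by (simp add: \<omega>_def)
    also have "h (br v jw) y = \<omega> v jw y + \<mu> v * \<omega> w x y" using bspec[OF jw(3) y] by (simp add: \<omega>_def)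
    finally show ?thesis by (simp add: algebra_simps)
  qed
  obtain kv jv where v': "kv \<in> K" "jv \<in> H" "br v x = kv + (\<mu> v *\<^sub>R x + jv)" "\<forall>y\<in>H. h jv y = \<omega> v x y"
    by (rule ex_trace_free_part[OF v x])
  obtain kw jw where w': "kw \<in> K" "jw \<in> H" "br w x = kw + (\<mu> w *\<^sub>R x + jw)" "\<forall>y\<in>H. h jw y = \<omega> w x y"
    by (rule ex_trace_free_part[OF w x])
  have "br (br v w) x = br v (br w x) - br w (br v x)"
    using jacobi[OF L(1,2,3)] by simp
  then have "h (br (br v w) x) y = h (br v (br w x)) y - h (br w (br v x)) y"
    using h_diff br_L L by simp
  then show ?thesis
    using main[OF v w w'] main[OF w v v'] trace_free_parts_commute[OF v w x v'(2,4) w'(2,4) y]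
    by (simp add: algebra_simps)
qed

text \<open>For \<open>y\<close> in \<open>H\<close>, \<open>h (br x v) y\<close> is a functional of \<open>v\<close> that vanishes on brackets, so \<open>br x v\<close> has no
component in \<open>H\<close>.\<close>

lemma bracket_complement_subalgebra:
  assumes x: "x \<in> H" and v: "v \<in> K"
  shows "br x v \<in> K"
proof -
  note xL = HL[OF x] and vL = KL'[OF v]
  have *: "h (br x v) y = 0" if y: "y \<in> H" for y
  proof (rule functional_vanishing_on_brackets[OF _ _ _ v, where \<phi> = "\<lambda>v. h (br x v) y"])
    show "h (br x (a + b)) y = h (br x a) y + h (br x b) y" if "a \<in> K" "b \<in> K" for a b
      using that xL HL[OF y] KL' br_L by (simp add: br_add h_add)
    show "h (br x (c *\<^sub>R a)) y = c * h (br x a) y" if "a \<in> K" for a c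
      using that xL HL[OF y] KL' br_L by (simp add: br_scale h_scale)
    show "h (br x (br a b)) y = 0" if "a \<in> K" "b \<in> K" for a b
    proof -
      have "br x (br a b) = (- 1) *\<^sub>R br (br a b) x"
        using br_antisym[OF xL KL'[OF br_K[OF that]]] by simp
      then show ?thesis
        using brackets_act_trivially[OF that x y]
          h_scale[OF br_L[OF KL'[OF br_K[OF that]] xL] HL[OF y], of "- 1"] by simp
    qed
  qed
  obtain k r where kr: "k \<in> K" "r \<in> H" "br x v = k + r" using orthogonal_splitting[OF br_L[OF xL vL]] .
  have "r = 0"
  proof (rule nondegenerate_H[OF kr(2)])
    show "h r y = 0" if y: "y \<in> H" for y
      using *[OF y] KH[OF kr(1) y] h_add[OF KL'[OF kr(1)] HL[OF kr(2)] HL[OF y]] kr(3) by simp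
  qed
  then show ?thesis using kr by simp
qed

lemma complement_acts_skew:
  assumes x: "x \<in> H" and v: "v \<in> K" and w: "w \<in> K"
  shows "h (br x v) w + h v (br x w) = 0"
  by (rule derivation_skew[OF endo_br_K[OF HL[OF x] bracket_complement_subalgebra[OF x]] jacobi[OF HL[OF x] KL' KL'] v w])

end

section \<open>Foliations generated by a subgroup\<close>

lemma scaleR_fun_apply: "(c *\<^sub>R f) x = c *\<^sub>R f x"
  by (simp add: scaleR_fun_def)

lemma semi_riemannian_metricD:
  assumes "semi_riemannian_metric M g"
  shows "p \<in> topspace (mtop M) \<Longrightarrow> u \<in> tangent_space M p \<Longrightarrow> v \<in> tangent_space M p \<Longrightarrow>
      g p u v = g p v u \<and> (\<forall>c. g p (c *\<^sub>R u) v = c * g p u v) \<and>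
      (\<forall>w\<in>tangent_space M p. g p (u + v) w = g p u w + g p v w)"
    "p \<in> topspace (mtop M) \<Longrightarrow> u \<in> tangent_space M p \<Longrightarrow> \<forall>v\<in>tangent_space M p. g p u v = 0 \<Longrightarrow> u = 0"
    "vector_field M X \<Longrightarrow> vector_field M Y \<Longrightarrow> smooth_fun M (topspace (mtop M)) (\<lambda>p. g p (X p) (Y p))"
proof -
  note d = assms[unfolded semi_riemannian_metric_def]
  note d1 = d[THEN conjunct1] and d2 = d[THEN conjunct2, THEN conjunct1] and d3 = d[THEN conjunct2, THEN conjunct2]
  show "g p u v = g p v u \<and> (\<forall>c. g p (c *\<^sub>R u) v = c * g p u v) \<and>
      (\<forall>w\<in>tangent_space M p. g p (u + v) w = g p u w + g p v w)"
    if "p \<in> topspace (mtop M)" "u \<in> tangent_space M p" "v \<in> tangent_space M p"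
    by (rule d1[THEN bspec, OF that(1), THEN bspec, OF that(2), THEN bspec, OF that(3)])
  show "u = 0" if "p \<in> topspace (mtop M)" "u \<in> tangent_space M p" "\<forall>v\<in>tangent_space M p. g p u v = 0"
    by (rule d2[THEN bspec, OF that(1), THEN bspec, OF that(2), THEN mp, OF that(3)])
  show "smooth_fun M (topspace (mtop M)) (\<lambda>p. g p (X p) (Y p))" if "vector_field M X" "vector_field M Y"
    by (rule d3[THEN spec, THEN spec, THEN mp, OF conjI[OF that]])
qed

text \<open>The codimension enters as an upper bound, which the abstract argument on \<open>lie_pair\<close> asks for.\<close>

locale killing_foliation =
  fixes G :: "'a monoid" and M :: "('a, 'e::real_normed_vector) mfd" and K :: "'a set"
    and N :: "('a, 'f::real_normed_vector) mfd" and g :: "'a metric_field"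
    and nabla :: "'a vfield \<Rightarrow> 'a vfield \<Rightarrow> 'a vfield"
  assumes lie: "lie_group G M" and sub: "lie_subgroup G M K N"
    and codim: "dim (UNIV :: 'e set) \<le> dim (UNIV :: 'f set) + 2"
    and metric: "semi_riemannian_metric M g" and left_inv: "left_invariant_metric G M g"
    and metric_N: "semi_riemannian_metric N (pullback_metric M id g)"
    and killing: "\<And>V W. \<lbrakk>V \<in> subgroup_algebra G M K N; W \<in> subgroup_algebra G M K N\<rbrakk> \<Longrightarrow>
           g \<one>\<^bsub>G\<^esub> (V \<one>\<^bsub>G\<^esub>) (W \<one>\<^bsub>G\<^esub>) =
             - killing_form (lie_bracket M) (subgroup_algebra G M K N) V W"
    and lc: "levi_civita_connection M g nabla"
begin

abbreviation \<gg> where "\<gg> \<equiv> lie_algebra G M"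
abbreviation \<kk> where "\<kk> \<equiv> subgroup_algebra G M K N"
abbreviation br where "br \<equiv> lie_bracket M"
abbreviation \<V> where "\<V> \<equiv> subgroup_foliation G M K N"
abbreviation \<H> where "\<H> \<equiv> orth_distribution M g \<V>"

definition h :: "'a vfield \<Rightarrow> 'a vfield \<Rightarrow> real" where
  "h X Y = g \<one>\<^bsub>G\<^esub> (X \<one>\<^bsub>G\<^esub>) (Y \<one>\<^bsub>G\<^esub>)"

lemmas grp = lie_groupD[OF lie]

sublocale group G by (rule grp(1))

lemma top: "p \<in> topspace (mtop M) \<longleftrightarrow> p \<in> carrier G"
  using grp(3) by simp

lemma k_g: "X \<in> \<kk> \<Longrightarrow> X \<in> \<gg>"
  by (simp add: subgroup_algebra_def)

lemmas vf = lie_algebraD(1)[OF lie]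

lemma tangent: "vector_field M X \<Longrightarrow> p \<in> carrier G \<Longrightarrow> X p \<in> tangent_space M p"
  unfolding top[symmetric] by (rule vector_fieldD(1))

lemma metric_form:
  assumes "p \<in> carrier G"
  shows "sym_form (tangent_space M p) (g p)"
proof
  have p: "p \<in> topspace (mtop M)" using assms top by simp
  show "subspace (tangent_space M p)" by (rule subspace_tangent_space[OF grp(2) p])
  show "g p x y = g p y x" "g p (c *\<^sub>R x) y = c * g p x y"
    if "x \<in> tangent_space M p" "y \<in> tangent_space M p" for x y c
    using semi_riemannian_metricD(1)[OF metric p that] by simp_all
  show "g p (x + y) z = g p x z + g p y z"
    if "x \<in> tangent_space M p" "y \<in> tangent_space M p" "z \<in> tangent_space M p" for x y z
    using semi_riemannian_metricD(1)[OF metric p that(1,2)] that(3) by simp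
qed

lemma metric_const:
  assumes X: "X \<in> \<gg>" and Y: "Y \<in> \<gg>" and p: "p \<in> carrier G"
  shows "g p (X p) (Y p) = h X Y"
proof -
  have "g (p \<otimes>\<^bsub>G\<^esub> \<one>\<^bsub>G\<^esub>) (differential M (\<lambda>x. p \<otimes>\<^bsub>G\<^esub> x) \<one>\<^bsub>G\<^esub> (X \<one>\<^bsub>G\<^esub>))
      (differential M (\<lambda>x. p \<otimes>\<^bsub>G\<^esub> x) \<one>\<^bsub>G\<^esub> (Y \<one>\<^bsub>G\<^esub>)) = h X Y"
    unfolding h_def
    by (rule left_inv[unfolded left_invariant_metric_def, THEN bspec, OF p, THEN bspec, OF one_closed,
          THEN bspec, OF tangent[OF vf[OF X] one_closed], THEN bspec, OF tangent[OF vf[OF Y] one_closed]])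
  then show ?thesis
    using left_invariant_apply[OF lie X p] left_invariant_apply[OF lie Y p] p by simp
qed

lemma h_nondegenerate:
  assumes X: "X \<in> \<gg>" and 0: "\<And>Y. Y \<in> \<gg> \<Longrightarrow> h X Y = 0"
  shows "X = 0"
proof -
  note X1 = tangent[OF vf[OF X] one_closed]
  have "g \<one>\<^bsub>G\<^esub> (X \<one>\<^bsub>G\<^esub>) w = 0" if w: "w \<in> tangent_space M \<one>\<^bsub>G\<^esub>" for w
  proof -
    obtain Y where Y: "Y \<in> \<gg>" "Y \<one>\<^bsub>G\<^esub> = w" using left_invariant_through[OF lie one_closed w] .
    then show ?thesis using 0[OF Y(1)] by (simp add: h_def)
  qed
  then have "X \<one>\<^bsub>G\<^esub> = 0"
    by (intro semi_riemannian_metricD(2)[OF metric one_in_topspace[OF lie] X1] ballI)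
  then show ?thesis
    using left_invariant_eq_left_ext[OF lie X] linear_0[OF linear_left_ext, of G M] by simp
qed

text \<open>Nondegeneracy of the metric on \<open>K\<close>, transported along the parametrisation of the subgroup algebra by
the tangent space of \<open>K\<close> at the identity.\<close>

lemma h_nondegenerate_k:
  assumes X: "X \<in> \<kk>" and 0: "\<And>Y. Y \<in> \<kk> \<Longrightarrow> h X Y = 0"
  shows "X = 0"
proof -
  note S = lie_subgroupD[OF sub] and eq = subgroup_algebra_eq[OF lie sub]
  let ?d = "differential M id \<one>\<^bsub>G\<^esub>"
  have oneN: "\<one>\<^bsub>G\<^esub> \<in> topspace (mtop N)" using subgroup.one_closed[OF S(1)] S(4) by simp
  have val: "left_ext G M (?d v) \<one>\<^bsub>G\<^esub> = ?d v" if "v \<in> tangent_space N \<one>\<^bsub>G\<^esub>" for v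
    using differential_in_tangent_space[OF lie_groupD(2)[OF S(2)] grp(2) S(3) oneN that]
    by (intro left_ext_one[OF lie]) simp
  obtain v where v: "v \<in> tangent_space N \<one>\<^bsub>G\<^esub>" "X = left_ext G M (?d v)" using X unfolding eq by blast
  have "pullback_metric M id g \<one>\<^bsub>G\<^esub> v w = 0" if w: "w \<in> tangent_space N \<one>\<^bsub>G\<^esub>" for w
  proof -
    have "left_ext G M (?d w) \<in> \<kk>" using w unfolding eq by blast
    then have "h X (left_ext G M (?d w)) = 0" by (rule 0)
    then show ?thesis by (simp add: pullback_metric_def h_def v(2) val[OF v(1)] val[OF w])
  qed
  then have "v = 0" by (intro semi_riemannian_metricD(2)[OF metric_N oneN v(1)] ballI)
  then show ?thesis
    using v(2) linear_0[OF linear_left_ext, of G M] linear_0[OF linear_differential, of M id "\<one>\<^bsub>G\<^esub>"] by simp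
qed

lemma endo_bracket:
  assumes X: "X \<in> \<gg>"
  shows "endo_on \<gg> (br X)"
proof -
  have anti: "br X Y = - br Y X" for Y by (rule lie_bracket_antisym)
  show ?thesis
    unfolding endo_on_def
    using lie_algebra_bracket[OF lie X] lie_bracket_add_left[OF grp(2) vf vf vf[OF X]]
      lie_bracket_scaleR_left[OF grp(2) vf vf[OF X]]
    by (simp add: anti)
qed

lemma ex_lie_pair: "\<exists>C E. lie_pair \<gg> h \<kk> br C E"
proof -
  obtain E where E: "finite E" "card E \<le> dim (UNIV :: 'e set)" "\<gg> \<subseteq> span E"
    by (rule lie_algebra_spanning_set[OF lie])
  obtain C where C: "finite C" "independent C" "span C = \<kk>" "card C = dim (UNIV :: 'f set)"
    by (rule subgroup_algebra_basis[OF lie sub])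
  interpret g1: sym_form "tangent_space M \<one>\<^bsub>G\<^esub>" "g \<one>\<^bsub>G\<^esub>" by (rule metric_form[OF one_closed])
  note t = tangent[OF vf one_closed]
  have "lie_pair \<gg> h \<kk> br C E"
  proof
    show "subspace \<gg>" by (rule subspace_lie_algebra[OF lie])
    show "h X Y = h Y X" if "X \<in> \<gg>" "Y \<in> \<gg>" for X Y
      unfolding h_def using g1.h_sym t that by blast
    show "h (X + Y) Z = h X Z + h Y Z" if "X \<in> \<gg>" "Y \<in> \<gg>" "Z \<in> \<gg>" for X Y Z
      using g1.h_add[OF t[OF that(1)] t[OF that(2)] t[OF that(3)]] by (simp add: h_def)
    show "h (c *\<^sub>R X) Z = c * h X Z" if "X \<in> \<gg>" "Z \<in> \<gg>" for X Z c
      using g1.h_scale[OF t[OF that(1)] t[OF that(2)]] by (simp add: h_def scaleR_fun_apply)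
    show "\<kk> \<subseteq> \<gg>" using k_g by blast
    show "endo_on \<gg> (br X)" if "X \<in> \<gg>" for X by (rule endo_bracket[OF that])
    show "br X Y = - br Y X" for X Y by (rule lie_bracket_antisym)
    show "br X (br Y Z) = br (br X Y) Z + br Y (br X Z)" if "X \<in> \<gg>" "Y \<in> \<gg>" "Z \<in> \<gg>" for X Y Z
      by (rule lie_bracket_jacobi[OF grp(2) vf[OF that(1)] vf[OF that(2)] vf[OF that(3)]])
    show "br X Y \<in> \<kk>" if "X \<in> \<kk>" "Y \<in> \<kk>" for X Y by (rule subgroup_algebra_bracket[OF lie sub that])
    show "finite C" "independent C" "span C = \<kk>" "finite E" "\<gg> \<subseteq> span E" by (fact C E)+
    show "card E \<le> card C + 2" using C(4) E(2) codim by simp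
    show "X = 0" if "X \<in> \<gg>" "\<And>Y. Y \<in> \<gg> \<Longrightarrow> h X Y = 0" for X by (rule h_nondegenerate[OF that])
    show "X = 0" if "X \<in> \<kk>" "\<And>Y. Y \<in> \<kk> \<Longrightarrow> h X Y = 0" for X by (rule h_nondegenerate_k[OF that])
    show "h X Y = - killing_form br \<kk> X Y" if "X \<in> \<kk>" "Y \<in> \<kk>" for X Y
      unfolding h_def by (rule killing[OF that])
  qed
  then show ?thesis by blast
qed

end

text \<open>The sets \<open>C\<close> and \<open>E\<close> are obtained from charts at the identity, so they are parameters of a second
locale instead of assumptions of the first.\<close>

locale killing_foliation_basis = killing_foliation G M K N g nabla + lie_pair \<gg> h \<kk> br C E
  for G :: "'a monoid" and M :: "('a, 'e::real_normed_vector) mfd" and K :: "'a set"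
    and N :: "('a, 'f::real_normed_vector) mfd" and g :: "'a metric_field"
    and nabla :: "'a vfield \<Rightarrow> 'a vfield \<Rightarrow> 'a vfield" and C E :: "'a vfield set"
begin

lemma at_point_inj:
  assumes X: "X \<in> \<gg>" and p: "p \<in> carrier G" and 0: "X p = 0"
  shows "X = 0"
proof (rule nondegenerate[OF X])
  interpret gp: sym_form "tangent_space M p" "g p" by (rule metric_form[OF p])
  show "h X Y = 0" if Y: "Y \<in> \<gg>" for Y
    using metric_const[OF X Y p] 0 gp.h_zero(1)[OF tangent[OF vf[OF Y] p]] by simp
qed

lemma foliation_at: "\<V> p = (\<lambda>X. X p) ` \<kk>"
  by (auto simp: subgroup_foliation_def)

text \<open>Every horizontal vector extends to a left-invariant horizontal field.\<close>

lemma complement_at: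
  assumes p: "p \<in> carrier G"
  shows "\<H> p = (\<lambda>X. X p) ` H"
proof (intro equalityI subsetI)
  fix w assume w: "w \<in> \<H> p"
  then have wt: "w \<in> tangent_space M p" and w0: "\<And>v. v \<in> \<V> p \<Longrightarrow> g p v w = 0"
    by (auto simp: orth_distribution_def)
  obtain X where X: "X \<in> \<gg>" "X p = w" using left_invariant_through[OF lie p wt] .
  have "h V X = 0" if "V \<in> \<kk>" for V
    using w0[of "V p"] metric_const[OF k_g[OF that] X(1) p] X(2) that by (simp add: foliation_at)
  then have "X \<in> H" using X(1) by (simp add: H_def)
  then show "w \<in> (\<lambda>X. X p) ` H" using X(2) by blast
next
  fix w assume "w \<in> (\<lambda>X. X p) ` H"
  then obtain X where X: "X \<in> H" "w = X p" by blast
  then show "w \<in> \<H> p"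
    using tangent[OF vf[OF HL[OF X(1)]] p] metric_const[OF k_g HL[OF X(1)] p] KH
    by (auto simp: orth_distribution_def foliation_at)
qed

lemma projections_at:
  assumes p: "p \<in> carrier G" and V: "V \<in> \<kk>" and Y: "Y \<in> H" and w: "w = V p + Y p"
  shows "proj_along (\<V> p) (\<H> p) w = V p" "proj_along (\<H> p) (\<V> p) w = Y p"
proof -
  have uniq: "V' = V \<and> Y' = Y" if "V' \<in> \<kk>" "Y' \<in> H" "V p + Y p = V' p + Y' p" for V' Y'
  proof -
    have dV: "V' - V \<in> \<kk>" by (rule subspace_diff[OF subspace_K that(1) V])
    have dY: "Y - Y' \<in> H" by (rule subspace_diff[OF subspace_H Y that(2)])
    have "((V' - V) - (Y - Y')) p = 0" using that(3) by (simp add: algebra_simps)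
    moreover have "(V' - V) - (Y - Y') \<in> \<gg>"
      using subspace_diff[OF subspace_L KL'[OF dV] HL[OF dY]] .
    ultimately have eq: "V' - V = Y - Y'" using at_point_inj[OF _ p] by fastforce
    have "V' - V = 0" using nondegenerate_K[OF dV] HK[OF _ dY] eq by simp
    then show ?thesis using eq by simp
  qed
  show "proj_along (\<V> p) (\<H> p) w = V p" unfolding proj_along_def
  proof (rule the_equality)
    show "V p \<in> \<V> p \<and> (\<exists>b\<in>\<H> p. w = V p + b)" using V Y w by (auto simp: foliation_at complement_at[OF p])
    show "a = V p" if "a \<in> \<V> p \<and> (\<exists>b\<in>\<H> p. w = a + b)" for a
      using that uniq w by (auto simp: foliation_at complement_at[OF p])
  qed
  show "proj_along (\<H> p) (\<V> p) w = Y p" unfolding proj_along_def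
  proof (rule the_equality)
    show "Y p \<in> \<H> p \<and> (\<exists>b\<in>\<V> p. w = Y p + b)" using V Y w by (auto simp: foliation_at complement_at[OF p] add.commute)
    show "a = Y p" if a: "a \<in> \<H> p \<and> (\<exists>b\<in>\<V> p. w = a + b)" for a
    proof -
      obtain Y' V' where q: "Y' \<in> H" "a = Y' p" "V' \<in> \<kk>" "w = Y' p + V' p"
        using a by (auto simp: foliation_at complement_at[OF p])
      have "V p + Y p = V' p + Y' p" using q(4) unfolding w add.commute[of "Y' p"] .
      then show ?thesis using uniq[OF q(3,1)] q(2) by simp
    qed
  qed
qed

subsection \<open>The Levi-Civita connection on left-invariant fields\<close>

lemmas nabla_vf = lc[unfolded levi_civita_connection_def, THEN conjunct1,
    THEN spec, THEN spec, THEN mp, OF conjI]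

lemmas nabla_add = lc[unfolded levi_civita_connection_def, THEN conjunct2, THEN conjunct1,
    THEN spec, THEN spec, THEN spec, THEN mp, THEN conjunct1, OF conjI[OF _ conjI]]

lemmas nabla_mult = lc[unfolded levi_civita_connection_def, THEN conjunct2, THEN conjunct2, THEN conjunct1,
    THEN spec, THEN spec, THEN spec, THEN mp, THEN conjunct1, OF conjI[OF _ conjI]]

lemmas nabla_torsion_free = lc[unfolded levi_civita_connection_def, THEN conjunct2, THEN conjunct2,
    THEN conjunct2, THEN conjunct1, THEN spec, THEN spec, THEN mp, OF conjI]

lemmas nabla_metric = lc[unfolded levi_civita_connection_def, THEN conjunct2, THEN conjunct2,
    THEN conjunct2, THEN conjunct2, THEN spec, THEN spec, THEN spec, THEN mp, THEN bspec, OF conjI[OF _ conjI],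
    unfolded top]

lemma nabla_skew:
  assumes "vector_field M X" "vector_field M Y" "vector_field M Z" and p: "p \<in> carrier G"
    and const: "\<And>q. q \<in> carrier G \<Longrightarrow> g q (Y q) (Z q) = c"
  shows "g p (nabla X Y p) (Z p) = - g p (Y p) (nabla X Z p)"
proof -
  have "X p (\<lambda>q. g q (Y q) (Z q)) = X p (\<lambda>q. c)"
    using const top p by (intro tangent_vec_cong[OF grp(5) tangent[OF assms(1) p] openin_topspace]) simp_all
  then show ?thesis
    using nabla_metric[OF assms(1-4)] tangent_vec_const[OF grp(5) tangent[OF assms(1) p]] by simp
qed

text \<open>The Koszul formula, in the symmetrised form needed here: metric products of left-invariant fields are
constant, so only the bracket terms are left. The two parts express the second fundamental form through
derivatives of \<open>Z\<close> and of \<open>X\<close>, \<open>Y\<close> respectively.\<close>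

lemma koszul:
  assumes X: "X \<in> \<gg>" and Y: "Y \<in> \<gg>" and Z: "Z \<in> \<gg>" and p: "p \<in> carrier G"
  shows "g p (nabla X Z p) (Y p) + g p (nabla Y Z p) (X p) = - (h (br Z X) Y + h (br Z Y) X)"
    "g p (nabla X Y p + nabla Y X p) (Z p) = h (br Z X) Y + h (br Z Y) X"
proof -
  interpret gp: sym_form "tangent_space M p" "g p" by (rule metric_form[OF p])
  note t = tangent[OF vf p] and tn = tangent[OF nabla_vf[OF vf vf] p]
  have tors: "nabla A B p = nabla B A p + br A B p" if "A \<in> \<gg>" "B \<in> \<gg>" for A B
    using fun_cong[OF nabla_torsion_free[OF vf[OF that(1)] vf[OF that(2)]], of p] by (simp add: algebra_simps)
  have skew: "g p (nabla A B p) (D p) = - g p (nabla A D p) (B p)" if "A \<in> \<gg>" "B \<in> \<gg>" "D \<in> \<gg>" for A B D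
    using nabla_skew[OF vf[OF that(1)] vf[OF that(2)] vf[OF that(3)] p metric_const[OF that(2,3)]]
      gp.h_sym[OF t[OF that(2)] tn[OF that(1,3)]] by simp
  have br': "g p (br A Z p) (B p) = - h (br Z A) B" if "A \<in> \<gg>" "B \<in> \<gg>" for A B
    using metric_const[OF br_L[OF Z that(1)] that(2) p] br_antisym[OF that(1) Z]
      gp.h_scale[OF t[OF br_L[OF Z that(1)]] t[OF that(2)], of "- 1"] by simp
  have "g p (nabla X Z p) (Y p) = g p (nabla Z X p) (Y p) - h (br Z X) Y"
    unfolding tors[OF X Z] using gp.h_add[OF tn[OF Z X] t[OF br_L[OF X Z]] t[OF Y]] br'[OF X Y] by simp
  moreover have "g p (nabla Y Z p) (X p) = g p (nabla Z Y p) (X p) - h (br Z Y) X"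
    unfolding tors[OF Y Z] using gp.h_add[OF tn[OF Z Y] t[OF br_L[OF Y Z]] t[OF X]] br'[OF Y X] by simp
  ultimately show 1: "g p (nabla X Z p) (Y p) + g p (nabla Y Z p) (X p) = - (h (br Z X) Y + h (br Z Y) X)"
    using skew[OF Z X Y] by simp
  show "g p (nabla X Y p + nabla Y X p) (Z p) = h (br Z X) Y + h (br Z Y) X"
    using 1 gp.h_add[OF tn[OF X Y] tn[OF Y X] t[OF Z]] skew[OF X Y Z] skew[OF Y X Z] by simp
qed

text \<open>Evaluating the conformality condition at the identity on left-invariant horizontal fields suffices. The
conformal factor is the product with the value there of the vertical field \<open>W\<close> of the definition.\<close>

lemma conformal_imp_conformal_pair:
  assumes "conformal_foliation M g nabla \<V>"
  shows "\<exists>\<mu>. conformal_lie_pair \<gg> h \<kk> br C E \<mu>"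
proof -
  obtain W where W: "is_section M \<V> W" and conf: "\<And>X Y p. is_section M \<H> X \<Longrightarrow> is_section M \<H> Y \<Longrightarrow>
      p \<in> topspace (mtop M) \<Longrightarrow> second_form_hor M g nabla \<V> X Y p = g p (X p) (Y p) *\<^sub>R W p"
    using assms unfolding conformal_foliation_def by blast
  let ?e = "\<one>\<^bsub>G\<^esub>"
  interpret g1: sym_form "tangent_space M ?e" "g ?e" by (rule metric_form[OF one_closed])
  note t = tangent[OF vf one_closed]
  have Wt: "W ?e \<in> tangent_space M ?e"
    using W tangent[OF _ one_closed] by (simp add: is_section_def)
  have sec: "is_section M \<H> X" if "X \<in> H" for X
    using that vf[OF HL[OF that]] complement_at top by (auto simp: is_section_def)
  have "h (br V X) Y + h (br V Y) X = 2 * (h X Y * g ?e (V ?e) (W ?e))"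
    if V: "V \<in> \<kk>" and X: "X \<in> H" and Y: "Y \<in> H" for V X Y
  proof -
    note L = HL[OF X] HL[OF Y] KL'[OF V]
    let ?S = "nabla X Y + nabla Y X"
    have S: "vector_field M ?S"
      using nabla_vf[OF vf[OF L(1)] vf[OF L(2)]] nabla_vf[OF vf[OF L(2)] vf[OF L(1)]]
      by (rule vector_field_add[OF grp(2)])
    obtain Z where Z: "Z \<in> \<gg>" "Z ?e = ?S ?e" using left_invariant_through[OF lie one_closed tangent[OF S one_closed]] .
    obtain A B where AB: "A \<in> \<kk>" "B \<in> H" "Z = A + B" using orthogonal_splitting[OF Z(1)] .
    have "proj_along (\<V> ?e) (\<H> ?e) (?S ?e) = A ?e"
      by (rule projections_at(1)[OF one_closed AB(1,2)]) (use Z(2) AB(3) in simp)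
    then have "(1/2) *\<^sub>R A ?e = h X Y *\<^sub>R W ?e"
      using conf[OF sec[OF X] sec[OF Y] one_in_topspace[OF lie]]
      by (simp add: second_form_hor_def scaleR_fun_apply vert_proj_def h_def)
    then have "g ?e (V ?e) ((1/2) *\<^sub>R A ?e) = g ?e (V ?e) (h X Y *\<^sub>R W ?e)" by simp
    then have "h V A = 2 * (h X Y * g ?e (V ?e) (W ?e))"
      using g1.h_scale_right[OF t[OF KL'[OF AB(1)]] t[OF L(3)]] g1.h_scale_right[OF Wt t[OF L(3)]]
      by (simp add: h_def)
    moreover have "h V A = h V Z"
      using h_add_right[OF KL'[OF AB(1)] HL[OF AB(2)] L(3)] KH[OF V AB(2)] AB(3) by simp
    moreover have "h V Z = h (br V X) Y + h (br V Y) X"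
      using koszul(2)[OF L one_closed] Z(2) g1.h_sym[OF t[OF L(3)] t[OF Z(1)]] by (simp add: h_def)
    ultimately show ?thesis by simp
  qed
  then have "conformal_lie_pair \<gg> h \<kk> br C E (\<lambda>V. g ?e (V ?e) (W ?e))"
    by unfold_locales
  then show ?thesis by blast
qed

subsection \<open>Sections of the foliation\<close>

lemma vf_sum_apply: "finite I \<Longrightarrow> (\<Sum>i\<in>I. F i :: 'a vfield) p = (\<Sum>i\<in>I. F i p)"
  by (induction I rule: finite_induct) auto

lemma nabla_sum:
  assumes "finite I" "\<And>i. i \<in> I \<Longrightarrow> vector_field M (F i)" and Y: "vector_field M Y"
  shows "nabla (\<Sum>i\<in>I. F i) Y = (\<Sum>i\<in>I. nabla (F i) Y)"
  using assms(1,2)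
proof (induction I rule: finite_induct)
  case empty
  have "nabla (0 + 0) Y = nabla 0 Y + nabla 0 Y"
    by (rule nabla_add[OF vector_field_zero[OF grp(2)] vector_field_zero[OF grp(2)] Y])
  then have "nabla 0 Y = 0" by simp
  then show ?case by (simp only: sum.empty)
next
  case (insert i I)
  have F: "vector_field M (F i)" "\<And>j. j \<in> I \<Longrightarrow> vector_field M (F j)"
    using insert.prems by simp_all
  have "nabla (F i + sum F I) Y = nabla (F i) Y + nabla (sum F I) Y"
    by (rule nabla_add[OF F(1) vector_field_sum[OF grp(2) insert.hyps(1) F(2)] Y])
  also have "nabla (sum F I) Y = (\<Sum>j\<in>I. nabla (F j) Y)"
    by (rule insert.IH[OF F(2)])
  finally show ?case by (simp only: sum.insert[OF insert.hyps])
qed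

text \<open>The connection is tensorial in its first argument. Only sections of the foliation are needed, and
for these the dual basis \<open>z\<close> gives a global expansion with smooth coefficients \<open>g (z c) U\<close> in the
left-invariant frame \<open>C\<close>, without bump functions.\<close>

lemma nabla_section:
  assumes W: "is_section M \<V> W" and V: "V \<in> \<kk>" and p: "p \<in> carrier G" and WV: "W p = V p"
    and Y: "vector_field M Y"
  shows "nabla W Y p = nabla V Y p"
proof -
  obtain z where z': "\<forall>c\<in>C. z c \<in> \<kk>" "\<forall>v\<in>\<kk>. (\<Sum>c\<in>C. h (z c) v *\<^sub>R c) = v"
    by (rule dual_basis)
  note z = bspec[OF z'(1)] bspec[OF z'(2)]
  have CK: "c \<in> \<kk>" if "c \<in> C" for c using C(3) span_base[OF that] by blast
  have frame: "nabla U Y p = (\<Sum>c\<in>C. g p (z c p) (U p) *\<^sub>R nabla c Y p)" if U: "is_section M \<V> U" for U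
  proof -
    have Uvf: "vector_field M U" using U by (simp add: is_section_def)
    define F where "F c = (\<lambda>q. g q (z c q) (U q) *\<^sub>R c q)" for c
    have sm: "smooth_fun M (topspace (mtop M)) (\<lambda>q. g q (z c q) (U q))" if "c \<in> C" for c
      by (rule semi_riemannian_metricD(3)[OF metric vf[OF k_g[OF z(1)[OF that]]] Uvf])
    have Fvf: "vector_field M (F c)" if "c \<in> C" for c
      unfolding F_def by (rule vector_field_mult[OF grp(2) vf[OF k_g[OF CK[OF that]]] sm[OF that]])
    have "U q = (\<Sum>c\<in>C. F c) q" for q
    proof (cases "q \<in> carrier G")
      case True
      then have "U q \<in> \<V> q" using U top by (simp add: is_section_def)
      then obtain v where v: "v \<in> \<kk>" "U q = v q" by (auto simp: foliation_at)
      have "(\<Sum>c\<in>C. F c) q = (\<Sum>c\<in>C. h (z c) v *\<^sub>R c q)"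
        unfolding vf_sum_apply[OF C(1)] F_def v(2)
        using metric_const[OF k_g[OF z(1)] k_g[OF v(1)] True] by (intro sum.cong refl) simp
      also have "\<dots> = (\<Sum>c\<in>C. h (z c) v *\<^sub>R c) q"
        unfolding vf_sum_apply[OF C(1)] by (intro sum.cong refl) (simp add: scaleR_fun_apply)
      finally show ?thesis using z(2)[OF v(1)] v(2) by simp
    next
      case False
      then have q: "q \<notin> topspace (mtop M)" using top by simp
      show ?thesis
        unfolding vector_fieldD(2)[OF Uvf q] vf_sum_apply[OF C(1)]
        using vector_fieldD(2)[OF Fvf q] by simp
    qed
    then have "U = (\<Sum>c\<in>C. F c)" by (rule ext)
    then have "nabla U Y = (\<Sum>c\<in>C. nabla (F c) Y)" using nabla_sum[OF C(1) Fvf Y] by simp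
    also have "\<dots> = (\<Sum>c\<in>C. (\<lambda>q. g q (z c q) (U q) *\<^sub>R nabla c Y q))"
      unfolding F_def by (intro sum.cong refl nabla_mult sm vf k_g CK Y)
    finally show ?thesis by (simp add: vf_sum_apply[OF C(1)])
  qed
  have "is_section M \<V> V" using V vf[OF k_g[OF V]] by (auto simp: is_section_def foliation_at)
  then show ?thesis using frame[OF W] frame WV by simp
qed

text \<open>For horizontal left-invariant \<open>y\<close> the products \<open>g V y\<close> and \<open>g W y\<close> vanish, so the derivative can be moved
from \<open>V\<close>, \<open>W\<close> to \<open>y\<close>. The result depends on the values of \<open>V\<close> and \<open>W\<close> at \<open>p\<close> alone and is given by the
Koszul formula for left-invariant fields, where it vanishes because \<open>ad y\<close> is skew on the subgroup
algebra.\<close>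

lemma conformal_imp_totally_geodesic:
  assumes "conformal_foliation M g nabla \<V>"
  shows "totally_geodesic_foliation M g nabla \<V>"
  unfolding totally_geodesic_foliation_def
proof (intro allI impI ballI; elim conjE)
  fix V W p assume V: "is_section M \<V> V" and W: "is_section M \<V> W" and "p \<in> topspace (mtop M)"
  then have p: "p \<in> carrier G" by (simp add: top)
  obtain \<mu> where "conformal_lie_pair \<gg> h \<kk> br C E \<mu>"
    using conformal_imp_conformal_pair[OF assms] by blast
  then interpret conformal_lie_pair \<gg> h \<kk> br C E \<mu> .
  interpret gp: sym_form "tangent_space M p" "g p" by (rule metric_form[OF p])
  have Vvf: "vector_field M V" and Wvf: "vector_field M W" using V W by (simp_all add: is_section_def)
  obtain v where v: "v \<in> \<kk>" "V p = v p" using V p top by (auto simp: is_section_def foliation_at)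
  obtain w where w: "w \<in> \<kk>" "W p = w p" using W p top by (auto simp: is_section_def foliation_at)
  let ?S = "nabla V W + nabla W V"
  have S: "vector_field M ?S" by (intro vector_field_add[OF grp(2)] nabla_vf Vvf Wvf)
  obtain Z where Z: "Z \<in> \<gg>" "Z p = ?S p" using left_invariant_through[OF lie p tangent[OF S p]] .
  obtain A B where AB: "A \<in> \<kk>" "B \<in> H" "Z = A + B" using orthogonal_splitting[OF Z(1)] .
  have orth: "g p (?S p) (y p) = 0" if y: "y \<in> H" for y
  proof -
    note yvf = vf[OF HL[OF y]] and yt = tangent[OF vf[OF HL[OF y]] p]
    have 0: "g q (U q) (y q) = 0" if U: "is_section M \<V> U" and q: "q \<in> carrier G" for U q
    proof -
      obtain u where u: "u \<in> \<kk>" "U q = u q" using U q top by (auto simp: is_section_def foliation_at)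
      then show ?thesis using metric_const[OF k_g[OF u(1)] HL[OF y] q] KH[OF u(1) y] by simp
    qed
    have "g p (?S p) (y p) = g p (nabla V W p) (y p) + g p (nabla W V p) (y p)"
      using gp.h_add[OF tangent[OF nabla_vf[OF Vvf Wvf] p] tangent[OF nabla_vf[OF Wvf Vvf] p] yt] by simp
    also have "\<dots> = - g p (W p) (nabla V y p) - g p (V p) (nabla W y p)"
      using nabla_skew[OF Vvf Wvf yvf p 0[OF W]] nabla_skew[OF Wvf Vvf yvf p 0[OF V]] by simp
    also have "\<dots> = - (g p (nabla v y p) (w p) + g p (nabla w y p) (v p))"
      using nabla_section[OF V v(1) p v(2) yvf] nabla_section[OF W w(1) p w(2) yvf] v(2) w(2)
        gp.h_sym[OF tangent[OF vf[OF k_g[OF w(1)]] p] tangent[OF nabla_vf[OF vf[OF k_g[OF v(1)]] yvf] p]]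
        gp.h_sym[OF tangent[OF vf[OF k_g[OF v(1)]] p] tangent[OF nabla_vf[OF vf[OF k_g[OF w(1)]] yvf] p]]
      by simp
    also have "\<dots> = h (br y v) w + h (br y w) v"
      using koszul(1)[OF k_g[OF v(1)] k_g[OF w(1)] HL[OF y] p] by simp
    also have "\<dots> = 0"
      using complement_acts_skew[OF y v(1) w(1)] h_sym[OF KL'[OF v(1)] br_L[OF HL[OF y] KL'[OF w(1)]]] by simp
    finally show ?thesis .
  qed
  have "B = 0"
  proof (rule nondegenerate_H[OF AB(2)])
    fix y assume y: "y \<in> H"
    have "h B y = h Z y"
      using AB h_add[OF KL'[OF AB(1)] HL[OF AB(2)] HL[OF y]] KH[OF AB(1) y] by simp
    also have "\<dots> = 0" using metric_const[OF Z(1) HL[OF y] p] Z(2) orth[OF y] by simp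
    finally show "h B y = 0" .
  qed
  moreover have "proj_along (\<H> p) (\<V> p) (?S p) = B p"
    by (rule projections_at(2)[OF p AB(1,2)]) (use Z(2) AB(3) in simp)
  ultimately have "proj_along (\<H> p) (\<V> p) (?S p) = 0" by simp
  then show "second_form_vert M g nabla \<V> V W p = 0"
    by (simp add: second_form_vert_def scaleR_fun_apply hor_proj_def)
qed

end

theorem theorem1p3:
  fixes G :: "'a monoid"
    and M :: "('a, 'e::euclidean_space) mfd"
    and K :: "'a set"
    and N :: "('a, 'f::real_normed_vector) mfd"
    and g :: "'a metric_field"
    and nabla :: "'a vfield \<Rightarrow> 'a vfield \<Rightarrow> 'a vfield"
  assumes "lie_group G M"
    and "lie_subgroup G M K N"
    and "semisimple_lie_group (G\<lparr>carrier := K\<rparr>) N"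
    and "DIM('e) = dim (UNIV :: 'f set) + 2"
    and "semi_riemannian_metric M g"
    and "left_invariant_metric G M g"
    and "semi_riemannian_metric N (pullback_metric M id g)"
    and "\<And>V W. \<lbrakk>V \<in> subgroup_algebra G M K N; W \<in> subgroup_algebra G M K N\<rbrakk> \<Longrightarrow>
           g \<one>\<^bsub>G\<^esub> (V \<one>\<^bsub>G\<^esub>) (W \<one>\<^bsub>G\<^esub>) =
             - killing_form (lie_bracket M) (subgroup_algebra G M K N) V W"
    and "levi_civita_connection M g nabla"
    and "conformal_foliation M g nabla (subgroup_foliation G M K N)"
  shows "totally_geodesic_foliation M g nabla (subgroup_foliation G M K N)"
proof -
  interpret killing_foliation G M K N g nabla
  proof
    show "dim (UNIV :: 'e set) \<le> dim (UNIV :: 'f set) + 2" using assms(4) by simp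
  qed (fact assms)+
  obtain C E where "lie_pair \<gg> h \<kk> br C E" using ex_lie_pair by blast
  then interpret lp: lie_pair \<gg> h \<kk> br C E .
  interpret killing_foliation_basis G M K N g nabla C E ..
  show ?thesis by (rule conformal_imp_totally_geodesic[OF assms(10)])
qed

end
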